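(* Let $X=V(f)\subseteq\mathbb{P}^3$ be a cubic surface over $\mathbb{C}$ with isolated singularities, and let $\Phi(f):\mathbb{P}^{3*}\dashrightarrow\mathcal{M}(3,2)$ be its hyperplane-section map. If $X$ is not a cone, then $\Phi(f)$ has maximal rank; in particular, it is not generically finite onto its image. If $X$ is a cone, then $\Phi(f)$ is constant.
   Context: $f\in\mathbb{C}[x_0,\ldots,x_3]$ is a homogeneous cubic polynomial defining $X$. "With isolated singularities" means at most isolated singularities. $X$ is a cone if, after a linear change of coordinates, $f$ does not depend on all the variables. $\mathcal{M}(3,2)$ is the coarse moduli space of smooth cubic curves in $\mathbb{P}^2$, i.e. the geometric (GIT) quotient by $PGL_3(\mathbb{C})$ of the open subset of $\mathbb{P}(\mathbb{C}[x_1,x_2,x_3]_3)$ parametrizing smooth cubics; $\dim\mathcal{M}(3,2)=1$. $U_f=\{H\in\mathbb{P}^{3*}\mid X\cap H\text{ is smooth}\}$ is nonempty and Zariski open, and $\Phi(f)$ is the rational map given on $U_f$ by $H\mapsto[X\cap H]$, where $X\cap H\subseteq H\simeq\mathbb{P}^2$. It has maximal rank if $\dim\operatorname{Im}\Phi(f)=\min\{3,\dim\mathcal{M}(3,2)\}=1$. It is generically finite onto its image if the general fiber of $\mathbb{P}^{3*}\dashrightarrow\operatorname{Im}\Phi(f)$ is finite, equivalently $\dim\operatorname{Im}\Phi(f)=3$. *)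

theory Defs
  imports
    "HOL-Analysis.Analysis"
    "HOL-Library.Poly_Mapping"
    "HOL-Library.Extended_Nat"
begin

section \<open>Polynomials over the complex numbers\<close>

text \<open>
  A polynomial with variables indexed by \<open>'v\<close> is a finitely supported map from exponents
  \<open>'v \<Rightarrow>\<^sub>0 nat\<close> to coefficients; the ring structure is the one of Poly_Mapping.
\<close>

type_synonym 'v mpoly = "('v \<Rightarrow>\<^sub>0 nat) \<Rightarrow>\<^sub>0 complex"

definition exponent_degree :: "('v \<Rightarrow>\<^sub>0 nat) \<Rightarrow> nat" where
  "exponent_degree m = (\<Sum>i\<in>Poly_Mapping.keys m. Poly_Mapping.lookup m i)"

definition homogeneous :: "nat \<Rightarrow> 'v mpoly \<Rightarrow> bool" where
  "homogeneous d p \<longleftrightarrow> (\<forall>m\<in>Poly_Mapping.keys p. exponent_degree m = d)"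

text \<open>
  Substitution of elements of a commutative ring for the variables, the coefficients being
  sent to that ring by \<open>h\<close>.
\<close>

definition insertion :: "(complex \<Rightarrow> 'b) \<Rightarrow> ('v \<Rightarrow> 'b) \<Rightarrow> 'v mpoly \<Rightarrow> 'b::comm_ring_1" where
  "insertion h \<phi> p = (\<Sum>m\<in>Poly_Mapping.keys p. h (Poly_Mapping.lookup p m) *
     (\<Prod>i\<in>Poly_Mapping.keys m. \<phi> i ^ Poly_Mapping.lookup m i))"

definition eval_poly :: "('v \<Rightarrow> complex) \<Rightarrow> 'v mpoly \<Rightarrow> complex" where
  "eval_poly a = insertion (\<lambda>c. c) a"

text \<open>\<open>linear_subst A p\<close> is \<open>p(A z)\<close>: the \<open>i\<close>-th variable is replaced by
  \<open>\<Sum>j. A $ i $ j * z\<^sub>j\<close>.\<close>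

definition linear_subst :: "complex^'m^'n \<Rightarrow> 'n mpoly \<Rightarrow> 'm::finite mpoly" where
  "linear_subst A =
     insertion (Poly_Mapping.single 0)
       (\<lambda>i. \<Sum>j\<in>UNIV. Poly_Mapping.single (Poly_Mapping.single j 1) (A $ i $ j))"

definition partial_deriv :: "'v \<Rightarrow> 'v mpoly \<Rightarrow> 'v mpoly" where
  "partial_deriv i p =
     (\<Sum>m\<in>Poly_Mapping.keys p. Poly_Mapping.single (m - Poly_Mapping.single i 1)
                                      (of_nat (Poly_Mapping.lookup m i) * Poly_Mapping.lookup p m))"

section \<open>Projective spaces and the Zariski topology\<close>

definition proj_point :: "('v \<Rightarrow> complex) \<Rightarrow> ('v \<Rightarrow> complex) set" where
  "proj_point a = {\<lambda>i. c * a i | c. c \<noteq> 0}"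

text \<open>
  The projective space with homogeneous coordinates indexed by the set \<open>I\<close>; a coordinate vector
  is extended by \<open>0\<close> outside \<open>I\<close>.
\<close>

definition proj_space :: "'v set \<Rightarrow> ('v \<Rightarrow> complex) set set" where
  "proj_space I = {proj_point a | a. a \<noteq> (\<lambda>_. 0) \<and> (\<forall>i. i \<notin> I \<longrightarrow> a i = 0)}"

text \<open>The distinguished open sets, the complements of the hypersurfaces \<open>F = 0\<close>, form a base.\<close>

definition zariski :: "'v set \<Rightarrow> ('v \<Rightarrow> complex) set topology" where
  "zariski I = topology_generated_by
     {{p \<in> proj_space I. \<forall>a\<in>p. eval_poly a F \<noteq> 0} | F d. homogeneous d F}"

lemma topspace_zariski: "topspace (zariski I) = proj_space I"
proof -
  let ?B = "{{p \<in> proj_space I. \<forall>a\<in>p. eval_poly a F \<noteq> 0} | F d. homogeneous d F}"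
  have "homogeneous 0 (1 :: 'a mpoly)" "eval_poly a 1 = 1" for a :: "'a \<Rightarrow> complex"
    by (auto simp: homogeneous_def exponent_degree_def eval_poly_def insertion_def)
  then have "{p \<in> proj_space I. \<forall>a\<in>p. eval_poly a (1 :: 'a mpoly) \<noteq> 0} \<in> ?B"
      and "{p \<in> proj_space I. \<forall>a\<in>p. eval_poly a (1 :: 'a mpoly) \<noteq> 0} = proj_space I"
    by (blast, simp)
  then have "\<Union>?B = proj_space I" by blast
  then show ?thesis by (simp add: zariski_def topology_generated_by_topspace)
qed

definition irreducible_in :: "'a topology \<Rightarrow> 'a set \<Rightarrow> bool" where
  "irreducible_in X S \<longleftrightarrow> S \<noteq> {} \<and> S \<subseteq> topspace X \<and>
     (\<forall>C D. closedin X C \<and> closedin X D \<and> S \<subseteq> C \<union> D \<longrightarrow> S \<subseteq> C \<or> S \<subseteq> D)"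

text \<open>Krull dimension; the empty space gets dimension \<open>0\<close>.\<close>

definition krull_dim :: "'a topology \<Rightarrow> enat" where
  "krull_dim X = Sup {enat n | n. \<exists>Z :: nat \<Rightarrow> 'a set.
     (\<forall>i\<le>n. closedin X (Z i) \<and> irreducible_in X (Z i)) \<and> (\<forall>i<n. Z i \<subset> Z (Suc i))}"

definition quotient_topology :: "'a topology \<Rightarrow> ('a \<times> 'a) set \<Rightarrow> 'a set topology" where
  "quotient_topology X R = topology (\<lambda>W. W \<subseteq> topspace X // R \<and>
     openin X {x \<in> topspace X. R `` {x} \<in> W})"

lemma openin_quotient_topology:
  "openin (quotient_topology X R) W \<longleftrightarrow>
     W \<subseteq> topspace X // R \<and> openin X {x \<in> topspace X. R `` {x} \<in> W}"
proof -
  have "istopology (\<lambda>W. W \<subseteq> topspace X // R \<and> openin X {x \<in> topspace X. R `` {x} \<in> W})"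
    unfolding istopology_def
  proof (intro conjI allI impI; (elim conjE)?)
    fix S T
    assume *: "openin X {x \<in> topspace X. R `` {x} \<in> S}" "openin X {x \<in> topspace X. R `` {x} \<in> T}"
    have "{x \<in> topspace X. R `` {x} \<in> S \<inter> T} =
        {x \<in> topspace X. R `` {x} \<in> S} \<inter> {x \<in> topspace X. R `` {x} \<in> T}" by blast
    then show "openin X {x \<in> topspace X. R `` {x} \<in> S \<inter> T}" using * by (simp add: openin_Int)
  next
    fix K assume *: "\<forall>S\<in>K. S \<subseteq> topspace X // R \<and> openin X {x \<in> topspace X. R `` {x} \<in> S}"
    have "{x \<in> topspace X. R `` {x} \<in> \<Union>K} = \<Union>((\<lambda>S. {x \<in> topspace X. R `` {x} \<in> S}) ` K)"
      by blast
    then show "openin X {x \<in> topspace X. R `` {x} \<in> \<Union>K}" using * by auto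
  qed blast+
  then show ?thesis by (simp add: quotient_topology_def)
qed

lemma quotient_map_quotient_topology:
  "quotient_map X (quotient_topology X R) (\<lambda>x. R `` {x})"
proof -
  have "openin (quotient_topology X R) (topspace X // R)"
  proof -
    have "{x \<in> topspace X. R `` {x} \<in> topspace X // R} = topspace X"
      by (auto simp: quotientI)
    then show ?thesis by (simp add: openin_quotient_topology)
  qed
  then have "topspace (quotient_topology X R) = topspace X // R"
    by (metis openin_quotient_topology openin_subset openin_topspace subset_antisym)
  then show ?thesis
    by (auto simp: quotient_map_def openin_quotient_topology quotient_def)
qed

section \<open>Singularities and cones\<close>

definition singular_locus :: "'n mpoly \<Rightarrow> ('n \<Rightarrow> complex) set set" where
  "singular_locus f = {proj_point a | a. a \<noteq> (\<lambda>_. 0) \<and> eval_poly a f = 0 \<and>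
     (\<forall>i. eval_poly a (partial_deriv i f) = 0)}"

abbreviation smooth_form :: "'n mpoly \<Rightarrow> bool" where
  "smooth_form f \<equiv> singular_locus f = {}"

definition isolated_singularities :: "'n mpoly \<Rightarrow> bool" where
  "isolated_singularities f \<longleftrightarrow>
     (\<forall>p\<in>singular_locus f. openin (subtopology (zariski UNIV) (singular_locus f)) {p})"

definition is_cone :: "'n::finite mpoly \<Rightarrow> bool" where
  "is_cone f \<longleftrightarrow> (\<exists>A :: complex^'n^'n. invertible A \<and>
     (\<exists>i. \<forall>m\<in>Poly_Mapping.keys (linear_subst A f). Poly_Mapping.lookup m i = 0))"

section \<open>The moduli space of smooth plane cubics\<close>

text \<open>
  \<open>\<P>(\<complex>[x\<^sub>1,x\<^sub>2,x\<^sub>3]\<^sub>3)\<close> is the projective space whose homogeneous coordinates, the coefficients of a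
  ternary cubic form, are indexed by the exponents of degree \<open>3\<close>.
\<close>

definition form_point :: "3 mpoly \<Rightarrow> ((3 \<Rightarrow>\<^sub>0 nat) \<Rightarrow> complex) set" where
  "form_point g = proj_point (Poly_Mapping.lookup g)"

definition smooth_cubics :: "((3 \<Rightarrow>\<^sub>0 nat) \<Rightarrow> complex) set set" where
  "smooth_cubics = {form_point g | g. g \<noteq> 0 \<and> homogeneous 3 g \<and> smooth_form g}"

definition smooth_cubics_top :: "((3 \<Rightarrow>\<^sub>0 nat) \<Rightarrow> complex) set topology" where
  "smooth_cubics_top = subtopology (zariski {m. exponent_degree m = 3}) smooth_cubics"

text \<open>Scalar matrices act trivially on points, so \<open>GL\<^sub>3\<close> and \<open>PGL\<^sub>3\<close> have the same orbits.\<close>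

definition pgl_rel :: "(((3 \<Rightarrow>\<^sub>0 nat) \<Rightarrow> complex) set \<times> ((3 \<Rightarrow>\<^sub>0 nat) \<Rightarrow> complex) set) set" where
  "pgl_rel = {(form_point g, form_point (linear_subst B g)) | g (B :: complex^3^3).
     g \<noteq> 0 \<and> homogeneous 3 g \<and> smooth_form g \<and> invertible B}"

text \<open>
  The points of the geometric quotient are the orbits, and its Zariski topology is the
  quotient topology.
\<close>

definition moduli_cubics :: "((3 \<Rightarrow>\<^sub>0 nat) \<Rightarrow> complex) set set topology" where
  "moduli_cubics = quotient_topology smooth_cubics_top pgl_rel"

section \<open>The hyperplane section map\<close>

text \<open>A point of the dual projective space is the class of the coefficients of a linear form.\<close>

definition hyperplane :: "(4 \<Rightarrow> complex) set \<Rightarrow> (complex^4) set" where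
  "hyperplane H = {x. \<forall>a\<in>H. (\<Sum>i\<in>UNIV. a i * x $ i) = 0}"

definition parametrizes :: "complex^3^4 \<Rightarrow> (4 \<Rightarrow> complex) set \<Rightarrow> bool" where
  "parametrizes A H \<longleftrightarrow> bij_betw (\<lambda>z. A *v z) UNIV (hyperplane H)"

text \<open>
  An equation of \<open>X \<inter> H\<close> in \<open>H \<simeq> \<P>\<^sup>2\<close>. Two choices of linear coordinates on \<open>H\<close> differ by an
  invertible matrix, so neither smoothness nor the class in the moduli space depends on it.
\<close>

definition section_form :: "4 mpoly \<Rightarrow> (4 \<Rightarrow> complex) set \<Rightarrow> 3 mpoly" where
  "section_form f H = linear_subst (SOME A. parametrizes A H) f"

definition smooth_sections :: "4 mpoly \<Rightarrow> (4 \<Rightarrow> complex) set set" where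
  "smooth_sections f = {H \<in> proj_space UNIV. smooth_form (section_form f H)}"

definition section_map ::
    "4 mpoly \<Rightarrow> (4 \<Rightarrow> complex) set \<Rightarrow> ((3 \<Rightarrow>\<^sub>0 nat) \<Rightarrow> complex) set set" where
  "section_map f H = pgl_rel `` {form_point (section_form f H)}"

definition section_image :: "4 mpoly \<Rightarrow> ((3 \<Rightarrow>\<^sub>0 nat) \<Rightarrow> complex) set set topology" where
  "section_image f = subtopology moduli_cubics (section_map f ` smooth_sections f)"

definition maximal_rank :: "4 mpoly \<Rightarrow> bool" where
  "maximal_rank f \<longleftrightarrow> krull_dim (section_image f) = min 3 (krull_dim moduli_cubics)"

text \<open>
  The image is irreducible, being the image of an open subset of the dual projective space, so
  its general points are those of some nonempty open subset.
\<close>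

definition generically_finite :: "4 mpoly \<Rightarrow> bool" where
  "generically_finite f \<longleftrightarrow> (\<exists>W. openin (section_image f) W \<and> W \<noteq> {} \<and>
     (\<forall>q\<in>W. finite {H \<in> smooth_sections f. section_map f H = q}))"

definition constant_section_map :: "4 mpoly \<Rightarrow> bool" where
  "constant_section_map f \<longleftrightarrow> (\<exists>q\<in>topspace moduli_cubics. section_map f ` smooth_sections f = {q})"

end

(*
  Only finitely many orbits of smooth plane cubics meet a proper closed invariant set, because a
  line of Weierstrass cubics meets every orbit, and orbits are closed, because the j-invariant is
  a quotient of Aronhold's invariants. So the moduli space carries the cofinite topology, and so
  does every subspace; an infinite subspace has dimension one, and everything reduces to showing
  that j takes two values on the smooth plane sections.

  A smooth plane section exists because tangent planes are values of the gradient of f on the null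
  set f = 0. In coordinates where such a section is w = 0, write f = g + wQ + w^2 m + k w^3. If j were
  constant, its differential at g would kill hQ for every linear form h; this forces Q to be a
  combination of the partial derivatives of g, and a shear makes Q = 0. Then h^2 m and k h^3 are the
  leading terms of the deformations w = th, so m = 0 and k = 0 in the same way, and f defines a cone.

  On a line of planes on which j is not constant, j takes all but finitely many values; hence a
  general fibre meets infinitely many lines through a fixed plane.
*)
theory Submission
  imports Defs "HOL-Computational_Algebra.Fundamental_Theorem_Algebra"
begin

section \<open>Polynomials and polynomial functions\<close>

text \<open>\<open>hQ\<close> killed for all \<open>h\<close> forces \<open>Q\<close> into the span
  of the partial derivatives because the kernel is the cubic part of the Jacobian ideal of
  \<open>g\<close>: modulo that ideal the graded dimensions are 1, 3, 3, 1, and the product pairs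
  degrees 1 and 2 perfectly. Squares and cubes of linear forms span, so the same pairing disposes of
  \<open>m\<close> and \<open>k\<close>. In Weierstrass coordinates this is a small linear system
  whose determinant is a multiple of 4a^3 + 27b^2.

  One obstacle is that j is critical along c4 = 0 and c6 = 0. Constancy of j is therefore used as a
  polynomial identity in \<open>t\<close>, which there forces c4 or c6 to vanish along the whole
  deformation, and the differential is replaced by 3 c6 dc4 - 2 c4 dc6.

  Another is the flex behind the Weierstrass form. Intersecting with the Hessian would need
  elimination; instead, projection from a point of the cubic makes it a double cover y^2 = quartic,
  and a flex becomes a root of a polynomial in one variable.

  Isolated singularities enter through countability: the planes through countably many singular
  points have measure zero, as do the tangent planes.\<close>

abbreviation "lookup \<equiv> Poly_Mapping.lookup"
abbreviation "keys \<equiv> Poly_Mapping.keys"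
abbreviation "single \<equiv> Poly_Mapping.single"
abbreviation pval :: "'n::finite mpoly \<Rightarrow> complex^'n \<Rightarrow> complex" where
  "pval p v \<equiv> eval_poly (($) v) p"

definition monom_val :: "('v \<Rightarrow> 'b) \<Rightarrow> ('v \<Rightarrow>\<^sub>0 nat) \<Rightarrow> 'b::comm_ring_1" where
  "monom_val \<phi> m = (\<Prod>i\<in>keys m. \<phi> i ^ lookup m i)"

lemma monom_val_superset:
  "finite K \<Longrightarrow> keys m \<subseteq> K \<Longrightarrow> monom_val \<phi> m = (\<Prod>i\<in>K. \<phi> i ^ lookup m i)"
  unfolding monom_val_def by (rule prod.mono_neutral_left) (auto simp: in_keys_iff)

lemma monom_val_UNIV:
  fixes m :: "'v::finite \<Rightarrow>\<^sub>0 nat"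
  shows "monom_val \<phi> m = (\<Prod>i\<in>UNIV. \<phi> i ^ lookup m i)"
  by (rule monom_val_superset) auto

lemma monom_val_0 [simp]: "monom_val \<phi> 0 = 1"
  by (simp add: monom_val_def)

lemma monom_val_single [simp]: "monom_val \<phi> (single i k) = \<phi> i ^ k"
  by (cases "k = 0") (auto simp: monom_val_def)

lemma monom_val_add: "monom_val \<phi> (m + n) = monom_val \<phi> m * monom_val \<phi> n"
proof -
  let ?K = "keys m \<union> keys n"
  have "keys (m + n) \<subseteq> ?K" by (rule keys_add)
  then show ?thesis
    by (simp add: monom_val_superset[of ?K] lookup_add power_add prod.distrib)
qed

lemma exponent_degree_superset:
  "finite K \<Longrightarrow> keys m \<subseteq> K \<Longrightarrow> exponent_degree m = (\<Sum>i\<in>K. lookup m i)"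
  unfolding exponent_degree_def by (rule sum.mono_neutral_left) (auto simp: in_keys_iff)

lemma exponent_degree_0 [simp]: "exponent_degree 0 = 0"
  by (simp add: exponent_degree_def)

lemma exponent_degree_single [simp]: "exponent_degree (single i k) = k"
  by (cases "k = 0") (auto simp: exponent_degree_def)

lemma exponent_degree_add: "exponent_degree (m + n) = exponent_degree m + exponent_degree n"
proof -
  let ?K = "keys m \<union> keys n"
  have "keys (m + n) \<subseteq> ?K" by (rule keys_add)
  then show ?thesis
    by (simp add: exponent_degree_superset[of ?K] lookup_add sum.distrib)
qed

lemma insertion_superset:
  assumes "finite K" "keys p \<subseteq> K" "h 0 = 0"
  shows "insertion h \<phi> p = (\<Sum>m\<in>K. h (lookup p m) * monom_val \<phi> m)"
  unfolding insertion_def monom_val_def[symmetric]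
  using assms by (intro sum.mono_neutral_left) (auto simp: in_keys_iff)

lemma poly_mapping_sum_singles:
  "(\<Sum>m\<in>keys p. single m (lookup p m)) = p"
  by (rule poly_mapping_eqI)
     (simp add: lookup_sum lookup_single when_def in_keys_iff sum.delta)

text \<open>One locale for three kinds of substitution: values in the complex numbers, restriction
  to a curve (coefficients become constant univariate polynomials) and linear substitution
  (coefficients become constant polynomials).\<close>

locale coeff_hom =
  fixes h :: "complex \<Rightarrow> 'b::comm_ring_1"
  assumes hom_add: "h (a + b) = h a + h b"
    and hom_mult: "h (a * b) = h a * h b"
    and hom_one: "h 1 = 1"
begin

lemma hom_zero: "h 0 = 0"
  using hom_add[of 0 0] by simp

lemma insertion_zero [simp]: "insertion h \<phi> 0 = 0"
  by (simp add: insertion_def)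

lemma insertion_single [simp]: "insertion h \<phi> (single m c) = h c * monom_val \<phi> m"
  using insertion_superset[of "{m}" "single m c" h \<phi>] hom_zero by simp

lemma insertion_one [simp]: "insertion h \<phi> 1 = 1"
  using insertion_single[of \<phi> 0 1] by (simp add: hom_one)

lemma insertion_add: "insertion h \<phi> (p + q) = insertion h \<phi> p + insertion h \<phi> q"
proof -
  let ?K = "keys p \<union> keys q"
  have "keys (p + q) \<subseteq> ?K" by (rule keys_add)
  then show ?thesis
    using hom_zero
    by (simp add: insertion_superset[of ?K] lookup_add hom_add distrib_right sum.distrib)
qed

lemma insertion_sum: "insertion h \<phi> (\<Sum>x\<in>A. p x) = (\<Sum>x\<in>A. insertion h \<phi> (p x))"
  by (induction A rule: infinite_finite_induct) (auto simp: insertion_add)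

lemma insertion_mult: "insertion h \<phi> (p * q) = insertion h \<phi> p * insertion h \<phi> q"
proof -
  have "p * q = (\<Sum>m\<in>keys p. \<Sum>n\<in>keys q.
      single (m + n) (lookup p m * lookup q n))"
    by (subst (1) poly_mapping_sum_singles[of p, symmetric],
        subst (1) poly_mapping_sum_singles[of q, symmetric])
       (simp add: sum_product mult_single)
  then show ?thesis
    by (simp add: insertion_sum hom_mult monom_val_add insertion_def[of h \<phi> p]
        insertion_def[of h \<phi> q] sum_product flip: monom_val_def) (simp add: mult_ac)
qed

lemma insertion_power: "insertion h \<phi> (p ^ n) = insertion h \<phi> p ^ n"
  by (induction n) (auto simp: insertion_mult)

lemma insertion_prod: "insertion h \<phi> (\<Prod>x\<in>A. p x) = (\<Prod>x\<in>A. insertion h \<phi> (p x))"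
  by (induction A rule: infinite_finite_induct) (auto simp: insertion_mult)

end

interpretation coeff_id: coeff_hom "\<lambda>c. c"
  by unfold_locales auto

interpretation coeff_poly: coeff_hom "\<lambda>c. [:c:]"
  by unfold_locales (auto simp: one_pCons)

interpretation coeff_const: coeff_hom "single 0 :: complex \<Rightarrow> 'v mpoly"
  by unfold_locales (auto simp: single_add mult_single)

lemmas eval_poly_add = coeff_id.insertion_add[folded eval_poly_def]
lemmas eval_poly_mult = coeff_id.insertion_mult[folded eval_poly_def]
lemmas eval_poly_power = coeff_id.insertion_power[folded eval_poly_def]
lemmas eval_poly_simps [simp] =
  coeff_id.insertion_zero[folded eval_poly_def] coeff_id.insertion_single[folded eval_poly_def]
  coeff_id.insertion_sum[folded eval_poly_def] coeff_id.insertion_prod[folded eval_poly_def]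
  eval_poly_add eval_poly_mult eval_poly_power

lemma eval_poly_diff: "eval_poly a (p - q) = eval_poly a p - eval_poly a q"
  using eval_poly_add[of a "p - q" q] by (simp del: eval_poly_simps)

lemma eval_poly_uminus: "eval_poly a (- p) = - eval_poly a p"
  using eval_poly_diff[of a 0 p] by simp

lemma eval_poly_numeral: "eval_poly a (numeral k) = numeral k"
  using eval_poly_simps(2)[of a 0 "numeral k"] by simp

lemma eval_poly_monom_val:
  "eval_poly a p = (\<Sum>m\<in>keys p. lookup p m * monom_val a m)"
  by (simp add: eval_poly_def insertion_def monom_val_def)

lemma poly_insertion:
  "poly (insertion (\<lambda>c. [:c:]) \<phi> p) t = eval_poly (\<lambda>i. poly (\<phi> i) t) p"
  by (simp add: eval_poly_def insertion_def poly_sum poly_prod)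

lemma eval_linear_subst:
  "pval (linear_subst A p) z = pval p (A *v z)"
proof -
  have "linear_subst A p = (\<Sum>m\<in>keys p. single 0 (lookup p m) *
     (\<Prod>i\<in>keys m. (\<Sum>j\<in>UNIV. single (single j 1) (A $ i $ j))
        ^ lookup m i))"
    by (simp add: linear_subst_def insertion_def)
  then show ?thesis
    by (simp add: eval_poly_monom_val[of _ p] monom_val_def matrix_vector_mult_def)
qed

text \<open>Distinct monomials are distinct multiplicative characters, and characters are linearly
  independent by Dedekind's argument.\<close>

lemma monomials_independent:
  fixes c :: "('v \<Rightarrow>\<^sub>0 nat) \<Rightarrow> complex"
  assumes "finite K" "\<And>a. (\<Sum>m\<in>K. c m * monom_val a m) = 0" "m \<in> K"
  shows "c m = 0"
  using assms
proof (induction K arbitrary: c m rule: finite_induct)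
  case (insert k K)
  have old: "c n = 0" if "n \<in> K" for n
  proof -
    have "n \<noteq> k" using that insert by auto
    then obtain i where i: "lookup n i \<noteq> lookup k i"
      by (metis poly_mapping_eqI)
    \<comment> \<open>Doubling \<open>a i\<close> multiplies the monomial \<open>m\<close> by
      \<open>2 ^ lookup m i\<close>. The relation at the doubled point minus
      \<open>2 ^ lookup k i\<close> times the relation itself loses \<open>k\<close> but keeps
      \<open>n\<close>.\<close>
    define d where "d m = c m * (2 ^ lookup m i - 2 ^ lookup k i)" for m
    have scale: "monom_val (a(i := 2 * a i)) m = 2 ^ lookup m i * monom_val a m"
      for a :: "'v \<Rightarrow> complex" and m
    proof -
      let ?K = "insert i (keys m)"
      have "(\<Prod>j\<in>?K. (a(i := 2 * a i)) j ^ lookup m j) =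
          (2 * a i) ^ lookup m i * (\<Prod>j\<in>?K - {i}. a j ^ lookup m j)"
        by (subst prod.remove[of _ i]) auto
      also have "\<dots> = 2 ^ lookup m i * (\<Prod>j\<in>?K. a j ^ lookup m j)"
        by (subst (2) prod.remove[of _ i]) (auto simp: power_mult_distrib)
      finally show ?thesis
        by (simp add: monom_val_superset[of ?K] subset_insertI)
    qed
    have "(\<Sum>m\<in>K. d m * monom_val a m) = 0" for a
    proof -
      have "0 = (\<Sum>m\<in>insert k K. c m * monom_val (a(i := 2 * a i)) m)
               - 2 ^ lookup k i * (\<Sum>m\<in>insert k K. c m * monom_val a m)"
        by (simp only: insert.prems) simp
      also have "\<dots> = (\<Sum>m\<in>insert k K. d m * monom_val a m)"
        unfolding scale d_def sum_distrib_left sum_subtractf[symmetric]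
        by (rule sum.cong) (auto simp: algebra_simps)
      also have "\<dots> = (\<Sum>m\<in>K. d m * monom_val a m)"
        using insert.hyps by (simp add: d_def)
      finally show ?thesis by simp
    qed
    from insert.IH[OF this that] have "d n = 0" .
    moreover have "(2::complex) ^ lookup n i \<noteq> 2 ^ lookup k i"
    proof
      assume "(2::complex) ^ lookup n i = 2 ^ lookup k i"
      then have "of_nat (2 ^ lookup n i) = (of_nat (2 ^ lookup k i) :: complex)"
        by simp
      then show False using i by (simp only: of_nat_eq_iff) simp
    qed
    ultimately show ?thesis by (simp add: d_def)
  qed
  have "c k = 0"
    using insert.prems(1)[of "\<lambda>_. 1"] insert.hyps old by (simp add: monom_val_def)
  with old insert.prems show ?case by auto
qed simp

text \<open>This allows later identities between polynomials, such as composition of substitutions,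
  to be checked pointwise.\<close>

lemma eval_poly_eq_imp_eq:
  assumes "\<And>a. eval_poly a p = eval_poly a q"
  shows "p = q"
proof (rule poly_mapping_eqI)
  fix m
  let ?K = "insert m (keys p \<union> keys q)"
  have "(\<Sum>m\<in>?K. (lookup p m - lookup q m) * monom_val a m) = 0" for a
  proof -
    have "eval_poly a p = (\<Sum>m\<in>?K. lookup p m * monom_val a m)"
      and "eval_poly a q = (\<Sum>m\<in>?K. lookup q m * monom_val a m)"
      unfolding eval_poly_def by (rule insertion_superset; auto)+
    then have "(\<Sum>m\<in>?K. lookup p m * monom_val a m) = (\<Sum>m\<in>?K. lookup q m * monom_val a m)"
      using assms[of a] by (simp only:)
    then show ?thesis by (simp only: left_diff_distrib sum_subtractf) simp
  qed
  from monomials_independent[OF _ this, of m]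
  show "lookup p m = lookup q m" by simp
qed

lemma eval_poly_vec_eq_imp_eq:
  fixes p q :: "'n::finite mpoly"
  assumes "\<And>v. pval p v = pval q v"
  shows "p = q"
proof (rule eval_poly_eq_imp_eq)
  fix a :: "'n \<Rightarrow> complex"
  have "a = ($) (\<chi> i. a i)" by auto
  then show "eval_poly a p = eval_poly a q" using assms by metis
qed

lemma linear_subst_compose:
  "linear_subst B (linear_subst A p) = linear_subst (A ** B) p"
  by (rule eval_poly_vec_eq_imp_eq)
     (simp add: eval_linear_subst matrix_vector_mul_assoc)

lemma linear_subst_mat_1: "linear_subst (mat 1) p = p"
  by (rule eval_poly_vec_eq_imp_eq) (simp add: eval_linear_subst)

section \<open>Homogeneous polynomials\<close>

lemma homogeneous_0 [simp]: "homogeneous d 0"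
  by (simp add: homogeneous_def)

lemma homogeneous_add: "homogeneous d p \<Longrightarrow> homogeneous d q \<Longrightarrow> homogeneous d (p + q)"
  unfolding homogeneous_def using keys_add[of p q] by blast

lemma homogeneous_sum: "(\<And>x. x \<in> A \<Longrightarrow> homogeneous d (p x)) \<Longrightarrow> homogeneous d (\<Sum>x\<in>A. p x)"
  by (induction A rule: infinite_finite_induct) (auto intro: homogeneous_add)

lemma homogeneous_single: "homogeneous (exponent_degree m) (single m c)"
  by (simp add: homogeneous_def)

lemma homogeneous_1 [simp]: "homogeneous 0 1"
  using homogeneous_single[of 0 1] by simp

lemma homogeneous_mult: "homogeneous d p \<Longrightarrow> homogeneous e q \<Longrightarrow> homogeneous (d + e) (p * q)"
  unfolding homogeneous_def using keys_mult[of p q] by (fastforce simp: exponent_degree_add)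

lemma homogeneous_power: "homogeneous d p \<Longrightarrow> homogeneous (k * d) (p ^ k)"
  by (induction k) (auto intro: homogeneous_mult)

lemma homogeneous_prod:
  "(\<And>x. x \<in> A \<Longrightarrow> homogeneous (d x) (p x)) \<Longrightarrow> homogeneous (\<Sum>x\<in>A. d x) (\<Prod>x\<in>A. p x)"
  by (induction A rule: infinite_finite_induct) (auto intro: homogeneous_mult)

lemma homogeneous_linear_subst:
  assumes "homogeneous d p"
  shows "homogeneous d (linear_subst A p)"
  unfolding linear_subst_def insertion_def
proof (rule homogeneous_sum)
  fix m assume m: "m \<in> keys p"
  have lin: "homogeneous 1 (\<Sum>j\<in>UNIV. single (single j 1) (A $ i $ j))" for i
  proof (rule homogeneous_sum)
    fix j
    show "homogeneous 1 (single (single j 1) (A $ i $ j))"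
      using homogeneous_single[of "single j 1" "A $ i $ j"] by simp
  qed
  have "homogeneous (0 + (\<Sum>i\<in>keys m. lookup m i * 1))
     (single 0 (lookup p m) *
        (\<Prod>i\<in>keys m. (\<Sum>j\<in>UNIV. single (single j 1) (A $ i $ j))
            ^ lookup m i))"
    using homogeneous_single[of 0 "lookup p m"]
    by (intro homogeneous_mult homogeneous_prod homogeneous_power lin) auto
  then show "homogeneous d (single 0 (lookup p m) *
        (\<Prod>i\<in>keys m. (\<Sum>j\<in>UNIV. single (single j 1) (A $ i $ j))
            ^ lookup m i))"
    using assms m by (simp add: homogeneous_def exponent_degree_def)
qed

lemma eval_poly_scale:
  assumes "homogeneous d p"
  shows "eval_poly (\<lambda>i. c * a i) p = c ^ d * eval_poly a p"
proof -
  have "monom_val (\<lambda>i. c * a i) m = c ^ exponent_degree m * monom_val a m" for m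
    by (simp add: monom_val_def exponent_degree_def power_mult_distrib prod.distrib power_sum)
  then show ?thesis
    using assms unfolding eval_poly_monom_val sum_distrib_left homogeneous_def
    by (intro sum.cong) (auto simp: mult_ac)
qed

lemma eval_poly_zero:
  assumes "homogeneous d p" "d > 0"
  shows "eval_poly (\<lambda>i. 0) p = 0"
  using eval_poly_scale[OF assms(1), of 0 "\<lambda>_. 0"] assms(2) by (simp add: power_0_left)

section \<open>Derivatives of polynomial functions\<close>

lemma has_derivative_eval_poly:
  fixes p :: "'n::finite mpoly"
  shows "((\<lambda>v. pval p v) has_derivative
    (\<lambda>u. \<Sum>i\<in>UNIV. u $ i * pval (partial_deriv i p) v)) (at v)"
proof -
  let ?l = "lookup"
  \<comment> \<open>If \<open>i\<close> does not occur in \<open>m\<close>, truncated subtraction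
    leaves \<open>m\<close> unchanged on both sides; the factor \<open>lookup m i\<close> kills that
    term in \<open>deriv\<close>.\<close>
  have val: "monom_val (($) v) (m - single i 1) =
      v $ i ^ (?l m i - 1) * (\<Prod>j\<in>UNIV - {i}. v $ j ^ ?l m j)" for m i
    unfolding monom_val_UNIV
    by (subst prod.remove[of _ i]) (auto simp: lookup_minus lookup_single when_def intro!: prod.cong)
  have deriv: "((\<lambda>v. monom_val (($) v) m) has_derivative
      (\<lambda>u. \<Sum>i\<in>UNIV. u $ i * (of_nat (?l m i) * monom_val (($) v) (m - single i 1)))) (at v)" for m
  proof -
    have "((\<lambda>v. v $ i ^ ?l m i) has_derivative
        (\<lambda>u. of_nat (?l m i) * u $ i * v $ i ^ (?l m i - 1))) (at v)" for i
      by (rule has_derivative_power[OF bounded_linear_imp_has_derivative[OF bounded_linear_vec_nth]])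
    then show ?thesis
      unfolding val unfolding monom_val_UNIV
      by (rule has_derivative_prod[THEN has_derivative_eq_rhs])
         (simp add: fun_eq_iff mult_ac)
  qed
  have "((\<lambda>v. pval p v) has_derivative
     (\<lambda>u. \<Sum>m\<in>keys p. ?l p m * (\<Sum>i\<in>UNIV. u $ i *
        (of_nat (?l m i) * monom_val (($) v) (m - single i 1))))) (at v)"
    unfolding eval_poly_monom_val by (intro has_derivative_sum has_derivative_mult_right deriv)
  moreover have "(\<Sum>m\<in>keys p. ?l p m * (\<Sum>i\<in>UNIV. u $ i *
        (of_nat (?l m i) * monom_val (($) v) (m - single i 1))))
     = (\<Sum>i\<in>UNIV. u $ i * pval (partial_deriv i p) v)" for u
    unfolding sum_distrib_left
    by (subst sum.swap) (simp add: eval_poly_monom_val[of _ p] partial_deriv_def sum_distrib_left mult_ac)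
  ultimately show ?thesis by (simp only:)
qed

lemma continuous_on_eval_poly: "continuous_on S (\<lambda>v. pval p v)" for p :: "'n::finite mpoly"
  by (rule continuous_at_imp_continuous_on) (blast intro: has_derivative_continuous has_derivative_eval_poly)

lemma has_field_derivative_eval_poly_line:
  fixes p :: "'n::finite mpoly"
  shows "((\<lambda>t. pval p (v + t *s u)) has_field_derivative
    (\<Sum>i\<in>UNIV. u $ i * pval (partial_deriv i p) v)) (at 0)"
proof -
  have lin: "bounded_linear (\<lambda>t::complex. t *s u)"
    unfolding linear_conv_bounded_linear[symmetric]
    by (rule linearI) (simp_all add: vec_eq_iff algebra_simps scaleR_conv_of_real[where 'a=complex])
  have "((\<lambda>t. v + t *s u) has_derivative (\<lambda>t. t *s u)) (at (0::complex))"
    using has_derivative_add[OF has_derivative_const bounded_linear_imp_has_derivative[OF lin]] by simp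
  from has_derivative_compose[OF this, of "\<lambda>v. pval p v", OF has_derivative_eval_poly]
  show ?thesis
    by (rule has_derivative_imp_has_field_derivative) (simp add: sum_distrib_left mult_ac)
qed

section \<open>Coefficients of ternary cubic forms\<close>

text \<open>Naming the ten monomials lets the invariants be explicit formulas over any commutative
  ring; they are used with complex numbers, with univariate polynomials and with indeterminate
  coefficients.\<close>

datatype mon3 = X3 | X2Y | X2Z | XY2 | XYZ | XZ2 | Y3 | Y2Z | YZ2 | Z3

lemma UNIV_mon3: "UNIV = {X3, X2Y, X2Z, XY2, XYZ, XZ2, Y3, Y2Z, YZ2, Z3}"
  using mon3.exhaust by blast

instance mon3 :: finite
  by standard (simp add: UNIV_mon3)

definition exps3 :: "nat \<Rightarrow> nat \<Rightarrow> nat \<Rightarrow> (3 \<Rightarrow>\<^sub>0 nat)" where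
  "exps3 i j k = single 1 i + single 2 j + single 3 k"

primrec mon_exp :: "mon3 \<Rightarrow> (3 \<Rightarrow>\<^sub>0 nat)" where
  "mon_exp X3 = exps3 3 0 0"
|   "mon_exp X2Y = exps3 2 1 0"
|   "mon_exp X2Z = exps3 2 0 1"
|   "mon_exp XY2 = exps3 1 2 0"
|   "mon_exp XYZ = exps3 1 1 1"
|   "mon_exp XZ2 = exps3 1 0 2"
|   "mon_exp Y3 = exps3 0 3 0"
|   "mon_exp Y2Z = exps3 0 2 1"
|   "mon_exp YZ2 = exps3 0 1 2"
|   "mon_exp Z3 = exps3 0 0 3"

definition cubic_coefs :: "'a \<Rightarrow> 'a \<Rightarrow> 'a \<Rightarrow> 'a \<Rightarrow> 'a \<Rightarrow> 'a \<Rightarrow> 'a \<Rightarrow> 'a \<Rightarrow> 'a \<Rightarrow> 'a \<Rightarrow> mon3 \<Rightarrow> 'a" where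
  "cubic_coefs a b c d e f g h i j = (\<lambda>m. case m of X3 \<Rightarrow> a | X2Y \<Rightarrow> b | X2Z \<Rightarrow> c | XY2 \<Rightarrow> d | XYZ \<Rightarrow> e |
     XZ2 \<Rightarrow> f | Y3 \<Rightarrow> g | Y2Z \<Rightarrow> h | YZ2 \<Rightarrow> i | Z3 \<Rightarrow> j)"

lemma cubic_coefs_simps [simp]:
  "cubic_coefs a b c d e f g h i j X3 = a" "cubic_coefs a b c d e f g h i j X2Y = b"
  "cubic_coefs a b c d e f g h i j X2Z = c" "cubic_coefs a b c d e f g h i j XY2 = d"
  "cubic_coefs a b c d e f g h i j XYZ = e" "cubic_coefs a b c d e f g h i j XZ2 = f"
  "cubic_coefs a b c d e f g h i j Y3 = g" "cubic_coefs a b c d e f g h i j Y2Z = h"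
  "cubic_coefs a b c d e f g h i j YZ2 = i" "cubic_coefs a b c d e f g h i j Z3 = j"
  by (simp_all add: cubic_coefs_def)

definition cubic_val :: "(mon3 \<Rightarrow> 'a::comm_ring_1) \<Rightarrow> 'a \<Rightarrow> 'a \<Rightarrow> 'a \<Rightarrow> 'a" where
  "cubic_val c x y z =
     c X3 * x ^ 3 + c X2Y * x ^ 2 * y + c X2Z * x ^ 2 * z + c XY2 * x * y ^ 2 + c XYZ * x * y * z +
     c XZ2 * x * z ^ 2 + c Y3 * y ^ 3 + c Y2Z * y ^ 2 * z + c YZ2 * y * z ^ 2 + c Z3 * z ^ 3"

definition coef :: "3 mpoly \<Rightarrow> mon3 \<Rightarrow> complex" where
  "coef g m = lookup g (mon_exp m)"

definition cubic_poly :: "(mon3 \<Rightarrow> complex) \<Rightarrow> 3 mpoly" where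
  "cubic_poly c = (\<Sum>m\<in>UNIV. single (mon_exp m) (c m))"

lemma lookup_exps3 [simp]:
  "lookup (exps3 i j k) 1 = i"
  "lookup (exps3 i j k) 2 = j"
  "lookup (exps3 i j k) 3 = k"
  by (auto simp: exps3_def lookup_add lookup_single)

lemma exps3_eqI:
  "lookup m 1 = i \<Longrightarrow> lookup m 2 = j \<Longrightarrow> lookup m 3 = k \<Longrightarrow> m = exps3 i j k"
  by (rule poly_mapping_eqI) (metis exhaust_3 lookup_exps3)

lemma exps3_eq_iff: "exps3 i j k = exps3 i' j' k' \<longleftrightarrow> i = i' \<and> j = j' \<and> k = k'"
  by (metis lookup_exps3)

lemma exponent_degree_3:
  "exponent_degree m = lookup m 1 + lookup m 2 + lookup m (3::3)"
  by (simp add: exponent_degree_superset[of UNIV] sum_3)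

lemma inj_mon_exp: "inj mon_exp"
proof (rule injI)
  fix m n assume "mon_exp m = mon_exp n"
  then show "m = n" by (cases m; cases n) (simp_all add: exps3_eq_iff)
qed

lemma exponent_degree_mon_exp [simp]: "exponent_degree (mon_exp m) = 3"
  by (cases m) (simp_all add: exponent_degree_3)

lemma exponent_degree_3_imp_mon_exp:
  assumes "exponent_degree (m :: 3 \<Rightarrow>\<^sub>0 nat) = 3"
  shows "m \<in> range mon_exp"
proof -
  define i j k where "i = lookup m 1" and "j = lookup m 2"
    and "k = lookup m 3"
  have m: "m = exps3 i j k" by (rule exps3_eqI) (auto simp: i_def j_def k_def)
  have "i + j + k = 3" using assms by (simp add: exponent_degree_3 i_def j_def k_def)
  then have "(i = 3 \<and> j = 0 \<and> k = 0) \<or> (i = 2 \<and> j = 1 \<and> k = 0) \<or> (i = 2 \<and> j = 0 \<and> k = 1) \<or> (i = 1 \<and> j = 2 \<and> k = 0) \<or> (i = 1 \<and> j = 1 \<and> k = 1) \<or> (i = 1 \<and> j = 0 \<and> k = 2) \<or> (i = 0 \<and> j = 3 \<and> k = 0) \<or> (i = 0 \<and> j = 2 \<and> k = 1) \<or> (i = 0 \<and> j = 1 \<and> k = 2) \<or> (i = 0 \<and> j = 0 \<and> k = 3)"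
    by arith
  moreover have "exps3 i j k \<in> range mon_exp" if "mon_exp n = exps3 i j k" for n
    using that by (metis rangeI)
  ultimately show ?thesis unfolding m
    by (elim disjE conjE; hypsubst; metis mon_exp.simps rangeI)
qed

lemma coef_cubic_poly [simp]: "coef (cubic_poly c) = c"
  by (rule ext) (simp add: coef_def cubic_poly_def lookup_sum lookup_single when_def inj_eq[OF inj_mon_exp])

lemma homogeneous_cubic_poly [simp]: "homogeneous 3 (cubic_poly c)"
  unfolding cubic_poly_def
  by (rule homogeneous_sum) (metis homogeneous_single exponent_degree_mon_exp)

lemma cubic_poly_coef:
  assumes "homogeneous 3 g"
  shows "cubic_poly (coef g) = g"
proof (rule poly_mapping_eqI)
  fix m
  show "lookup (cubic_poly (coef g)) m = lookup g m"
  proof (cases "m \<in> range mon_exp")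
    case True
    then obtain n where n: "m = mon_exp n" by auto
    then show ?thesis using fun_cong[OF coef_cubic_poly[of "coef g"], of n] by (simp only: n coef_def)
  next
    case False
    then have "exponent_degree m \<noteq> 3" using exponent_degree_3_imp_mon_exp by blast
    then have "m \<notin> keys g" "m \<notin> keys (cubic_poly (coef g))"
      using assms homogeneous_cubic_poly[of "coef g"] by (auto simp: homogeneous_def)
    then show ?thesis by (simp add: in_keys_iff)
  qed
qed

lemma eval_cubic_poly: "pval (cubic_poly c) v = cubic_val c (v $ 1) (v $ 2) (v $ 3)"
proof -
  have "monom_val (($) v) (exps3 i j k) = v $ 1 ^ i * v $ 2 ^ j * v $ 3 ^ k" for i j k
    by (simp add: exps3_def monom_val_add)
  then show ?thesis
    by (simp add: cubic_poly_def UNIV_mon3 cubic_val_def mult_ac)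
qed

lemma eval_cubic:
  "homogeneous 3 g \<Longrightarrow> pval g v = cubic_val (coef g) (v $ 1) (v $ 2) (v $ 3)"
  by (metis cubic_poly_coef eval_cubic_poly)

lemma coef_eqI:
  assumes "homogeneous 3 g" "\<And>v. pval g v = cubic_val c (v $ 1) (v $ 2) (v $ 3)"
  shows "coef g = c"
  using assms by (metis coef_cubic_poly eval_cubic_poly eval_poly_vec_eq_imp_eq)

text \<open>Coefficients are found by comparing values, so the sums defining
  \<open>linear_subst\<close> need not be expanded.\<close>

lemma coef_linear_subst_eqI:
  assumes "homogeneous 3 (g :: 'n::finite mpoly)"
    and "\<And>v. pval g (A *v v) = cubic_val c (v $ 1) (v $ 2) (v $ 3)"
  shows "coef (linear_subst A g) = c"
  by (rule coef_eqI) (auto intro: homogeneous_linear_subst assms simp: eval_linear_subst)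

section \<open>The invariants of ternary cubic forms\<close>

text \<open>
  Aronhold's invariants \<open>S\<close> and \<open>T\<close>, scaled so that a cubic in Weierstrass form gets the
  invariants \<open>c\<^sub>4\<close> and \<open>c\<^sub>6\<close> of the elliptic curve.
\<close>

definition c4_form :: "'a \<Rightarrow> 'a \<Rightarrow> 'a \<Rightarrow> 'a \<Rightarrow> 'a \<Rightarrow> 'a \<Rightarrow> 'a \<Rightarrow> 'a \<Rightarrow> 'a \<Rightarrow> 'a \<Rightarrow> 'a::comm_ring_1" where
  "c4_form a b c d e f g h i j =
     144*a*d*h*j - 48*a*d*i^2 - 216*a*e*g*j + 24*a*e*h*i + 144*a*f*g*i - 48*a*f*h^2 +
     144*b*c*g*j - 16*b*c*h*i + 24*b*d*e*j - 16*b*d*f*i + 24*b*e*f*h - 8*b*e^2*i - 48*b*f^2*g -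
     48*b^2*h*j + 16*b^2*i^2 + 24*c*d*e*i - 16*c*d*f*h - 48*c*d^2*j + 24*c*e*f*g - 8*c*e^2*h -
     48*c^2*g*i + 16*c^2*h^2 - 8*d*e^2*f + 16*d^2*f^2 + e^4"
definition c6_form :: "'a \<Rightarrow> 'a \<Rightarrow> 'a \<Rightarrow> 'a \<Rightarrow> 'a \<Rightarrow> 'a \<Rightarrow> 'a \<Rightarrow> 'a \<Rightarrow> 'a \<Rightarrow> 'a \<Rightarrow> 'a::comm_ring_1" where
  "c6_form a b c d e f g h i j =
     - 3888*a*b*d*g*j^2 + 1296*a*b*d*h*i*j - 288*a*b*d*i^3 + 1296*a*b*e*g*i*j + 144*a*b*e*h*i^2
     - 864*a*b*e*h^2*j + 1296*a*b*f*g*h*j - 864*a*b*f*g*i^2 + 144*a*b*f*h^2*i +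
     1296*a*c*d*g*i*j + 144*a*c*d*h*i^2 - 864*a*c*d*h^2*j + 1296*a*c*e*g*h*j - 864*a*c*e*g*i^2
     + 144*a*c*e*h^2*i + 1296*a*c*f*g*h*i - 3888*a*c*f*g^2*j - 288*a*c*f*h^3 + 1296*a*d*e*f*g*j
     - 720*a*d*e*f*h*i + 648*a*d*e^2*h*j + 72*a*d*e^2*i^2 - 864*a*d*f^2*g*i + 576*a*d*f^2*h^2 -
     864*a*d^2*e*i*j - 864*a*d^2*f*h*j + 576*a*d^2*f*i^2 + 864*a*d^3*j^2 - 864*a*e*f^2*g*h +
     648*a*e^2*f*g*i + 72*a*e^2*f*h^2 - 540*a*e^3*g*j - 36*a*e^3*h*i + 864*a*f^3*g^2 -
     3888*a^2*g*h*i*j + 864*a^2*g*i^3 + 5832*a^2*g^2*j^2 - 216*a^2*h^2*i^2 + 864*a^2*h^3*j -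
     720*b*c*d*e*h*j + 144*b*c*d*e*i^2 + 1296*b*c*d*f*g*j - 48*b*c*d*f*h*i + 144*b*c*d^2*i*j -
     720*b*c*e*f*g*i + 144*b*c*e*f*h^2 + 648*b*c*e^2*g*j - 24*b*c*e^2*h*i + 144*b*c*f^2*g*h -
     864*b*c^2*g*h*j + 576*b*c^2*g*i^2 - 96*b*c^2*h^2*i + 144*b*d*e*f^2*h - 24*b*d*e^2*f*i -
     36*b*d*e^3*j - 288*b*d*f^3*g + 144*b*d^2*e*f*j - 96*b*d^2*f^2*i + 72*b*e^2*f^2*g -
     36*b*e^3*f*h + 12*b*e^4*i - 864*b^2*c*g*i*j - 96*b^2*c*h*i^2 + 576*b^2*c*h^2*j +
     144*b^2*d*e*i*j + 144*b^2*d*f*h*j - 96*b^2*d*f*i^2 - 216*b^2*d^2*j^2 - 864*b^2*e*f*g*j +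
     144*b^2*e*f*h*i + 72*b^2*e^2*h*j - 48*b^2*e^2*i^2 + 576*b^2*f^2*g*i - 216*b^2*f^2*h^2 +
     864*b^3*g*j^2 - 288*b^3*h*i*j + 64*b^3*i^3 + 144*c*d*e*f^2*g - 24*c*d*e^2*f*h -
     36*c*d*e^3*i + 144*c*d^2*e*f*i + 72*c*d^2*e^2*j - 96*c*d^2*f^2*h - 288*c*d^3*f*j -
     36*c*e^3*f*g + 12*c*e^4*h - 864*c^2*d*e*g*j + 144*c^2*d*e*h*i + 144*c^2*d*f*g*i -
     96*c^2*d*f*h^2 + 576*c^2*d^2*h*j - 216*c^2*d^2*i^2 + 144*c^2*e*f*g*h + 72*c^2*e^2*g*i -
     48*c^2*e^2*h^2 - 216*c^2*f^2*g^2 - 288*c^3*g*h*i + 864*c^3*g^2*j + 64*c^3*h^3 + 12*d*e^4*f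
     - 48*d^2*e^2*f^2 + 64*d^3*f^3 - e^6"

definition c4 :: "(mon3 \<Rightarrow> 'a::comm_ring_1) \<Rightarrow> 'a" where
  "c4 c = c4_form (c X3) (c X2Y) (c X2Z) (c XY2) (c XYZ) (c XZ2) (c Y3) (c Y2Z) (c YZ2) (c Z3)"

definition c6 :: "(mon3 \<Rightarrow> 'a::comm_ring_1) \<Rightarrow> 'a" where
  "c6 c = c6_form (c X3) (c X2Y) (c X2Z) (c XY2) (c XYZ) (c XZ2) (c Y3) (c Y2Z) (c YZ2) (c Z3)"

text \<open>This is 1728 times the discriminant.\<close>

definition disc :: "(mon3 \<Rightarrow> 'a::comm_ring_1) \<Rightarrow> 'a" where
  "disc c = c4 c ^ 3 - c6 c ^ 2"

section \<open>Covariance of the invariants\<close>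

text \<open>The arguments on the left are the coefficients after \<open>x\<close> is replaced by
  \<open>x + t*y\<close>. These transvections, diagonal matrices and two coordinate swaps generate
  all invertible matrices.\<close>

lemma c4_form_transvection:
  fixes t :: complex
  shows "c4_form a (b + 3*t*a) c (d + 2*t*b + 3*t^2*a) (e + 2*t*c) f (g + t*d + t^2*b + t^3*a)
           (h + t*e + t^2*c) (i + t*f) j = c4_form a b c d e f g h i j"
  unfolding c4_form_def by algebra

lemma c6_form_transvection:
  fixes t :: complex
  shows "c6_form a (b + 3*t*a) c (d + 2*t*b + 3*t^2*a) (e + 2*t*c) f (g + t*d + t^2*b + t^3*a)
           (h + t*e + t^2*c) (i + t*f) j = c6_form a b c d e f g h i j"
  unfolding c6_form_def by algebra

lemma c4_form_diagonal:
  fixes p q t :: complex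
  shows "c4_form (p^3*a) (p^2*q*b) (p^2*t*c) (p*q^2*d) (p*q*t*e) (p*t^2*f) (q^3*g) (q^2*t*h) (q*t^2*i) (t^3*j)
         = (p*q*t)^4 * c4_form a b c d e f g h i j"
  unfolding c4_form_def by algebra

lemma c6_form_diagonal:
  fixes p q t :: complex
  shows "c6_form (p^3*a) (p^2*q*b) (p^2*t*c) (p*q^2*d) (p*q*t*e) (p*t^2*f) (q^3*g) (q^2*t*h) (q*t^2*i) (t^3*j)
         = (p*q*t)^6 * c6_form a b c d e f g h i j"
  unfolding c6_form_def by algebra

lemma c4_c6_form_swap_xy:
  fixes a :: complex
  shows "c4_form g d h b e i a c f j = c4_form a b c d e f g h i j"
    and "c6_form g d h b e i a c f j = c6_form a b c d e f g h i j"
  unfolding c4_form_def c6_form_def by algebra+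

lemma c4_c6_form_swap_yz:
  fixes a :: complex
  shows "c4_form a c b f e d j i h g = c4_form a b c d e f g h i j"
    and "c6_form a c b f e d j i h g = c6_form a b c d e f g h i j"
  unfolding c4_form_def c6_form_def by algebra+

lemma c4_c6_form_scale:
  fixes t :: complex
  shows "c4_form (t*a) (t*b) (t*c) (t*d) (t*e) (t*f) (t*g) (t*h) (t*i) (t*j) = t^4 * c4_form a b c d e f g h i j"
    and "c6_form (t*a) (t*b) (t*c) (t*d) (t*e) (t*f) (t*g) (t*h) (t*i) (t*j) = t^6 * c6_form a b c d e f g h i j"
  unfolding c4_form_def c6_form_def by algebra+

definition mat3 :: "complex \<Rightarrow> complex \<Rightarrow> complex \<Rightarrow> complex \<Rightarrow> complex \<Rightarrow> complex \<Rightarrow> complex \<Rightarrow>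
    complex \<Rightarrow> complex \<Rightarrow> complex^3^3" where
  "mat3 a b c d e f g h i = vector [vector [a, b, c], vector [d, e, f], vector [g, h, i]]"

lemma mat3_nth [simp]:
  "mat3 a b c d e f g h i $ 1 = vector [a, b, c]"
  "mat3 a b c d e f g h i $ 2 = vector [d, e, f]"
  "mat3 a b c d e f g h i $ 3 = vector [g, h, i]"
  by (simp_all add: mat3_def)

lemma mat3_exhaust: "B = mat3 (B$1$1) (B$1$2) (B$1$3) (B$2$1) (B$2$2) (B$2$3) (B$3$1) (B$3$2) (B$3$3)"
  by (simp add: vec_eq_iff forall_3)

lemma mat3_mult:
  "mat3 a b c d e f g h i ** mat3 a' b' c' d' e' f' g' h' i' =
     mat3 (a*a' + b*d' + c*g') (a*b' + b*e' + c*h') (a*c' + b*f' + c*i')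
          (d*a' + e*d' + f*g') (d*b' + e*e' + f*h') (d*c' + e*f' + f*i')
          (g*a' + h*d' + i*g') (g*b' + h*e' + i*h') (g*c' + h*f' + i*i')"
  by (simp add: vec_eq_iff forall_3 matrix_matrix_mult_def sum_3)

lemma mat3_mult_vec:
  "mat3 a b c d e f g h i *v v =
     vector [a * v$1 + b * v$2 + c * v$3, d * v$1 + e * v$2 + f * v$3, g * v$1 + h * v$2 + i * v$3]"
  by (simp add: vec_eq_iff forall_3 matrix_vector_mult_def sum_3)

lemma det_mat3:
  "det (mat3 a b c d e f g h i) = a*e*i + b*f*g + c*d*h - a*f*h - b*d*i - c*e*g"
  by (simp add: det_3)

text \<open>Stated for a single matrix so that products inherit it and generators suffice. An
  invariant of degree \<open>d\<close> of ternary cubics has weight 3d/3 = d, hence the exponents 4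
  and 6.\<close>

definition c4_c6_covariant :: "complex^3^3 \<Rightarrow> bool" where
  "c4_c6_covariant B \<longleftrightarrow> (\<forall>g. homogeneous 3 g \<longrightarrow>
     c4 (coef (linear_subst B g)) = det B ^ 4 * c4 (coef g) \<and>
     c6 (coef (linear_subst B g)) = det B ^ 6 * c6 (coef g))"

lemma covariant_mult: "c4_c6_covariant A \<Longrightarrow> c4_c6_covariant B \<Longrightarrow> c4_c6_covariant (A ** B)"
  unfolding c4_c6_covariant_def
  by (simp flip: linear_subst_compose add: homogeneous_linear_subst det_mul power_mult_distrib)

lemma covariantI:
  assumes "\<And>c. cubic_val (\<phi> c) = (\<lambda>x y z. let v = B *v vector [x, y, z] in cubic_val c (v$1) (v$2) (v$3))"
    and "\<And>c. c4 (\<phi> c) = det B ^ 4 * c4 c" "\<And>c. c6 (\<phi> c) = det B ^ 6 * c6 c"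
  shows "c4_c6_covariant B"
  unfolding c4_c6_covariant_def
proof (intro allI impI)
  fix g :: "3 mpoly" assume g: "homogeneous 3 g"
  have "vector [v $ 1, v $ 2, v $ 3] = v" for v :: "complex^3"
    by (simp add: vec_eq_iff forall_3)
  then have "coef (linear_subst B g) = \<phi> (coef g)"
    by (intro coef_linear_subst_eqI g) (simp only: eval_cubic[OF g] assms(1) Let_def)
  then show "c4 (coef (linear_subst B g)) = det B ^ 4 * c4 (coef g) \<and>
      c6 (coef (linear_subst B g)) = det B ^ 6 * c6 (coef g)"
    by (simp add: assms)
qed

lemma covariant_diagonal: "c4_c6_covariant (mat3 p 0 0 0 q 0 0 0 t)"
  by (rule covariantI[where \<phi> = "\<lambda>c. cubic_coefs (p^3 * c X3) (p^2*q * c X2Y) (p^2*t * c X2Z) (p*q^2 * c XY2) (p*q*t * c XYZ) (p*t^2 * c XZ2) (q^3 * c Y3) (q^2*t * c Y2Z) (q*t^2 * c YZ2) (t^3 * c Z3)"])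
     (simp_all add: fun_eq_iff cubic_val_def mat3_mult_vec c4_def c6_def c4_form_diagonal
       c6_form_diagonal det_mat3 power_mult_distrib)

lemma covariant_swap_xy: "c4_c6_covariant (mat3 0 1 0 1 0 0 0 0 1)"
  by (rule covariantI[where \<phi> = "\<lambda>c. cubic_coefs (c Y3) (c XY2) (c Y2Z) (c X2Y) (c XYZ) (c YZ2) (c X3) (c X2Z) (c XZ2) (c Z3)"])
     (simp_all add: fun_eq_iff cubic_val_def mat3_mult_vec c4_def c6_def det_mat3 c4_c6_form_swap_xy)

lemma covariant_swap_yz: "c4_c6_covariant (mat3 1 0 0 0 0 1 0 1 0)"
  by (rule covariantI[where \<phi> = "\<lambda>c. cubic_coefs (c X3) (c X2Z) (c X2Y) (c XZ2) (c XYZ) (c XY2) (c Z3) (c YZ2) (c Y2Z) (c Y3)"])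
     (simp_all add: fun_eq_iff cubic_val_def mat3_mult_vec c4_def c6_def det_mat3 c4_c6_form_swap_yz)

lemma covariant_transvection_xy: "c4_c6_covariant (mat3 1 t 0 0 1 0 0 0 1)"
  by (rule covariantI[where \<phi> = "\<lambda>c. cubic_coefs (c X3) (c X2Y + 3*t*c X3) (c X2Z) (c XY2 + 2*t*c X2Y + 3*t^2*c X3) (c XYZ + 2*t*c X2Z) (c XZ2) (c Y3 + t*c XY2 + t^2*c X2Y + t^3*c X3) (c Y2Z + t*c XYZ + t^2*c X2Z) (c YZ2 + t*c XZ2) (c Z3)"])
     (simp_all add: fun_eq_iff cubic_val_def mat3_mult_vec c4_def c6_def det_mat3 c4_form_transvection
       c6_form_transvection, intro allI, algebra)

lemma covariant_swap_xz: "c4_c6_covariant (mat3 0 0 1 0 1 0 1 0 0)"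
  using covariant_mult[OF covariant_mult[OF covariant_swap_xy covariant_swap_yz] covariant_swap_xy]
  by (simp add: mat3_mult)

text \<open>Conjugation by coordinate swaps carries the one transvection already treated to the
  other five positions.\<close>

lemma covariant_transvections:
  shows covariant_transvection_xz: "c4_c6_covariant (mat3 1 0 t 0 1 0 0 0 1)"
    and covariant_transvection_yx: "c4_c6_covariant (mat3 1 0 0 t 1 0 0 0 1)"
    and covariant_transvection_yz: "c4_c6_covariant (mat3 1 0 0 0 1 t 0 0 1)"
    and covariant_transvection_zx: "c4_c6_covariant (mat3 1 0 0 0 1 0 t 0 1)"
    and covariant_transvection_zy: "c4_c6_covariant (mat3 1 0 0 0 1 0 0 t 1)"
proof -
  note conj = covariant_mult[OF covariant_mult]
  show xz: "c4_c6_covariant (mat3 1 0 t 0 1 0 0 0 1)"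
    using conj[OF covariant_swap_yz covariant_transvection_xy[of t] covariant_swap_yz] by (simp add: mat3_mult)
  show "c4_c6_covariant (mat3 1 0 0 t 1 0 0 0 1)"
    using conj[OF covariant_swap_xy covariant_transvection_xy[of t] covariant_swap_xy] by (simp add: mat3_mult)
  show "c4_c6_covariant (mat3 1 0 0 0 1 t 0 0 1)"
    using conj[OF covariant_swap_xy xz covariant_swap_xy] by (simp add: mat3_mult)
  show "c4_c6_covariant (mat3 1 0 0 0 1 0 t 0 1)"
    using conj[OF covariant_swap_xz xz covariant_swap_xz] by (simp add: mat3_mult)
  show "c4_c6_covariant (mat3 1 0 0 0 1 0 0 t 1)"
    using conj[OF covariant_swap_xz covariant_transvection_xy[of t] covariant_swap_xz] by (simp add: mat3_mult)
qed

lemma covariant_upper_triangular: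
  assumes "a \<noteq> 0" "e \<noteq> 0"
  shows "c4_c6_covariant (mat3 a b c 0 e f 0 0 i)"
proof -
  note m = covariant_mult[OF covariant_mult[OF covariant_mult]]
  show ?thesis
    using m[OF covariant_diagonal[of a e i] covariant_transvection_yz[of "f / e"]
      covariant_transvection_xz[of "c / a"] covariant_transvection_xy[of "b / a"]] assms
    by (simp add: mat3_mult)
qed

lemma covariant_pivot:
  assumes "a \<noteq> 0" "e * i - f * h \<noteq> 0"
  shows "c4_c6_covariant (mat3 a b c 0 e f 0 h i)"
proof -
  have piv: "c4_c6_covariant (mat3 a b c 0 e f 0 h i)" if "e \<noteq> 0" for e f h i
    using covariant_mult[OF covariant_transvection_zy[of "h / e"]
        covariant_upper_triangular[OF assms(1) that, of b c f "i - f * h / e"]] that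
    by (simp add: mat3_mult)
  show ?thesis
  proof (cases "e = 0")
    case True
    then have "h \<noteq> 0" using assms by auto
    from covariant_mult[OF covariant_swap_yz piv[OF this]] show ?thesis by (simp add: mat3_mult)
  qed (rule piv)
qed

text \<open>Gaussian elimination: a swap brings a nonzero entry to the top of the first column,
  transvections clear the rest of the column, and \<open>covariant_pivot\<close> handles the
  remaining block.\<close>

lemma covariant_invertible:
  assumes "invertible B"
  shows "c4_c6_covariant B"
proof -
  have piv: "c4_c6_covariant (mat3 a b c d e f g h i)"
    if "a \<noteq> 0" "det (mat3 a b c d e f g h i) \<noteq> 0" for a b c d e f g h i
  proof -
    \<comment> \<open>The Schur complement of the pivot \<open>a\<close> has determinant
      \<open>det / a\<close>.\<close>
    have "(e - d * b / a) * (i - g * c / a) - (f - d * c / a) * (h - g * b / a) =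
        det (mat3 a b c d e f g h i) / a"
      using that(1) by (simp add: det_mat3 field_simps)
    then have "c4_c6_covariant (mat3 a b c 0 (e - d * b / a) (f - d * c / a) 0 (h - g * b / a) (i - g * c / a))"
      using that by (intro covariant_pivot) auto
    from covariant_mult[OF covariant_mult[OF covariant_transvection_yx[of "d / a"]
          covariant_transvection_zx[of "g / a"]] this] that(1)
    show ?thesis by (simp add: mat3_mult)
  qed
  obtain a b c d e f g h i where B: "B = mat3 a b c d e f g h i"
    using mat3_exhaust by blast
  have det: "det (mat3 a b c d e f g h i) \<noteq> 0"
    using assms by (simp add: invertible_det_nz flip: B)
  consider "a \<noteq> 0" | "a = 0" "d \<noteq> 0" | "a = 0" "d = 0" "g \<noteq> 0"
    using det by (cases "a = 0"; cases "d = 0"; cases "g = 0") (simp_all add: det_mat3)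
  then show ?thesis unfolding B
  proof cases
    case 2
    with det have "det (mat3 d e f a b c g h i) \<noteq> 0" by (simp add: det_mat3 algebra_simps)
    from covariant_mult[OF covariant_swap_xy piv[OF 2(2) this]] show "c4_c6_covariant (mat3 a b c d e f g h i)"
      by (simp add: mat3_mult)
  next
    case 3
    with det have "det (mat3 g h i d e f a b c) \<noteq> 0" by (simp add: det_mat3 algebra_simps)
    from covariant_mult[OF covariant_swap_xz piv[OF 3(3) this]] show "c4_c6_covariant (mat3 a b c d e f g h i)"
      by (simp add: mat3_mult)
  qed (use piv det in auto)
qed

lemma c4_linear_subst:
  "invertible B \<Longrightarrow> homogeneous 3 g \<Longrightarrow> c4 (coef (linear_subst B g)) = det B ^ 4 * c4 (coef g)"
  and c6_linear_subst:
  "invertible B \<Longrightarrow> homogeneous 3 g \<Longrightarrow> c6 (coef (linear_subst B g)) = det B ^ 6 * c6 (coef g)"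
  using covariant_invertible unfolding c4_c6_covariant_def by auto

lemma disc_linear_subst:
  assumes "invertible B" "homogeneous 3 g"
  shows "disc (coef (linear_subst B g)) = det B ^ 12 * disc (coef g)"
  using assms by (simp add: disc_def c4_linear_subst c6_linear_subst power_mult_distrib right_diff_distrib
      flip: power_mult)

lemma c4_scale: "c4 (\<lambda>m. t * c m) = t ^ 4 * c4 c" for t :: complex
  by (simp add: c4_def c4_c6_form_scale)

lemma c6_scale: "c6 (\<lambda>m. t * c m) = t ^ 6 * c6 c" for t :: complex
  by (simp add: c6_def c4_c6_form_scale)

lemma disc_scale: "disc (\<lambda>m. t * c m) = t ^ 12 * disc c" for t :: complex
  by (simp add: disc_def c4_scale c6_scale power_mult_distrib right_diff_distrib flip: power_mult)

section \<open>Smoothness\<close>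

lemmas powers = power2_eq_square power3_eq_cube power4_eq_xxxx

definition critical :: "'n::finite mpoly \<Rightarrow> complex^'n \<Rightarrow> bool" where
  "critical p v \<longleftrightarrow> (\<forall>i. pval (partial_deriv i p) v = 0)"

text \<open>Derivatives along lines are carried along by a linear map without a computation with
  matrices; the results on substitutions below use this form.\<close>

lemma critical_iff_derivative:
  "critical p v \<longleftrightarrow> (\<forall>u. ((\<lambda>t. pval p (v + t *s u)) has_field_derivative 0) (at 0))"
proof
  assume "critical p v"
  then show "\<forall>u. ((\<lambda>t. pval p (v + t *s u)) has_field_derivative 0) (at 0)"
    using has_field_derivative_eval_poly_line[of v _ p] by (simp add: critical_def)
next
  assume *: "\<forall>u. ((\<lambda>t. pval p (v + t *s u)) has_field_derivative 0) (at 0)"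
  show "critical p v" unfolding critical_def
  proof
    fix i
    have "(\<Sum>j\<in>UNIV. axis i 1 $ j * pval (partial_deriv j p) v) = 0"
      using DERIV_unique[OF has_field_derivative_eval_poly_line] * by blast
    then show "pval (partial_deriv i p) v = 0"
      by (simp add: axis_def if_distrib[of "\<lambda>x. x * _"] cong: if_cong)
  qed
qed

lemma smooth_form_iff:
  fixes p :: "'n::finite mpoly"
  shows "smooth_form p \<longleftrightarrow> (\<forall>v. pval p v = 0 \<and> critical p v \<longrightarrow> v = 0)"
proof -
  have "(\<chi> i. a i) = 0 \<longleftrightarrow> a = (\<lambda>_. 0)" for a :: "'n \<Rightarrow> complex"
    by (auto simp: vec_eq_iff)
  moreover have "(\<forall>v. P (($) v)) \<longleftrightarrow> (\<forall>a. P a)" for P :: "('n \<Rightarrow> complex) \<Rightarrow> bool"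
    by (metis vec_lambda_inverse UNIV_I)
  ultimately show ?thesis
    unfolding singular_locus_def critical_def
    by (auto simp: vec_eq_iff fun_eq_iff) (metis vec_lambda_inverse UNIV_I)+
qed

lemma critical_linear_subst:
  "critical (linear_subst A p) z \<longleftrightarrow>
     (\<forall>u. ((\<lambda>t. pval p (A *v z + t *s (A *v u))) has_field_derivative 0) (at 0))"
  by (simp add: critical_iff_derivative eval_linear_subst matrix_vector_right_distrib vector_scalar_commute)

lemma critical_imp_critical_linear_subst: "critical p (A *v z) \<Longrightarrow> critical (linear_subst A p) z"
  unfolding critical_linear_subst critical_iff_derivative[of p] by blast

text \<open>Substituting the inverse matrix \<open>C\<close> turns a singular zero \<open>v\<close>
  of the new form into the singular zero \<open>B *v v\<close> of \<open>p\<close>.\<close>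

lemma smooth_form_linear_subst:
  assumes "invertible B" "smooth_form p"
  shows "smooth_form (linear_subst B p)"
proof -
  obtain C where C: "B ** C = mat 1" "C ** B = mat 1"
    using assms(1) unfolding invertible_def by blast
  show ?thesis unfolding smooth_form_iff
  proof (intro allI impI)
    fix v assume v: "pval (linear_subst B p) v = 0 \<and> critical (linear_subst B p) v"
    have v_eq: "C *v (B *v v) = v" by (simp add: matrix_vector_mul_assoc C)
    have "critical (linear_subst C (linear_subst B p)) (B *v v)"
      by (rule critical_imp_critical_linear_subst) (simp only: v_eq v)
    then have "critical p (B *v v)" by (simp add: linear_subst_compose C linear_subst_mat_1)
    then have "B *v v = 0" using assms(2) v by (auto simp: smooth_form_iff eval_linear_subst)
    then show "v = 0" using v_eq by simp
  qed
qed

section \<open>The gradient of a ternary cubic\<close>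

definition cubic_dx :: "(mon3 \<Rightarrow> complex) \<Rightarrow> complex \<Rightarrow> complex \<Rightarrow> complex \<Rightarrow> complex" where
  "cubic_dx c x y z = 3 * c X3 * x^2 + 2 * c X2Y * x * y + 2 * c X2Z * x * z + c XY2 * y^2
     + c XYZ * y * z + c XZ2 * z^2"

definition cubic_dy :: "(mon3 \<Rightarrow> complex) \<Rightarrow> complex \<Rightarrow> complex \<Rightarrow> complex \<Rightarrow> complex" where
  "cubic_dy c x y z = c X2Y * x^2 + 2 * c XY2 * x * y + c XYZ * x * z + 3 * c Y3 * y^2
     + 2 * c Y2Z * y * z + c YZ2 * z^2"

definition cubic_dz :: "(mon3 \<Rightarrow> complex) \<Rightarrow> complex \<Rightarrow> complex \<Rightarrow> complex \<Rightarrow> complex" where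
  "cubic_dz c x y z = c X2Z * x^2 + c XYZ * x * y + 2 * c XZ2 * x * z + c Y2Z * y^2
     + 2 * c YZ2 * y * z + 3 * c Z3 * z^2"

lemmas cubic_grad_defs = cubic_dx_def cubic_dy_def cubic_dz_def

text \<open>Only the gradient occurs: by Euler's relation \<open>cubic_euler\<close> a common zero
  of the three derivatives lies on the cubic.\<close>

definition nonsingular :: "(mon3 \<Rightarrow> complex) \<Rightarrow> bool" where
  "nonsingular c \<longleftrightarrow> (\<forall>x y z. cubic_dx c x y z = 0 \<and> cubic_dy c x y z = 0 \<and> cubic_dz c x y z = 0
     \<longrightarrow> x = 0 \<and> y = 0 \<and> z = 0)"

lemma cubic_euler:
  "3 * cubic_val c x y z = x * cubic_dx c x y z + y * cubic_dy c x y z + z * cubic_dz c x y z"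
  unfolding cubic_val_def cubic_grad_defs by algebra

lemma cubic_val_derivative:
  "((\<lambda>t. cubic_val c (x + t * u) (y + t * v) (z + t * w)) has_field_derivative
     u * cubic_dx c x y z + v * cubic_dy c x y z + w * cubic_dz c x y z) (at 0)"
  unfolding cubic_val_def cubic_grad_defs
  by (auto intro!: derivative_eq_intros simp: algebra_simps powers)

lemma critical_cubic_iff:
  assumes "homogeneous 3 g"
  shows "critical g v \<longleftrightarrow> cubic_dx (coef g) (v$1) (v$2) (v$3) = 0 \<and> cubic_dy (coef g) (v$1) (v$2) (v$3) = 0
     \<and> cubic_dz (coef g) (v$1) (v$2) (v$3) = 0" (is "_ \<longleftrightarrow> ?r")
proof -
  let ?D = "\<lambda>u::complex^3. u$1 * cubic_dx (coef g) (v$1) (v$2) (v$3) + u$2 * cubic_dy (coef g) (v$1) (v$2) (v$3)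
     + u$3 * cubic_dz (coef g) (v$1) (v$2) (v$3)"
  have D: "((\<lambda>t. pval g (v + t *s u)) has_field_derivative ?D u) (at 0)" for u
    using cubic_val_derivative[of "coef g" "v$1" "u$1" "v$2" "u$2" "v$3" "u$3"]
    by (simp add: eval_cubic[OF assms])
  have "critical g v \<longleftrightarrow> (\<forall>u. ?D u = 0)"
  proof -
    have "((\<lambda>t. pval g (v + t *s u)) has_field_derivative 0) (at 0) \<longleftrightarrow> ?D u = 0" for u
    proof
      assume "((\<lambda>t. pval g (v + t *s u)) has_field_derivative 0) (at 0)"
      from DERIV_unique[OF D this] show "?D u = 0" .
    next
      assume "?D u = 0"
      with D[of u] show "((\<lambda>t. pval g (v + t *s u)) has_field_derivative 0) (at 0)"
        by (simp only:)
    qed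
    then show ?thesis by (simp only: critical_iff_derivative)
  qed
  also have "\<dots> \<longleftrightarrow> ?r"
  proof
    assume *: "\<forall>u. ?D u = 0"
    show ?r
      using *[rule_format, of "vector [1, 0, 0]"] *[rule_format, of "vector [0, 1, 0]"]
        *[rule_format, of "vector [0, 0, 1]"] by simp
  qed simp
  finally show ?thesis .
qed

lemma smooth_form_cubic_iff:
  assumes "homogeneous 3 g"
  shows "smooth_form g \<longleftrightarrow> nonsingular (coef g)"
proof
  assume *: "smooth_form g"
  show "nonsingular (coef g)" unfolding nonsingular_def
  proof (intro allI impI)
    fix x y z
    assume d: "cubic_dx (coef g) x y z = 0 \<and> cubic_dy (coef g) x y z = 0 \<and> cubic_dz (coef g) x y z = 0"
    then have "cubic_val (coef g) x y z = 0"
      using cubic_euler[of "coef g" x y z] by simp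
    with d have "vector [x, y, z] = (0 :: complex^3)"
      using * by (auto simp: smooth_form_iff critical_cubic_iff[OF assms] eval_cubic[OF assms])
    then show "x = 0 \<and> y = 0 \<and> z = 0" by (simp add: vec_eq_iff forall_3)
  qed
next
  assume ns: "nonsingular (coef g)"
  show "smooth_form g" unfolding smooth_form_iff
  proof (intro allI impI)
    fix v assume "pval g v = 0 \<and> critical g v"
    then have "v $ 1 = 0 \<and> v $ 2 = 0 \<and> v $ 3 = 0"
      using ns unfolding nonsingular_def critical_cubic_iff[OF assms] by blast
    then show "v = 0" by (simp add: vec_eq_iff forall_3)
  qed
qed

section \<open>Linear equivalence of ternary cubics\<close>

definition coef_equiv :: "(mon3 \<Rightarrow> complex) \<Rightarrow> (mon3 \<Rightarrow> complex) \<Rightarrow> bool" where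
  "coef_equiv c c' \<longleftrightarrow> (\<exists>B. invertible B \<and> c' = coef (linear_subst B (cubic_poly c)))"

lemma coef_equiv_linear_subst:
  assumes "homogeneous 3 g" "invertible B"
  shows "coef_equiv (coef g) (coef (linear_subst B g))"
  using assms by (auto simp: coef_equiv_def cubic_poly_coef)

lemma coef_equiv_sym:
  assumes "coef_equiv c c'"
  shows "coef_equiv c' c"
proof -
  obtain B where B: "invertible B" "c' = coef (linear_subst B (cubic_poly c))"
    using assms by (auto simp: coef_equiv_def)
  then obtain C where C: "B ** C = mat 1" "C ** B = mat 1" unfolding invertible_def by blast
  have "linear_subst C (cubic_poly c') = cubic_poly c"
    by (simp add: B cubic_poly_coef homogeneous_linear_subst linear_subst_compose C linear_subst_mat_1)
  then show ?thesis unfolding coef_equiv_def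
    by (intro exI[of _ C]) (use C in \<open>auto simp: invertible_def\<close>)
qed

lemma coef_equiv_trans:
  assumes "coef_equiv c c'" "coef_equiv c' c''"
  shows "coef_equiv c c''"
proof -
  obtain B C where B: "invertible B" "c' = coef (linear_subst B (cubic_poly c))"
    and C: "invertible C" "c'' = coef (linear_subst C (cubic_poly c'))"
    using assms by (auto simp: coef_equiv_def)
  have "c'' = coef (linear_subst (B ** C) (cubic_poly c))"
    by (simp add: B C cubic_poly_coef homogeneous_linear_subst linear_subst_compose)
  then show ?thesis unfolding coef_equiv_def using B C invertible_mult by blast
qed

lemma coef_equivI:
  assumes "det (mat3 a1 a2 a3 b1 b2 b3 d1 d2 d3) \<noteq> 0"
    and "\<And>x y z. cubic_val c (a1*x + a2*y + a3*z) (b1*x + b2*y + b3*z) (d1*x + d2*y + d3*z) = cubic_val c' x y z"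
  shows "coef_equiv c c'"
proof -
  have "c' = coef (linear_subst (mat3 a1 a2 a3 b1 b2 b3 d1 d2 d3) (cubic_poly c))"
    by (rule coef_linear_subst_eqI[symmetric])
       (simp_all add: eval_cubic_poly mat3_mult_vec assms)
  then show ?thesis unfolding coef_equiv_def
    using assms(1) by (auto simp: invertible_det_nz)
qed

lemma coef_equiv_obtain:
  assumes "det (mat3 a1 a2 a3 b1 b2 b3 d1 d2 d3) \<noteq> 0"
  obtains c' where "coef_equiv c c'"
    "\<And>x y z. cubic_val c' x y z = cubic_val c (a1*x + a2*y + a3*z) (b1*x + b2*y + b3*z) (d1*x + d2*y + d3*z)"
proof -
  let ?B = "mat3 a1 a2 a3 b1 b2 b3 d1 d2 d3"
  let ?g = "linear_subst ?B (cubic_poly c)"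
  have "coef_equiv c (coef ?g)"
    using assms by (auto simp: coef_equiv_def invertible_det_nz)
  moreover have "cubic_val (coef ?g) x y z =
      cubic_val c (a1*x + a2*y + a3*z) (b1*x + b2*y + b3*z) (d1*x + d2*y + d3*z)" for x y z
    using eval_cubic[of ?g "vector [x, y, z]"]
    by (simp add: homogeneous_linear_subst eval_linear_subst eval_cubic_poly mat3_mult_vec)
  ultimately show ?thesis using that by blast
qed

lemma nonsingular_equiv:
  assumes "coef_equiv c c'" "nonsingular c"
  shows "nonsingular c'"
proof -
  obtain B where B: "invertible B" "c' = coef (linear_subst B (cubic_poly c))"
    using assms by (auto simp: coef_equiv_def)
  have "smooth_form (cubic_poly c)" using assms by (simp add: smooth_form_cubic_iff)
  with B have "smooth_form (linear_subst B (cubic_poly c))" by (intro smooth_form_linear_subst)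
  then show ?thesis by (simp add: B smooth_form_cubic_iff homogeneous_linear_subst)
qed

lemma invariants_equiv:
  assumes "coef_equiv c c'"
  obtains d where "d \<noteq> 0" "c4 c' = d ^ 4 * c4 c" "c6 c' = d ^ 6 * c6 c"
proof -
  obtain B where B: "invertible B" "c' = coef (linear_subst B (cubic_poly c))"
    using assms by (auto simp: coef_equiv_def)
  then show ?thesis
    by (intro that[of "det B"]) (auto simp: c4_linear_subst c6_linear_subst invertible_det_nz)
qed

lemma disc_equiv_eq_0: "coef_equiv c c' \<Longrightarrow> disc c' = 0 \<longleftrightarrow> disc c = 0"
  by (erule invariants_equiv)
     (auto simp: disc_def power_mult_distrib simp flip: power_mult right_diff_distrib)

text \<open>The given vector is completed to a basis as its third member, so that the point becomes
  (0:0:1).\<close>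

lemma coef_equiv_move_point:
  assumes "(x0, y0, z0) \<noteq> (0, 0, 0)"
  obtains c' a1 a2 b1 b2 d1 d2 where "coef_equiv c c'"
    "\<And>x y z. cubic_val c' x y z = cubic_val c (a1*x + a2*y + x0*z) (b1*x + b2*y + y0*z) (d1*x + d2*y + z0*z)"
proof -
  consider "z0 \<noteq> 0" | "y0 \<noteq> 0" | "x0 \<noteq> 0" using assms by auto
  then have "\<exists>a1 a2 b1 b2 d1 d2. det (mat3 a1 a2 x0 b1 b2 y0 d1 d2 z0) \<noteq> 0"
  proof cases
    case 1 then show ?thesis by (intro exI[of _ 1] exI[of _ 0]) (simp add: det_mat3)
  next
    case 2
    then have "det (mat3 1 0 x0 0 0 y0 0 1 z0) \<noteq> 0" by (simp add: det_mat3)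
    then show ?thesis by blast
  next
    case 3
    then have "det (mat3 0 0 x0 1 0 y0 0 1 z0) \<noteq> 0" by (simp add: det_mat3)
    then show ?thesis by blast
  qed
  then show ?thesis using coef_equiv_obtain that by metis
qed

text \<open>The cubic is singular at (0:0:1) with tangent cone c x^2 + e x y + h y^2, and e^2 - 4ch
  is the discriminant of that cone. Both formulas together give c4^3 = c6^2.\<close>

lemma c4_c6_form_node:
  fixes a :: complex
  shows "c4_form a b c d e 0 g h 0 0 = (e^2 - 4 * c * h) ^ 2"
    and "c6_form a b c d e 0 g h 0 0 = - ((e^2 - 4 * c * h) ^ 3)"
  by (simp_all add: c4_form_def c6_form_def) algebra+

text \<open>A singular point is moved to (0:0:1), where \<open>c4_c6_form_node\<close> applies. The
  converse has to wait for the Weierstrass form.\<close>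

lemma disc_nonzero_imp_nonsingular:
  assumes "disc c \<noteq> 0"
  shows "nonsingular c"
proof (rule ccontr)
  assume "\<not> nonsingular c"
  then obtain x0 y0 z0 where p: "cubic_dx c x0 y0 z0 = 0" "cubic_dy c x0 y0 z0 = 0" "cubic_dz c x0 y0 z0 = 0"
    and nz: "(x0, y0, z0) \<noteq> (0, 0, 0)" unfolding nonsingular_def by auto
  obtain c' a1 a2 b1 b2 d1 d2 where c': "coef_equiv c c'"
    and val: "\<And>x y z. cubic_val c' x y z = cubic_val c (a1*x + a2*y + x0*z) (b1*x + b2*y + y0*z) (d1*x + d2*y + z0*z)"
    using coef_equiv_move_point[OF nz] by metis
  \<comment> \<open>The gradient at the moved point is computed along lines, where the coordinate
    change just maps lines to lines.\<close>
  have D: "u * cubic_dx c' 0 0 1 + v * cubic_dy c' 0 0 1 + w * cubic_dz c' 0 0 1 = 0" for u v w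
  proof (rule DERIV_unique)
    show "((\<lambda>t. cubic_val c' (0 + t * u) (0 + t * v) (1 + t * w)) has_field_derivative
        u * cubic_dx c' 0 0 1 + v * cubic_dy c' 0 0 1 + w * cubic_dz c' 0 0 1) (at 0)"
      by (rule cubic_val_derivative)
    have "cubic_val c' (0 + t * u) (0 + t * v) (1 + t * w) =
       cubic_val c (x0 + t * (a1*u + a2 * v + x0*w)) (y0 + t * (b1*u + b2 * v + y0*w)) (z0 + t * (d1*u + d2 * v + z0*w))" for t
      unfolding val by (simp add: algebra_simps)
    then show "((\<lambda>t. cubic_val c' (0 + t * u) (0 + t * v) (1 + t * w)) has_field_derivative 0) (at 0)"
      using cubic_val_derivative[of c x0 "a1*u + a2 * v + x0*w" y0 "b1*u + b2 * v + y0*w" z0 "d1*u + d2 * v + z0*w"]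
      by (simp add: p)
  qed
  have "c' XZ2 = 0" "c' YZ2 = 0" "c' Z3 = 0"
    using D[of 1 0 0] D[of 0 1 0] D[of 0 0 1] by (simp_all add: cubic_grad_defs)
  then have "disc c' = 0"
    by (simp add: disc_def c4_def c6_def c4_c6_form_node flip: power_mult)
  with assms disc_equiv_eq_0[OF c'] show False by simp
qed

section \<open>Weierstrass form\<close>

text \<open>The cubic \<open>y\<^sup>2z = x\<^sup>3 + axz\<^sup>2 + bz\<^sup>3\<close>.\<close>

definition weierstrass :: "'a::comm_ring_1 \<Rightarrow> 'a \<Rightarrow> mon3 \<Rightarrow> 'a" where
  "weierstrass a b = cubic_coefs (-1) 0 0 0 0 (-a) 0 1 0 (-b)"

lemma invariants_weierstrass:
  shows c4_weierstrass: "c4 (weierstrass a b) = -48 * a"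
    and c6_weierstrass: "c6 (weierstrass a b) = -864 * b"
    and disc_weierstrass: "disc (weierstrass a b) = -27648 * (4 * a^3 + 27 * b^2)"
  by (simp_all add: disc_def c4_def c6_def c4_form_def c6_form_def weierstrass_def power_mult_distrib)

lemma complex_root_exists:
  assumes "n > 0"
  obtains w :: complex where "w ^ n = z"
proof (cases "z = 0")
  case False
  then show ?thesis
    using assms by (intro that[of "exp (Ln z / of_nat n)"]) (simp flip: exp_of_nat_mult)
qed (use assms that[of 0] in simp)

text \<open>In suitable coordinates the line \<open>z = 0\<close> meets the cubic in a single point, with multiplicity
  three.\<close>

definition has_flex :: "(mon3 \<Rightarrow> complex) \<Rightarrow> bool" where
  "has_flex c \<longleftrightarrow> (\<exists>c'. coef_equiv c c' \<and> c' X2Y = 0 \<and> c' XY2 = 0 \<and> c' Y3 = 0)"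

lemma has_flex_equiv: "coef_equiv c c' \<Longrightarrow> has_flex c' \<Longrightarrow> has_flex c"
  unfolding has_flex_def using coef_equiv_trans by blast

text \<open>
  Away from \<open>x = 0\<close> the cubic below is \<open>(w + z\<^sup>2)\<^sup>2 = Q(z)\<close> with the quartic \<open>Q\<close> of the next
  lemma. On the branch \<open>w = y - z\<^sup>2\<close> with \<open>y\<^sup>2 = Q\<close>, the condition \<open>w'' = 0\<close> says that
  \<open>2QQ'' - Q'\<^sup>2 = 8Qy\<close>; the polynomial \<open>(2QQ'' - Q'\<^sup>2)\<^sup>2 - 64Q\<^sup>3\<close> has degree 8 or 9, unless \<open>Q\<close>
  is a square.
\<close>

lemma quartic_flex:
  fixes P Q R :: complex
  defines "q \<equiv> \<lambda>z. z^4 + P * z^2 + Q * z + R" and "q' \<equiv> \<lambda>z. 4 * z^3 + 2 * P * z + Q"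
    and "q'' \<equiv> \<lambda>z. 12 * z^2 + 2 * P"
  assumes sep: "\<And>z. \<not> (q z = 0 \<and> q' z = 0)"
  obtains m n z0 where "m^2 + 2 * n - P = - 6 * m * z0" "2 * m * n - Q = 6 * m * z0^2"
    "n^2 - R = - 2 * m * z0^3"
proof -
  have "\<not> (Q = 0 \<and> R = P^2 / 4)"
  proof
    assume *: "Q = 0 \<and> R = P^2 / 4"
    define z where "z = csqrt (- P / 2)"
    have z: "z^2 = - P / 2" by (simp add: z_def)
    have "q z = (z^2 + P / 2)^2" "q' z = 4 * z * (z^2 + P / 2)"
      using * by (simp_all add: q_def q'_def powers field_simps)
    with z sep[of z] show False by simp
  qed
  \<comment> \<open>The two top coefficients vanish together only in the case just excluded, so
    \<open>F\<close> is not constant.\<close>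
  define F where "F = [: -64*R^3 + Q^4 - 8*P*Q^2*R + 16*P^2*R^2, -192*Q*R^2, -240*Q^2*R, -96*Q^3 - 256*P*Q*R,
     384*R^2 - 216*P*Q^2 - 96*P^2*R, 384*Q*R - 192*P^2*Q, 48*Q^2 + 256*P*R - 64*P^3, 0, 192*R - 48*P^2, 64*Q :]"
  have "192*R - 48*P^2 \<noteq> 0 \<or> 64 * Q \<noteq> 0"
    using \<open>\<not> (Q = 0 \<and> R = P^2 / 4)\<close> by (auto simp: field_simps)
  then have "\<exists>z. poly F z = 0"
    by (intro fundamental_theorem_of_algebra_alt) (auto simp: F_def)
  then obtain z0 where z0: "poly F z0 = 0" ..
  \<comment> \<open>Squaring lost the sign of y. Solving the unsquared condition for
    \<open>y\<close> picks the branch on which w'' = 0; that \<open>y\<close> is a square root of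
    \<open>q z0\<close> follows from \<open>K\<close>.\<close>
  define y where "y = (2 * q z0 * q'' z0 - q' z0 ^ 2) / (8 * q z0)"
  have K: "(2 * q z0 * q'' z0 - q' z0 ^ 2)^2 = 64 * q z0 ^ 3"
  proof -
    have "poly F z0 = (2 * q z0 * q'' z0 - q' z0 ^ 2)^2 - 64 * q z0 ^ 3"
      unfolding F_def q_def q'_def q''_def by simp algebra
    then show ?thesis using z0 by simp
  qed
  have q0: "q z0 \<noteq> 0"
    using K sep[of z0] by auto
  have y2: "y^2 = q z0"
    using K q0 by (simp add: y_def power_divide powers)
  have y0: "y \<noteq> 0" using y2 q0 by auto
  have y1: "8 * q z0 * y = 2 * q z0 * q'' z0 - q' z0 ^ 2" using q0 by (simp add: y_def)
  \<comment> \<open>The line w = m z + n is the tangent at \<open>z0\<close> to the branch w = y -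
    z^2, whose slope is q'/(2y) - 2 z0.\<close>
  define m where "m = q' z0 / (2 * y) - 2 * z0"
  define n where "n = y - z0^2 - m * z0"
  text \<open>With \<open>L(z) = mz + n + z\<^sup>2\<close> these are the conditions \<open>L\<^sup>2 = Q\<close>, \<open>2LL' = Q'\<close> and
    \<open>2L'\<^sup>2 + 2LL'' = Q''\<close> at \<open>z\<^sub>0\<close>.\<close>
  have t0: "(m * z0 + n + z0^2)^2 = q z0" by (simp add: n_def y2)
  have L: "m * z0 + n + z0^2 = y" by (simp add: n_def)
  have L': "2 * y * (m + 2 * z0) = q' z0" using y0 by (simp add: m_def)
  have t2: "2 * (m + 2 * z0)^2 + 4 * y = q'' z0"
  proof -
    have "y^2 * (2 * (m + 2 * z0)^2 + 4 * y) * 2 = y^2 * q'' z0 * 2"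
      using L'[symmetric] y1 y2[symmetric] by algebra
    then show ?thesis using y0 by simp
  qed
  \<comment> \<open>The three equations compare coefficients in (z^2 + m z + n)^2 - q(z) = 2m (z -
    z0)^3, which expresses triple contact.\<close>
  have e1: "m^2 + 2 * n - P = - 6 * m * z0"
    using t2 L unfolding q''_def by algebra
  have e2: "2 * m * n - Q = 6 * m * z0^2"
    using L' L e1 unfolding q'_def by algebra
  have e3: "n^2 - R = - 2 * m * z0^3"
    using t0 e1 e2 unfolding q_def by algebra
  show ?thesis using that e1 e2 e3 by blast
qed

text \<open>A double root \<open>z\<close> of the quartic would give the singular point (1 : z :
  -z^2), so \<open>quartic_flex\<close> applies.\<close>

lemma has_flex_normal_form:
  fixes P Q R :: complex
  defines "c \<equiv> cubic_coefs (-R) (-Q) 0 (-P) 0 1 0 2 0 0"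
  assumes "nonsingular c"
  shows "has_flex c"
proof -
  have sep: "\<not> (z^4 + P * z^2 + Q * z + R = 0 \<and> 4 * z^3 + 2 * P * z + Q = 0)" for z
  proof
    assume *: "z^4 + P * z^2 + Q * z + R = 0 \<and> 4 * z^3 + 2 * P * z + Q = 0"
    have "cubic_dx c 1 z (- (z^2)) = 0" "cubic_dy c 1 z (- (z^2)) = 0" "cubic_dz c 1 z (- (z^2)) = 0"
    proof -
      have "cubic_dx c 1 z (- (z^2)) = z^4 - P * z^2 - 2 * Q * z - 3 * R"
        "cubic_dy c 1 z (- (z^2)) = - (4 * z^3 + 2 * P * z + Q)" "cubic_dz c 1 z (- (z^2)) = 0"
        by (simp_all add: cubic_grad_defs c_def algebra_simps
            powers)
      moreover have "z^4 - P * z^2 - 2 * Q * z - 3 * R = 0" using * by algebra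
      ultimately show "cubic_dx c 1 z (- (z^2)) = 0" "cubic_dy c 1 z (- (z^2)) = 0"
        "cubic_dz c 1 z (- (z^2)) = 0" using * by simp_all
    qed
    with assms(2) show False unfolding nonsingular_def by (metis one_neq_zero)
  qed
  obtain m n z0 where e: "m^2 + 2 * n - P = - 6 * m * z0" "2 * m * n - Q = 6 * m * z0^2"
    "n^2 - R = - 2 * m * z0^3"
    using quartic_flex[of P Q R] sep by metis
  define w0 where "w0 = m * z0 + n"
  \<comment> \<open>In the new coordinates the flex is (0:1:0) and its tangent, the line w = m z + n
    of \<open>quartic_flex\<close>, is z = 0.\<close>
  have "coef_equiv c (cubic_coefs (2*m) 0 2 0 (2*m + 4*z0) 0 0 (2*w0 + 2*z0^2) 1 0)"
  proof (rule coef_equivI)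
    show "det (mat3 0 1 0 1 z0 0 m w0 1) \<noteq> 0" by (simp add: det_mat3)
    show "cubic_val c (0 * x + 1 * y + 0 * z) (1 * x + z0 * y + 0 * z) (m * x + w0 * y + 1 * z) =
        cubic_val (cubic_coefs (2*m) 0 2 0 (2*m + 4*z0) 0 0 (2*w0 + 2*z0^2) 1 0) x y z" for x y z
      using e unfolding w0_def c_def cubic_val_def cubic_coefs_simps by algebra
  qed
  then show ?thesis unfolding has_flex_def by (rule_tac exI, intro conjI) (assumption, simp_all)
qed

text \<open>Take any point of the cubic and its tangent. Either the point is a flex, or completing
  squares leads to the normal form treated above.\<close>

lemma exists_flex:
  assumes "nonsingular c"
  shows "has_flex c"
proof -
  obtain x0 y0 z0 where p: "(x0, y0, z0) \<noteq> (0, 0, 0)" "cubic_val c x0 y0 z0 = 0"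
  proof (cases "c X3 = 0")
    case True
    then show ?thesis using that[of 1 0 0] by (simp add: cubic_val_def)
  next
    case False
    then have "\<exists>t. poly [:c Y3, c XY2, c X2Y, c X3:] t = 0"
      by (intro fundamental_theorem_of_algebra_alt) auto
    then obtain t where "poly [:c Y3, c XY2, c X2Y, c X3:] t = 0" ..
    then show ?thesis
      by (intro that[of t 1 0]) (simp_all add: cubic_val_def algebra_simps powers)
  qed
  obtain c1 a1 a2 b1 b2 d1 d2 where c1: "coef_equiv c c1"
    and val1: "\<And>x y z. cubic_val c1 x y z = cubic_val c (a1*x + a2*y + x0*z) (b1*x + b2*y + y0*z) (d1*x + d2*y + z0*z)"
    using coef_equiv_move_point[OF p(1)] by metis
  have Z1: "c1 Z3 = 0"
    using val1[of 0 0 1] p(2) by (simp add: cubic_val_def[of c1])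
  have ns1: "nonsingular c1" using nonsingular_equiv c1 assms by blast
  have lin: "c1 XZ2 \<noteq> 0 \<or> c1 YZ2 \<noteq> 0"
  proof (rule ccontr)
    assume "\<not> ?thesis"
    then have "cubic_dx c1 0 0 1 = 0" "cubic_dy c1 0 0 1 = 0" "cubic_dz c1 0 0 1 = 0"
      using Z1 by (simp_all add: cubic_grad_defs)
    with ns1 show False unfolding nonsingular_def by (metis one_neq_zero)
  qed
  \<comment> \<open>Now (0:0:1) is on the cubic with tangent x = 0, along which the cubic is g y^3 +
    r y^2 z.\<close>
  obtain a b p q d r g where c2: "coef_equiv c1 (cubic_coefs a b p d q 1 g r 0 0)"
  proof (cases "c1 XZ2 = 0")
    case False
    let ?k = "c1 XZ2"
    let ?l = "c1 YZ2"
    have "\<exists>a b p q d r g. coef_equiv c1 (cubic_coefs a b p d q 1 g r 0 0)"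
    proof (intro exI, rule coef_equivI)
      show "det (mat3 (1 / ?k) (- ?l / ?k) 0 0 1 0 0 0 1) \<noteq> 0" using False by (simp add: det_mat3)
      show "cubic_val c1 (1 / ?k * x + - ?l / ?k * y + 0 * z) (0 * x + 1 * y + 0 * z) (0 * x + 0 * y + 1 * z)
         = cubic_val (cubic_coefs (c1 X3 / ?k^3) (-3 * c1 X3 * ?l / ?k^3 + c1 X2Y / ?k^2) (c1 X2Z / ?k^2)
             (3 * c1 X3 * ?l^2 / ?k^3 - 2 * c1 X2Y * ?l / ?k^2 + c1 XY2 / ?k)
             (-2 * c1 X2Z * ?l / ?k^2 + c1 XYZ / ?k) 1
             (- c1 X3 * ?l^3 / ?k^3 + c1 X2Y * ?l^2 / ?k^2 - c1 XY2 * ?l / ?k + c1 Y3)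
             (c1 X2Z * ?l^2 / ?k^2 - c1 XYZ * ?l / ?k + c1 Y2Z) 0 0) x y z" for x y z
        using False Z1
        by (simp add: cubic_val_def field_simps powers)
    qed
    then show ?thesis using that by blast
  next
    case True
    let ?l = "c1 YZ2"
    have "\<exists>a b p q d r g. coef_equiv c1 (cubic_coefs a b p d q 1 g r 0 0)"
    proof (intro exI, rule coef_equivI)
      show "det (mat3 0 1 0 (1 / ?l) 0 0 0 0 1) \<noteq> 0" using True lin by (simp add: det_mat3)
      show "cubic_val c1 (0 * x + 1 * y + 0 * z) (1 / ?l * x + 0 * y + 0 * z) (0 * x + 0 * y + 1 * z)
         = cubic_val (cubic_coefs (c1 Y3 / ?l^3) (c1 XY2 / ?l^2) (c1 Y2Z / ?l^2) (c1 X2Y / ?l)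
             (c1 XYZ / ?l) 1 (c1 X3) (c1 X2Z) 0 0) x y z" for x y z
        using True lin Z1
        by (simp add: cubic_val_def field_simps powers)
    qed
    then show ?thesis using that by blast
  qed
  show ?thesis
  proof (cases "r = 0")
    case True
    \<comment> \<open>With \<open>r = 0\<close> the tangent x = 0 already has triple contact;
      permuting the coordinates makes it z = 0.\<close>
    have "coef_equiv (cubic_coefs a b p d q 1 g r 0 0) (cubic_coefs g 0 d 0 q b 0 1 p a)"
      by (rule coef_equivI[of 0 0 1 1 0 0 0 1 0])
         (simp_all add: True det_mat3 cubic_val_def field_simps powers)
    then have "has_flex (cubic_coefs a b p d q 1 g r 0 0)"
      unfolding has_flex_def by (intro exI[of _ "cubic_coefs g 0 d 0 q b 0 1 p a"]) simp
    then show ?thesis using has_flex_equiv c1 c2 by blast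
  next
    case False
    obtain \<mu> where \<mu>: "\<mu> ^ 2 = 2 / r" using complex_root_exists[of 2] by auto
    have \<mu>r: "\<mu> ^ 2 * r = 2" "\<mu> \<noteq> 0" using \<mu> False by auto
    have "\<exists>a b d g. coef_equiv (cubic_coefs a' b' p' d' q' 1 g' r 0 0) (cubic_coefs a b 0 d 0 1 g 2 0 0)"
      for a' b' p' d' q' g'
    proof (intro exI, rule coef_equivI)
      \<comment> \<open>Completing the square in z: the shift by \<open>u*x + w*y\<close> removes
        the terms x^2 z and x y z, while \<open>\<mu>\<close> has scaled the coefficient of y^2 z to
        2.\<close>
      define u w where "u = p' / 2" and "w = \<mu> * q' / 2"
      have uw: "p' = 2 * u" "\<mu> * q' = 2 * w" by (simp_all add: u_def w_def)
      show "det (mat3 1 0 0 0 \<mu> 0 (-u) (-w) 1) \<noteq> 0" using \<mu>r by (simp add: det_mat3)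
      show "cubic_val (cubic_coefs a' b' p' d' q' 1 g' r 0 0) (1 * x + 0 * y + 0 * z) (0 * x + \<mu> * y + 0 * z)
            (-u * x + -w * y + 1 * z) =
          cubic_val (cubic_coefs (a' - u^2) (\<mu> * b' - 2 * u * w) 0 (\<mu>^2 * d' - w^2 - 2 * u) 0 1
            (\<mu>^3 * g' - 2 * w) 2 0 0) x y z" for x y z
      proof -
        have e1: "q' * x * (\<mu> * y) = 2 * w * x * y"
          using arg_cong[OF uw(2), of "\<lambda>s. s * x * y"] by (simp add: mult_ac)
        have e2: "r * (\<mu> * y)^2 = 2 * y^2"
          using arg_cong[OF \<mu>r(1), of "\<lambda>s. s * y^2"] by (simp add: power_mult_distrib mult_ac)
        have "a' * x^3 + b' * x^2 * (\<mu> * y) + p' * x^2 * (-u * x + -w * y + z) + d' * x * (\<mu> * y)^2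
            + q' * x * (\<mu> * y) * (-u * x + -w * y + z) + x * (-u * x + -w * y + z)^2 + g' * (\<mu> * y)^3
            + r * (\<mu> * y)^2 * (-u * x + -w * y + z) =
          (a' - u^2) * x^3 + (\<mu> * b' - 2 * u * w) * x^2 * y + (\<mu>^2 * d' - w^2 - 2 * u) * x * y^2 + x * z^2
            + (\<mu>^3 * g' - 2 * w) * y^3 + 2 * y^2 * z"
          unfolding e1 e2 uw(1) by algebra
        then show ?thesis by (simp add: cubic_val_def)
      qed
    qed
    then obtain a b d g where c4: "coef_equiv c1 (cubic_coefs a b 0 d 0 1 g 2 0 0)"
      using c2 coef_equiv_trans by blast
    \<comment> \<open>For x = 1 the cubic is (z + y^2)^2 - (y^4 - g y^3 - d y^2 - b y - a). The
      shift of y by \<open>t\<close>, with z adjusted to preserve z + y^2, removes the cubic term of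
      the quartic.\<close>
    define t where "t = g / 4"
    define D where "D = d + g^2/4"
    have g: "g = 4 * t" and d: "d = D - 4 * t^2" by (simp_all add: t_def D_def power_divide)
    have "coef_equiv (cubic_coefs a b 0 d 0 1 g 2 0 0)
       (cubic_coefs (-(t^4 - D*t^2 - b*t - a)) (-(-2*D*t - b)) 0 (-(-2*t^2 - D)) 0 1 0 2 0 0)"
      by (rule coef_equivI[of 1 0 0 t 1 0 "t^2 - 2*t*t" "-2*t" 1])
         (simp_all add: det_mat3 cubic_val_def g d algebra_simps powers)
    with c4 c1 have c5: "coef_equiv c 
       (cubic_coefs (-(t^4 - D*t^2 - b*t - a)) (-(-2*D*t - b)) 0 (-(-2*t^2 - D)) 0 1 0 2 0 0)"
      using coef_equiv_trans by blast
    from has_flex_equiv[OF c5 has_flex_normal_form[OF nonsingular_equiv[OF c5 assms]]]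
    show ?thesis .
  qed
qed

text \<open>With the flex at (0:1:0) and tangent z = 0, smoothness makes the coefficients of x^3 and
  y^2 z nonzero; scaling, completing the square in y and the cube in x do the rest.\<close>

lemma weierstrass_form:
  assumes "nonsingular c"
  obtains a b where "coef_equiv c (weierstrass a b)"
proof -
  obtain c' where c': "coef_equiv c c'" "c' X2Y = 0" "c' XY2 = 0" "c' Y3 = 0"
    using exists_flex[OF assms] by (auto simp: has_flex_def)
  have ns: "nonsingular c'" using nonsingular_equiv c' assms by blast
  let ?k = "c' X3" and ?d = "c' Y2Z"
  have d: "?d \<noteq> 0"
  proof
    assume "?d = 0"
    then have "cubic_dx c' 0 1 0 = 0" "cubic_dy c' 0 1 0 = 0" "cubic_dz c' 0 1 0 = 0"
      using c' by (simp_all add: cubic_grad_defs)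
    with ns show False unfolding nonsingular_def by (metis one_neq_zero)
  qed
  have k: "?k \<noteq> 0"
  proof
    assume k: "?k = 0"
    \<comment> \<open>If \<open>k\<close> vanished, z would divide the cubic, and it would be
      singular where the line z = 0 meets the residual conic.\<close>
    have "\<exists>y. poly [:c' X2Z, c' XYZ, ?d:] y = 0"
      using d by (intro fundamental_theorem_of_algebra_alt) auto
    then obtain y where "poly [:c' X2Z, c' XYZ, ?d:] y = 0" ..
    then have "cubic_dx c' 1 y 0 = 0" "cubic_dy c' 1 y 0 = 0" "cubic_dz c' 1 y 0 = 0"
      using c' k by (simp_all add: cubic_grad_defs algebra_simps power2_eq_square)
    with ns show False unfolding nonsingular_def by (metis one_neq_zero)
  qed
  obtain \<xi> where "\<xi> ^ 3 = -1 / ?k" using complex_root_exists[of 3] by auto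
  then have \<xi>: "\<xi> ^ 3 * ?k = -1" "\<xi> \<noteq> 0" using k by auto
  obtain \<eta> where "\<eta> ^ 2 = 1 / ?d" using complex_root_exists[of 2] by auto
  then have \<eta>: "\<eta> ^ 2 * ?d = 1" "\<eta> \<noteq> 0" using d by auto
  have scaled: "coef_equiv c' (cubic_coefs (-1) 0 (c' X2Z * \<xi>^2) 0 (c' XYZ * \<xi> * \<eta>) (c' XZ2 * \<xi>) 0 1 (c' YZ2 * \<eta>) (c' Z3))"
  proof (rule coef_equivI)
    show "det (mat3 \<xi> 0 0 0 \<eta> 0 0 0 1) \<noteq> 0" using \<xi> \<eta> by (simp add: det_mat3)
    show "cubic_val c' (\<xi> * x + 0 * y + 0 * z) (0 * x + \<eta> * y + 0 * z) (0 * x + 0 * y + 1 * z) =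
        cubic_val (cubic_coefs (-1) 0 (c' X2Z * \<xi>^2) 0 (c' XYZ * \<xi> * \<eta>) (c' XZ2 * \<xi>) 0 1 (c' YZ2 * \<eta>) (c' Z3)) x y z"
      for x y z
      using \<xi>(1) \<eta>(1) c'(2-4) unfolding cubic_val_def cubic_coefs_simps by algebra
  qed
  have square: "coef_equiv (cubic_coefs (-1) 0 l 0 e m 0 1 f n)
      (cubic_coefs (-1) 0 (l - e^2/4) 0 0 (m - e*f/2) 0 1 0 (n - f^2/4))" for l e m f n :: complex
    by (rule coef_equivI[of 1 0 0 "-e/2" 1 "-f/2" 0 0 1])
       (simp_all add: det_mat3 cubic_val_def field_simps powers)
  have cube: "coef_equiv (cubic_coefs (-1) 0 l 0 0 m 0 1 0 n)
      (weierstrass (-(m + l^2/3)) (-(n + l*m/3 + 2*l^3/27)))" for l m n :: complex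
    unfolding weierstrass_def
    by (rule coef_equivI[of 1 0 "l/3" 0 1 0 0 0 1])
       (simp_all add: det_mat3 cubic_val_def field_simps powers)
  show ?thesis
    by (rule that) (rule coef_equiv_trans[OF c'(1) coef_equiv_trans[OF scaled coef_equiv_trans[OF square cube]]])
qed

lemma nonsingular_weierstrass_iff:
  "nonsingular (weierstrass a b) \<longleftrightarrow> 4 * a^3 + 27 * b^2 \<noteq> 0"
proof
  assume ns: "nonsingular (weierstrass a b)"
  show "4 * a^3 + 27 * b^2 \<noteq> 0"
  proof
    assume disc: "4 * a^3 + 27 * b^2 = 0"
    \<comment> \<open>The double root of X^3 + aX + b; if a = 0, then b = 0 as well and the root is
      0.\<close>
    define x where "x = (if a = 0 then 0 else - 3 * b / (2 * a))"
    have "3 * x^2 + a = 0 \<and> 2 * a * x + 3 * b = 0"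
    proof (cases "a = 0")
      case True
      with disc show ?thesis by (simp add: x_def)
    next
      case False
      then have "(3 * x^2 + a) * (4 * a^2) = 4 * a^3 + 27 * b^2"
        by (simp add: x_def field_simps powers)
      with disc False show ?thesis by (auto simp: x_def)
    qed
    then have "cubic_dx (weierstrass a b) x 0 1 = 0" "cubic_dy (weierstrass a b) x 0 1 = 0"
      "cubic_dz (weierstrass a b) x 0 1 = 0"
      by (simp_all add: cubic_grad_defs weierstrass_def) algebra+
    with ns show False unfolding nonsingular_def by (metis one_neq_zero)
  qed
next
  assume "4 * a^3 + 27 * b^2 \<noteq> 0"
  then show "nonsingular (weierstrass a b)"
    by (intro disc_nonzero_imp_nonsingular) (simp only: disc_weierstrass mult_eq_0_iff, simp)
qed

lemma nonsingular_iff_disc: "nonsingular c \<longleftrightarrow> disc c \<noteq> 0"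
proof
  assume ns: "nonsingular c"
  then obtain a b where W: "coef_equiv c (weierstrass a b)" by (rule weierstrass_form)
  then have "4 * a^3 + 27 * b^2 \<noteq> 0"
    using nonsingular_equiv[OF W ns] nonsingular_weierstrass_iff by blast
  then have "disc (weierstrass a b) \<noteq> 0" by (simp only: disc_weierstrass mult_eq_0_iff) simp
  then show "disc c \<noteq> 0" using disc_equiv_eq_0[OF W] by simp
qed (rule disc_nonzero_imp_nonsingular)

lemma smooth_form_iff_disc: "homogeneous 3 g \<Longrightarrow> smooth_form g \<longleftrightarrow> disc (coef g) \<noteq> 0"
  by (simp add: smooth_form_cubic_iff nonsingular_iff_disc)

section \<open>Classification by the j-invariant\<close>

text \<open>Replace z by \<open>\<gamma>\<close> z and y by \<open>\<beta>\<close> y with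
  \<open>\<beta>^2 * \<gamma> = 1\<close>, which keeps the coefficient of y^2 z.\<close>

lemma weierstrass_twist:
  assumes "\<gamma> \<noteq> 0"
  shows "coef_equiv (weierstrass a b) (weierstrass (\<gamma>^2 * a) (\<gamma>^3 * b))"
proof -
  obtain \<beta> where "\<beta> ^ 2 = 1 / \<gamma>" using complex_root_exists[of 2] by auto
  then have \<beta>: "\<beta> ^ 2 * \<gamma> = 1" "\<beta> \<noteq> 0" using assms by auto
  show ?thesis
  proof (rule coef_equivI)
    show "det (mat3 1 0 0 0 \<beta> 0 0 0 \<gamma>) \<noteq> 0" using \<beta> assms by (simp add: det_mat3)
    show "cubic_val (weierstrass a b) (1 * x + 0 * y + 0 * z) (0 * x + \<beta> * y + 0 * z) (0 * x + 0 * y + \<gamma> * z) =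
       cubic_val (weierstrass (\<gamma>^2 * a) (\<gamma>^3 * b)) x y z" for x y z
      using \<beta>(1) unfolding cubic_val_def weierstrass_def cubic_coefs_simps by algebra
  qed
qed

text \<open>This is j/1728, since \<open>disc\<close> is 1728 times the discriminant.\<close>

definition j_inv :: "(mon3 \<Rightarrow> complex) \<Rightarrow> complex" where
  "j_inv c = c4 c ^ 3 / disc c"

lemma j_inv_equiv:
  assumes "coef_equiv c c'"
  shows "j_inv c' = j_inv c"
proof -
  obtain d where d: "d \<noteq> 0" "c4 c' = d ^ 4 * c4 c" "c6 c' = d ^ 6 * c6 c"
    using assms by (rule invariants_equiv)
  then have "disc c' = d ^ 12 * disc c" "c4 c' ^ 3 = d ^ 12 * c4 c ^ 3"
    by (simp_all add: disc_def power_mult_distrib right_diff_distrib flip: power_mult)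
  then show ?thesis using d(1) by (simp add: j_inv_def)
qed

lemma j_inv_eq_imp_equiv:
  assumes "nonsingular c" "nonsingular c'" "j_inv c = j_inv c'"
  shows "coef_equiv c c'"
proof -
  obtain a b where W: "coef_equiv c (weierstrass a b)" using assms(1) by (rule weierstrass_form)
  obtain a' b' where W': "coef_equiv c' (weierstrass a' b')" using assms(2) by (rule weierstrass_form)
  have D: "4 * a^3 + 27 * b^2 \<noteq> 0" "4 * a'^3 + 27 * b'^2 \<noteq> 0"
    using nonsingular_equiv W W' assms nonsingular_weierstrass_iff by blast+
  have "j_inv (weierstrass a b) = j_inv (weierstrass a' b')"
    using assms(3) j_inv_equiv W W' by simp
  moreover have "disc (weierstrass a b) \<noteq> 0" "disc (weierstrass a' b') \<noteq> 0"
    using D by (simp_all only: disc_weierstrass mult_eq_0_iff) simp_all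
  ultimately have "c4 (weierstrass a b) ^ 3 * disc (weierstrass a' b') = c4 (weierstrass a' b') ^ 3 * disc (weierstrass a b)"
    by (metis j_inv_def frac_eq_eq)
  \<comment> \<open>Equal j means equal ratios a^3 : b^2, so the pairs can only differ by weights 2
    and 3, that is, by a twist.\<close>
  then have cross: "a^3 * b'^2 = a'^3 * b^2"
    unfolding c4_weierstrass disc_weierstrass by algebra
  have "\<exists>\<gamma>. \<gamma> \<noteq> 0 \<and> a' = \<gamma>^2 * a \<and> b' = \<gamma>^3 * b"
  proof -
    consider "a = 0" | "b = 0" | "a \<noteq> 0" "b \<noteq> 0" by blast
    then show ?thesis
    proof cases
      case 1
      with cross D have "b \<noteq> 0" "a' = 0" "b' \<noteq> 0" by auto
      obtain \<gamma> where "\<gamma> ^ 3 = b' / b" using complex_root_exists[of 3] by auto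
      then show ?thesis using 1 \<open>b \<noteq> 0\<close> \<open>a' = 0\<close> \<open>b' \<noteq> 0\<close> by (intro exI[of _ \<gamma>]) auto
    next
      case 2
      with cross D have "a \<noteq> 0" "b' = 0" "a' \<noteq> 0" by auto
      obtain \<gamma> where "\<gamma> ^ 2 = a' / a" using complex_root_exists[of 2] by auto
      then show ?thesis using 2 \<open>a \<noteq> 0\<close> \<open>b' = 0\<close> \<open>a' \<noteq> 0\<close> by (intro exI[of _ \<gamma>]) auto
    next
      case 3
      with cross D have nz: "a' \<noteq> 0" "b' \<noteq> 0" by auto
      \<comment> \<open>The quotient of b'/b = \<open>\<gamma>^3\<close> by a'/a =
        \<open>\<gamma>^2\<close>.\<close>
      define \<gamma> where "\<gamma> = b' * a / (b * a')"
      have "\<gamma>^2 * a * (b^2 * a'^2) = a' * (b^2 * a'^2)"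
        using 3 nz cross by (simp add: \<gamma>_def power_divide power_mult_distrib) algebra
      moreover have "\<gamma>^3 * b * (b^3 * a'^3) = b' * (b^3 * a'^3)"
        using 3 nz cross by (simp add: \<gamma>_def power_divide power_mult_distrib) algebra
      ultimately show ?thesis using 3 nz by (intro exI[of _ \<gamma>]) (auto simp: \<gamma>_def)
    qed
  qed
  then obtain \<gamma> where "\<gamma> \<noteq> 0" "a' = \<gamma>^2 * a" "b' = \<gamma>^3 * b" by blast
  then have "coef_equiv (weierstrass a b) (weierstrass a' b')" using weierstrass_twist by simp
  then show ?thesis using W W' coef_equiv_trans coef_equiv_sym by blast
qed

text \<open>Twisting by a root \<open>\<gamma>\<close> of
  \<open>a * \<gamma>^2 + b * \<gamma>^3 = 1\<close> moves (a, b) to the line a + b = 1. Such a root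
  exists because a and b are not both 0.\<close>

lemma nonsingular_pencil_form:
  assumes "nonsingular c"
  obtains t where "coef_equiv c (weierstrass t (1 - t))"
proof -
  obtain a b where W: "coef_equiv c (weierstrass a b)" using assms by (rule weierstrass_form)
  then have "4 * a^3 + 27 * b^2 \<noteq> 0"
    using nonsingular_equiv[OF W assms] nonsingular_weierstrass_iff by blast
  then have "\<exists>\<gamma>. poly [:-1, 0, a, b:] \<gamma> = 0"
    by (intro fundamental_theorem_of_algebra_alt) auto
  then obtain \<gamma> where "poly [:-1, 0, a, b:] \<gamma> = 0" ..
  then have \<gamma>: "\<gamma>^2 * a + \<gamma>^3 * b = 1" by (simp add: algebra_simps powers)
  then have "\<gamma> \<noteq> 0" "\<gamma>^3 * b = 1 - \<gamma>^2 * a" by (auto simp: eq_diff_eq add.commute)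
  then have "coef_equiv (weierstrass a b) (weierstrass (\<gamma>^2 * a) (1 - \<gamma>^2 * a))"
    using weierstrass_twist[of \<gamma> a b] by simp
  then show ?thesis using that W coef_equiv_trans by blast
qed

section \<open>The topology of the moduli space\<close>

lemma eval_c4: "eval_poly a (c4 p) = c4 (\<lambda>m. eval_poly a (p m))"
  and eval_c6: "eval_poly a (c6 p) = c6 (\<lambda>m. eval_poly a (p m))"
  unfolding c4_def c6_def c4_form_def c6_form_def
  by (simp_all only: eval_poly_diff eval_poly_uminus eval_poly_numeral eval_poly_add eval_poly_mult eval_poly_power)

lemma poly_c4: "poly (c4 p) t = c4 (\<lambda>m. poly (p m) t)"
  and poly_c6: "poly (c6 p) t = c6 (\<lambda>m. poly (p m) t)"
  for t :: complex
  by (simp_all add: c4_def c6_def c4_form_def c6_form_def)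

lemma poly_disc: "poly (disc p) t = disc (\<lambda>m. poly (p m) t)" for t :: complex
  by (simp add: disc_def poly_c4 poly_c6)

text \<open>Testing the single factor 2 is enough because its powers are distinct. Homogeneity of
  expressions in the invariants is thus read off from their scaling laws.\<close>

lemma homogeneousI_eval:
  assumes "\<And>a. eval_poly (\<lambda>i. 2 * a i) F = 2 ^ d * eval_poly a F"
  shows "homogeneous d F"
  unfolding homogeneous_def
proof
  fix m assume m: "m \<in> keys F"
  have scale: "monom_val (\<lambda>i. 2 * a i) m = 2 ^ exponent_degree m * monom_val a m"
    for a :: "'a \<Rightarrow> complex" and m
    by (simp add: monom_val_def exponent_degree_def power_mult_distrib prod.distrib power_sum)
  have "(2 ^ exponent_degree m - 2 ^ d) * lookup F m = 0"
  proof (rule monomials_independent[OF finite_keys _ m])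
    fix a :: "'a \<Rightarrow> complex"
    have "(\<Sum>m\<in>keys F. 2 ^ exponent_degree m * lookup F m * monom_val a m) =
        (\<Sum>m\<in>keys F. 2 ^ d * lookup F m * monom_val a m)"
      using assms[of a] unfolding eval_poly_monom_val scale sum_distrib_left by (simp only: mult_ac)
    then show "(\<Sum>m\<in>keys F. (2 ^ exponent_degree m - 2 ^ d) * lookup F m * monom_val a m) = 0"
      by (simp only: left_diff_distrib sum_subtractf) simp
  qed
  then have "of_nat (2 ^ exponent_degree m) = (of_nat (2 ^ d) :: complex)"
    using m by (simp add: in_keys_iff)
  then show "exponent_degree m = d" by (simp only: of_nat_eq_iff) simp
qed

lemma proj_point_eq_iff: "proj_point a = proj_point b \<longleftrightarrow> (\<exists>c\<noteq>0. b = (\<lambda>i. c * a i))"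
proof
  assume *: "proj_point a = proj_point b"
  have "b \<in> proj_point b" unfolding proj_point_def by (auto intro: exI[of _ 1])
  with * show "\<exists>c\<noteq>0. b = (\<lambda>i. c * a i)" unfolding proj_point_def by auto
next
  assume "\<exists>c\<noteq>0. b = (\<lambda>i. c * a i)"
  then obtain c where c: "c \<noteq> 0" "b = (\<lambda>i. c * a i)" by blast
  show "proj_point a = proj_point b" unfolding proj_point_def c(2)
  proof safe
    fix d :: complex assume "d \<noteq> 0"
    then show "\<exists>e. (\<lambda>i. d * a i) = (\<lambda>i. e * (c * a i)) \<and> e \<noteq> 0"
      using c by (intro exI[of _ "d / c"]) auto
  next
    fix d :: complex assume "d \<noteq> 0"
    then show "\<exists>e. (\<lambda>i. d * (c * a i)) = (\<lambda>i. e * a i) \<and> e \<noteq> 0"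
      using c by (intro exI[of _ "d * c"]) auto
  qed
qed

lemma ball_proj_point:
  assumes "homogeneous d F"
  shows "(\<forall>b\<in>proj_point a. eval_poly b F \<noteq> 0) \<longleftrightarrow> eval_poly a F \<noteq> 0"
  unfolding proj_point_def
  by (auto simp: eval_poly_scale[OF assms] intro: exI[of _ 1])

definition smooth_cubic :: "3 mpoly \<Rightarrow> bool" where
  "smooth_cubic g \<longleftrightarrow> homogeneous 3 g \<and> smooth_form g"

lemma smooth_cubicD:
  assumes "smooth_cubic g"
  shows "homogeneous 3 g" "smooth_form g" "disc (coef g) \<noteq> 0" "nonsingular (coef g)" "g \<noteq> 0"
proof -
  show *: "homogeneous 3 g" "smooth_form g" "disc (coef g) \<noteq> 0" "nonsingular (coef g)"
    using assms smooth_form_iff_disc smooth_form_cubic_iff by (auto simp: smooth_cubic_def)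
  show "g \<noteq> 0"
  proof
    assume "g = 0"
    then have "coef g = (\<lambda>m. 0)" by (auto simp: coef_def)
    with * show False by (simp add: disc_def c4_def c6_def c4_form_def c6_form_def)
  qed
qed

lemma smooth_cubic_iff: "homogeneous 3 g \<Longrightarrow> smooth_cubic g \<longleftrightarrow> disc (coef g) \<noteq> 0"
  by (auto simp: smooth_cubic_def smooth_form_iff_disc)

lemma smooth_cubics_alt: "smooth_cubics = form_point ` {g. smooth_cubic g}"
  unfolding smooth_cubics_def by (auto simp: smooth_cubic_def) (metis smooth_cubic_def smooth_cubicD(5))

lemma form_point_eq_iff:
  assumes "homogeneous 3 g" "homogeneous 3 h"
  shows "form_point g = form_point h \<longleftrightarrow> (\<exists>c\<noteq>0. coef h = (\<lambda>m. c * coef g m))"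
  unfolding form_point_def proj_point_eq_iff
proof safe
  fix c :: complex assume c: "c \<noteq> 0" "lookup h = (\<lambda>i. c * lookup g i)"
  show "\<exists>c. c \<noteq> 0 \<and> coef h = (\<lambda>m. c * coef g m)"
    by (rule exI[of _ c]) (auto simp: coef_def c)
next
  fix c :: complex assume c: "c \<noteq> 0" "coef h = (\<lambda>m. c * coef g m)"
  have "lookup h m = c * lookup g m" for m
  proof (cases "m \<in> range mon_exp")
    case True
    then obtain n where n: "m = mon_exp n" by auto
    show ?thesis using fun_cong[OF c(2), of n] by (simp only: n coef_def)
  next
    case False
    then have "exponent_degree m \<noteq> 3" using exponent_degree_3_imp_mon_exp by blast
    then have "m \<notin> keys g" "m \<notin> keys h"
      using assms by (auto simp: homogeneous_def)
    then show ?thesis by (simp add: in_keys_iff)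
  qed
  then show "\<exists>c. c \<noteq> 0 \<and> lookup h = (\<lambda>i. c * lookup g i)"
    using c(1) by blast
qed

lemma j_inv_scale: "t \<noteq> 0 \<Longrightarrow> j_inv (\<lambda>m. t * c m) = j_inv c"
  by (simp add: j_inv_def c4_scale disc_scale power_mult_distrib flip: power_mult)

definition moduli_class :: "3 mpoly \<Rightarrow> ((3 \<Rightarrow>\<^sub>0 nat) \<Rightarrow> complex) set set" where
  "moduli_class g = pgl_rel `` {form_point g}"

text \<open>Orbits are level sets of j: one inclusion is invariance under substitution and under
  scaling of the form, the other is \<open>j_inv_eq_imp_equiv\<close>.\<close>

lemma moduli_class_eq:
  assumes "smooth_cubic g"
  shows "moduli_class g = form_point ` {h. smooth_cubic h \<and> j_inv (coef h) = j_inv (coef g)}"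
proof (intro subset_antisym subsetI)
  fix q assume "q \<in> moduli_class g"
  then obtain g' B where *: "form_point g = form_point g'" "q = form_point (linear_subst B g')"
    "homogeneous 3 g'" "smooth_form g'" "invertible B"
    by (auto simp: moduli_class_def pgl_rel_def)
  then obtain c where "c \<noteq> 0" "coef g' = (\<lambda>m. c * coef g m)"
    using form_point_eq_iff[of g g'] smooth_cubicD(1)[OF assms] by auto
  then have "j_inv (coef g') = j_inv (coef g)" using j_inv_scale by simp
  moreover have "smooth_cubic (linear_subst B g')"
    using * by (auto simp: smooth_cubic_def homogeneous_linear_subst smooth_form_linear_subst)
  moreover have "j_inv (coef (linear_subst B g')) = j_inv (coef g')"
    using * by (intro j_inv_equiv coef_equiv_linear_subst)
  ultimately show "q \<in> form_point ` {h. smooth_cubic h \<and> j_inv (coef h) = j_inv (coef g)}"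
    using * by auto
next
  fix q assume "q \<in> form_point ` {h. smooth_cubic h \<and> j_inv (coef h) = j_inv (coef g)}"
  then obtain h where h: "q = form_point h" "smooth_cubic h" "j_inv (coef g) = j_inv (coef h)" by auto
  have "coef_equiv (coef g) (coef h)"
    using smooth_cubicD(4) assms h j_inv_eq_imp_equiv by blast
  then obtain B where B: "invertible B" "coef h = coef (linear_subst B g)"
    using smooth_cubicD(1)[OF assms] by (auto simp: coef_equiv_def cubic_poly_coef)
  then have "h = linear_subst B g"
    using cubic_poly_coef smooth_cubicD(1) assms h(2) homogeneous_linear_subst by metis
  then show "q \<in> moduli_class g"
    using B(1) h(1) smooth_cubicD[OF assms] by (auto simp: moduli_class_def pgl_rel_def)
qed

lemma moduli_class_eq_iff:
  assumes "smooth_cubic g" "smooth_cubic h"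
  shows "moduli_class g = moduli_class h \<longleftrightarrow> j_inv (coef g) = j_inv (coef h)"
proof
  assume "moduli_class g = moduli_class h"
  moreover have "form_point h \<in> moduli_class h"
    using assms by (auto simp: moduli_class_eq)
  ultimately have "form_point h \<in> moduli_class g" by simp
  then obtain h' where h': "smooth_cubic h'" "form_point h = form_point h'" "j_inv (coef h') = j_inv (coef g)"
    unfolding moduli_class_eq[OF assms(1)] by auto
  then obtain c where "c \<noteq> 0" "coef h' = (\<lambda>m. c * coef h m)"
    using form_point_eq_iff[of h h'] smooth_cubicD(1) assms by auto
  with h' show "j_inv (coef g) = j_inv (coef h)" using j_inv_scale by simp
qed (simp add: moduli_class_eq assms)

lemma lookup_outside_3: "homogeneous d g \<Longrightarrow> exponent_degree m \<noteq> d \<Longrightarrow> lookup g m = 0"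
  by (auto simp: homogeneous_def in_keys_iff)

lemma form_point_in_proj_space:
  assumes "homogeneous 3 g" "g \<noteq> 0"
  shows "form_point g \<in> proj_space {m. exponent_degree m = 3}"
proof -
  have "lookup g \<noteq> (\<lambda>_. 0)"
    using assms(2) by (metis lookup_zero poly_mapping_eqI)
  then show ?thesis
    using lookup_outside_3[OF assms(1)] unfolding form_point_def proj_space_def by blast
qed

lemma topspace_smooth_cubics_top: "topspace smooth_cubics_top = smooth_cubics"
proof -
  have "smooth_cubics \<subseteq> proj_space {m. exponent_degree m = 3}"
    unfolding smooth_cubics_def using form_point_in_proj_space by auto
  then show ?thesis by (auto simp: smooth_cubics_top_def topspace_zariski)
qed

lemma quotient_map_moduli: "quotient_map smooth_cubics_top moduli_cubics (\<lambda>x. pgl_rel `` {x})"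
  unfolding moduli_cubics_def by (rule quotient_map_quotient_topology)

lemma topspace_moduli: "topspace moduli_cubics = moduli_class ` {g. smooth_cubic g}"
  using quotient_imp_surjective_map[OF quotient_map_moduli]
  by (auto simp: topspace_smooth_cubics_top smooth_cubics_alt moduli_class_def)

text \<open>The condition \<open>j = j(g)\<close> is a homogeneous equation of degree 12 in the coefficients.\<close>

lemma closedin_moduli_class:
  assumes "smooth_cubic g"
  shows "closedin moduli_cubics {moduli_class g}"
proof -
  \<comment> \<open>The coordinate functions on the space of cubics. \<open>F\<close> is the
    equation j = j(g) with denominators cleared.\<close>
  define X where "X m = (single (single (mon_exp m) 1) 1 :: (3 \<Rightarrow>\<^sub>0 nat) mpoly)" for m
  define K where "K c = (single 0 c :: (3 \<Rightarrow>\<^sub>0 nat) mpoly)" for c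
  define F where "F = K (disc (coef g)) * c4 X ^ 3 - K (c4 (coef g) ^ 3) * (c4 X ^ 3 - c6 X ^ 2)"
  have eval_F: "eval_poly a F = disc (coef g) * c4 (\<lambda>m. a (mon_exp m)) ^ 3
      - c4 (coef g) ^ 3 * disc (\<lambda>m. a (mon_exp m))" for a
  proof -
    have X: "eval_poly a (X m) = a (mon_exp m)" and K: "eval_poly a (K c) = c" for m c
      by (simp_all add: X_def K_def)
    show ?thesis
      by (simp add: F_def eval_poly_diff eval_poly_mult eval_poly_power K eval_c4 eval_c6 X disc_def)
  qed
  have hom_F: "homogeneous 12 F"
    by (rule homogeneousI_eval)
       (simp add: eval_F c4_scale disc_scale power_mult_distrib right_diff_distrib flip: power_mult)
  let ?V = "{p \<in> proj_space {m. exponent_degree m = 3}. \<forall>a\<in>p. eval_poly a F \<noteq> 0}"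
  have "openin (zariski {m. exponent_degree m = 3}) ?V"
    unfolding zariski_def by (rule topology_generated_by_Basis) (use hom_F in blast)
  then have "openin smooth_cubics_top (smooth_cubics \<inter> ?V)"
    unfolding smooth_cubics_top_def openin_subtopology by auto
  then have "closedin smooth_cubics_top (smooth_cubics - smooth_cubics \<inter> ?V)"
    using closedin_diff[OF closedin_topspace[of smooth_cubics_top]] unfolding topspace_smooth_cubics_top by blast
  moreover have "smooth_cubics - smooth_cubics \<inter> ?V =
      {x \<in> topspace smooth_cubics_top. pgl_rel `` {x} \<in> {moduli_class g}}"
  proof -
    have "form_point h \<in> ?V \<longleftrightarrow> moduli_class h \<noteq> moduli_class g" if h: "smooth_cubic h" for h
    proof -
      have "form_point h \<in> ?V \<longleftrightarrow> eval_poly (lookup h) F \<noteq> 0"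
        using form_point_in_proj_space[OF smooth_cubicD(1,5)[OF h]] ball_proj_point[OF hom_F]
        by (simp add: form_point_def)
      also have "\<dots> \<longleftrightarrow> disc (coef g) * c4 (coef h) ^ 3 \<noteq> c4 (coef g) ^ 3 * disc (coef h)"
        by (simp add: eval_F coef_def[abs_def])
      also have "\<dots> \<longleftrightarrow> j_inv (coef h) \<noteq> j_inv (coef g)"
        using smooth_cubicD(3)[OF h] smooth_cubicD(3)[OF assms]
        by (simp add: j_inv_def frac_eq_eq mult_ac)
      finally show ?thesis using moduli_class_eq_iff[OF h assms] by simp
    qed
    then show ?thesis
      unfolding topspace_smooth_cubics_top smooth_cubics_alt moduli_class_def by blast
  qed
  ultimately have "closedin smooth_cubics_top {x \<in> topspace smooth_cubics_top. pgl_rel `` {x} \<in> {moduli_class g}}"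
    by simp
  moreover have "{moduli_class g} \<subseteq> topspace moduli_cubics"
    using assms topspace_moduli by auto
  ultimately show ?thesis
    using quotient_map_moduli unfolding quotient_map_closedin by blast
qed

text \<open>Pulled back to the parameter, a basic open set is the nonvanishing set of a univariate
  polynomial, hence empty or cofinite in \<open>D\<close>. This alternative survives finite
  intersections and arbitrary unions.\<close>

lemma zariski_open_along_curve:
  fixes P :: "'v \<Rightarrow> complex poly"
  assumes "openin (zariski I) V"
    and "\<And>t. t \<in> D \<Longrightarrow> proj_point (\<lambda>i. poly (P i) t) \<in> proj_space I"
  defines "A \<equiv> \<lambda>V. {t \<in> D. proj_point (\<lambda>i. poly (P i) t) \<in> V}"
  shows "A V = {} \<or> finite (D - A V)"
proof -
  from assms(1) have "generate_topology_on {{p \<in> proj_space I. \<forall>a\<in>p. eval_poly a F \<noteq> 0} | F d. homogeneous d F} V"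
    unfolding zariski_def by (rule openin_topology_generated_by)
  then show ?thesis
  proof induction
    case (Int a b)
    have "D - A (a \<inter> b) = (D - A a) \<union> (D - A b)" by (auto simp: A_def)
    moreover have "A (a \<inter> b) \<subseteq> A a" "A (a \<inter> b) \<subseteq> A b" by (auto simp: A_def)
    ultimately show ?case using Int by (metis finite_UnI subset_empty)
  next
    case (UN K)
    show ?case
    proof (cases "\<exists>k\<in>K. A k \<noteq> {}")
      case True
      then obtain k where "k \<in> K" "finite (D - A k)" using UN by blast
      moreover have "D - A (\<Union>K) \<subseteq> D - A k" using \<open>k \<in> K\<close> by (auto simp: A_def)
      ultimately show ?thesis using finite_subset by blast
    qed (auto simp: A_def)
  next
    case (Basis s)
    then obtain F d where s: "s = {p \<in> proj_space I. \<forall>a\<in>p. eval_poly a F \<noteq> 0}" and F: "homogeneous d F"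
      by blast
    define G where "G = insertion (\<lambda>c. [:c:]) P F"
    have A: "A s = {t \<in> D. poly G t \<noteq> 0}"
      using assms(2) by (auto simp: A_def s ball_proj_point[OF F] G_def poly_insertion)
    show ?case
    proof (cases "G = 0")
      case False
      have "D - A s \<subseteq> {t. poly G t = 0}" using A by auto
      then show ?thesis using poly_roots_finite[OF False] finite_subset by blast
    qed (simp add: A)
  qed (simp add: A_def)
qed

text \<open>The complement of \<open>C\<close>, pulled back to the line a + b = 1 of Weierstrass
  cubics, is nonempty and therefore cofinite; the classes in \<open>C\<close> come from the finitely
  many remaining parameters.\<close>

lemma closedin_moduli_finite:
  assumes "closedin moduli_cubics C" "C \<noteq> topspace moduli_cubics"
  shows "finite C"
proof -
  define p where "p = weierstrass [:0, 1::complex:] [:1, -1:]"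
  define g where "g t = cubic_poly (\<lambda>m. poly (p m) t)" for t
  have coef_g: "coef (g t) = weierstrass t (1 - t)" for t
    by (rule ext, rename_tac m, case_tac m) (simp_all add: g_def p_def weierstrass_def)
  define D where "D = {t. smooth_cubic (g t)}"
  have surj: "\<exists>t\<in>D. moduli_class h = moduli_class (g t)" if h: "smooth_cubic h" for h
  proof -
    obtain t where t: "coef_equiv (coef h) (weierstrass t (1 - t))"
      using smooth_cubicD(4)[OF h] nonsingular_pencil_form by blast
    have "nonsingular (weierstrass t (1 - t))"
      using nonsingular_equiv[OF t] smooth_cubicD(4)[OF h] by blast
    then have "smooth_cubic (g t)"
      using smooth_cubic_iff[of "g t"] by (simp add: coef_g nonsingular_iff_disc g_def[THEN arg_cong, of "homogeneous 3"])
    moreover have "j_inv (coef (g t)) = j_inv (coef h)" using j_inv_equiv[OF t] by (simp add: coef_g)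
    ultimately show ?thesis using h moduli_class_eq_iff by (auto simp: D_def)
  qed
  \<comment> \<open>The same curve in the homogeneous coordinates indexed by exponents: the sum
    picks the monomial with exponent \<open>e\<close>, if there is one.\<close>
  define P where "P e = (\<Sum>m\<in>UNIV. if mon_exp m = e then p m else 0)" for e
  have lookup_g: "lookup (g t) e = poly (P e) t" for t e
    by (simp add: g_def cubic_poly_def P_def lookup_sum lookup_single when_def poly_sum if_distrib[of "\<lambda>q. poly q t"] cong: if_cong)
  let ?W = "topspace moduli_cubics - C"
  have "openin moduli_cubics ?W" using assms(1) by (simp add: openin_diff)
  then have "openin smooth_cubics_top {x \<in> topspace smooth_cubics_top. pgl_rel `` {x} \<in> ?W}"
    using openin_continuous_map_preimage quotient_imp_continuous_map[OF quotient_map_moduli] by blast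
  from this[unfolded topspace_smooth_cubics_top, unfolded smooth_cubics_top_def openin_subtopology]
  obtain V where "openin (zariski {m. exponent_degree m = 3}) V \<and>
    {x \<in> smooth_cubics. pgl_rel `` {x} \<in> ?W} = V \<inter> smooth_cubics" ..
  then have V: "openin (zariski {m. exponent_degree m = 3}) V"
    and VW: "{x \<in> smooth_cubics. pgl_rel `` {x} \<in> ?W} = V \<inter> smooth_cubics" by simp_all
  let ?A = "{t \<in> D. proj_point (\<lambda>i. poly (P i) t) \<in> V}"
  have pt: "proj_point (\<lambda>i. poly (P i) t) = form_point (g t)" for t
    by (simp add: form_point_def lookup_g[abs_def])
  have "?A = {} \<or> finite (D - ?A)"
  proof (rule zariski_open_along_curve[OF V])
    fix t assume "t \<in> D"
    then show "proj_point (\<lambda>i. poly (P i) t) \<in> proj_space {m. exponent_degree m = 3}"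
      unfolding pt using form_point_in_proj_space smooth_cubicD by (auto simp: D_def)
  qed
  moreover have A: "?A = {t \<in> D. moduli_class (g t) \<in> ?W}"
  proof -
    have "form_point (g t) \<in> V \<longleftrightarrow> moduli_class (g t) \<in> ?W" if "t \<in> D" for t
    proof -
      have "form_point (g t) \<in> smooth_cubics" using that by (auto simp: D_def smooth_cubics_alt)
      then show ?thesis using VW unfolding moduli_class_def by blast
    qed
    then show ?thesis unfolding pt by blast
  qed
  moreover have "?A \<noteq> {}"
  proof -
    obtain q where q: "q \<in> ?W" using assms closedin_subset by blast
    then obtain h where "smooth_cubic h" "q = moduli_class h" using topspace_moduli by auto
    then show ?thesis unfolding A using surj[of h] q by auto
  qed
  ultimately have "finite (D - ?A)" by blast
  moreover have "C \<subseteq> (\<lambda>t. moduli_class (g t)) ` (D - ?A)"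
  proof
    fix q assume q: "q \<in> C"
    then obtain h where "smooth_cubic h" "q = moduli_class h"
      using closedin_subset[OF assms(1)] topspace_moduli by auto
    then obtain t where "t \<in> D" "q = moduli_class (g t)" using surj by blast
    then show "q \<in> (\<lambda>t. moduli_class (g t)) ` (D - ?A)" unfolding A using q by auto
  qed
  ultimately show "finite C" using finite_surj by blast
qed

section \<open>Dimension of subspaces of the moduli space\<close>

lemma closedin_moduli_subspace_iff:
  assumes "Y \<subseteq> topspace moduli_cubics"
  shows "closedin (subtopology moduli_cubics Y) C \<longleftrightarrow> C \<subseteq> Y \<and> (finite C \<or> C = Y)"
proof
  assume "closedin (subtopology moduli_cubics Y) C"
  then obtain T where "closedin moduli_cubics T" "C = T \<inter> Y" by (auto simp: closedin_subtopology)
  then show "C \<subseteq> Y \<and> (finite C \<or> C = Y)"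
    using closedin_moduli_finite[of T] assms by auto
next
  assume *: "C \<subseteq> Y \<and> (finite C \<or> C = Y)"
  show "closedin (subtopology moduli_cubics Y) C"
  proof (cases "C = Y")
    case True
    then show ?thesis using closedin_topspace[of "subtopology moduli_cubics Y"] assms
      by (simp add: inf_absorb2)
  next
    case False
    then have "finite C" using * by blast
    then have "closedin moduli_cubics (\<Union>q\<in>C. {q})"
    proof (intro closedin_Union; clarsimp)
      fix q assume "q \<in> C"
      then obtain g where "smooth_cubic g" "q = moduli_class g"
        using * assms topspace_moduli by auto
      then show "closedin moduli_cubics {q}" using closedin_moduli_class by simp
    qed
    then show ?thesis using * by (auto simp: closedin_subtopology)
  qed
qed

text \<open>A chain of length two would contain a finite irreducible set with two points.\<close>

lemma krull_dim_cofinite: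
  assumes inf: "infinite (topspace X)"
    and closed: "\<And>C. closedin X C \<longleftrightarrow> C \<subseteq> topspace X \<and> (finite C \<or> C = topspace X)"
  shows "krull_dim X = 1"
proof -
  let ?chain = "\<lambda>n Z. (\<forall>i\<le>n. closedin X (Z i) \<and> irreducible_in X (Z i)) \<and> (\<forall>i<n. Z i \<subset> Z (Suc i))"
  have irr_fin: "\<exists>x. S = {x}" if S: "irreducible_in X S" "finite S" for S
  proof -
    obtain x where x: "x \<in> S" using S by (auto simp: irreducible_in_def)
    have "closedin X {x}" "closedin X (S - {x})" "S \<subseteq> {x} \<union> (S - {x})"
      using S x by (auto simp: closed irreducible_in_def)
    then have "S \<subseteq> {x} \<or> S \<subseteq> S - {x}" using S(1) unfolding irreducible_in_def by blast
    then show ?thesis using x by blast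
  qed
  have le: "n \<le> 1" if Z: "?chain n Z" for n Z
  proof (rule ccontr)
    assume "\<not> n \<le> 1"
    then have n: "0 < n" "1 < n" "1 \<le> n" by auto
    then have "Z 0 \<subset> Z 1" "Z 1 \<subset> Z 2" using Z by (auto simp: numeral_2_eq_2)
    moreover have "Z 2 \<subseteq> topspace X" "irreducible_in X (Z 1)" "irreducible_in X (Z 0)" "closedin X (Z 1)"
      using Z n by (auto simp: irreducible_in_def)
    ultimately have "finite (Z 1)" using closed by blast
    then obtain x where "Z 1 = {x}" using irr_fin \<open>irreducible_in X (Z 1)\<close> by blast
    with \<open>Z 0 \<subset> Z 1\<close> have "Z 0 = {}" by (metis subset_singletonD psubset_eq)
    with \<open>irreducible_in X (Z 0)\<close> show False by (simp add: irreducible_in_def)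
  qed
  obtain x where x: "x \<in> topspace X" using inf by (metis finite.emptyI all_not_in_conv)
  define Z where "Z i = (if i = 0 then {x} else topspace X)" for i :: nat
  have "irreducible_in X {x}" using x by (auto simp: irreducible_in_def)
  moreover have "irreducible_in X (topspace X)"
    unfolding irreducible_in_def using x inf closed by (metis empty_iff finite_UnI finite_subset order_refl)
  moreover have "topspace X \<noteq> {x}" using inf by (metis finite.emptyI finite.insertI)
  ultimately have "?chain 1 Z" using x inf by (auto simp: Z_def closed)
  then have "\<exists>Z. ?chain 1 Z" by blast
  have "krull_dim X = Sup {enat n | n. \<exists>Z. ?chain n Z}" by (simp add: krull_dim_def)
  also have "\<dots> = enat 1"
  proof (rule antisym)
    show "Sup {enat n | n. \<exists>Z. ?chain n Z} \<le> enat 1"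
      by (rule Sup_least) (use le in \<open>auto simp del: One_nat_def\<close>)
    show "enat 1 \<le> Sup {enat n | n. \<exists>Z. ?chain n Z}"
      using \<open>\<exists>Z. ?chain 1 Z\<close> by (intro Sup_upper) blast
  qed
  finally show ?thesis by (simp add: one_enat_def)
qed

lemma krull_dim_moduli_subspace:
  assumes "Y \<subseteq> topspace moduli_cubics" "infinite Y"
  shows "krull_dim (subtopology moduli_cubics Y) = 1"
proof (rule krull_dim_cofinite)
  have "topspace (subtopology moduli_cubics Y) = Y" using assms(1) by auto
  then show "infinite (topspace (subtopology moduli_cubics Y))"
    "closedin (subtopology moduli_cubics Y) C \<longleftrightarrow> C \<subseteq> topspace (subtopology moduli_cubics Y) \<and>
       (finite C \<or> C = topspace (subtopology moduli_cubics Y))" for C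
    using assms closedin_moduli_subspace_iff by simp_all
qed

lemma krull_dim_moduli: "infinite (topspace moduli_cubics) \<Longrightarrow> krull_dim moduli_cubics = 1"
  using krull_dim_moduli_subspace[of "topspace moduli_cubics"] by simp

section \<open>Plane sections in coordinates\<close>

lemma invertible_if_trivial_kernel:
  fixes B :: "complex^'n^'n"
  assumes "\<And>v. B *v v = 0 \<Longrightarrow> v = 0"
  shows "invertible B"
proof -
  have "inj ((*v) B)"
    by (rule injI) (metis assms eq_iff_diff_eq_0 matrix_vector_mult_diff_distrib)
  then show ?thesis
    using matrix_left_invertible_injective invertible_left_inverse by blast
qed

text \<open>This makes the choice in \<open>section_form\<close> harmless. The matrix
  \<open>B\<close> is a left inverse of \<open>P\<close> applied to \<open>A\<close>.\<close>

lemma parametrizes_compose: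
  assumes "parametrizes P H" "parametrizes A H"
  obtains B where "invertible B" "A = P ** B"
proof -
  have injP: "inj ((*v) P)" and injA: "inj ((*v) A)"
    and range: "range ((*v) P) = hyperplane H" "range ((*v) A) = hyperplane H"
    using assms by (auto simp: parametrizes_def bij_betw_def)
  obtain L where L: "L ** P = mat 1"
    using injP matrix_left_invertible_injective by blast
  define B where "B = L ** A"
  have PB: "P *v (B *v z) = A *v z" for z
  proof -
    have "A *v z \<in> range ((*v) P)" using range by blast
    then obtain w where w: "A *v z = P *v w" by blast
    have "B *v z = L *v (P *v w)" by (simp add: B_def w flip: matrix_vector_mul_assoc)
    also have "\<dots> = w" by (simp add: matrix_vector_mul_assoc L)
    finally show ?thesis by (simp add: w)
  qed
  have "invertible B"
    by (rule invertible_if_trivial_kernel) (metis PB injA injD matrix_vector_mult_0_right)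
  moreover have "A = P ** B"
    by (simp add: matrix_eq PB flip: matrix_vector_mul_assoc)
  ultimately show ?thesis using that by blast
qed

lemma hyperplane_proj_point: "hyperplane (proj_point a) = {x. (\<Sum>i\<in>UNIV. a i * x $ i) = 0}"
proof -
  have "(\<Sum>i\<in>UNIV. c * a i * x $ i) = c * (\<Sum>i\<in>UNIV. a i * x $ i)" for c and x :: "complex^4"
    by (simp add: sum_distrib_left mult_ac)
  then show ?thesis unfolding hyperplane_def proj_point_def by (auto intro: exI[of _ 1])
qed

text \<open>The linear equation is solved for a coordinate \<open>k\<close> with \<open>a k\<close>
  nonzero; the other three, enumerated by \<open>e\<close>, are the parameters.\<close>

lemma exists_parametrization:
  assumes "a \<noteq> (\<lambda>_. 0)"
  obtains P where "parametrizes P (proj_point a)"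
proof -
  obtain k where k: "a k \<noteq> 0" using assms by auto
  have "card (UNIV - {k}) = card (UNIV :: 3 set)" by simp
  then obtain e :: "3 \<Rightarrow> 4" where e: "bij_betw e UNIV (UNIV - {k})"
    using finite_same_card_bij[of "UNIV :: 3 set" "UNIV - {k}"] by auto
  define P :: "complex^3^4" where
    "P = (\<chi> i l. if i = k then - a (e l) / a k else if e l = i then 1 else 0)"
  have inj_e: "e l = e l' \<longleftrightarrow> l = l'" and ek: "e l \<noteq> k" for l l'
    using e by (auto simp: bij_betw_def inj_def)
  have Pe: "(P *v z) $ e l = z $ l" for z l
    by (simp add: P_def matrix_vector_mult_def ek inj_e if_distrib[of "\<lambda>x. x * _"] cong: if_cong)
  have Pk: "(P *v z) $ k = - (\<Sum>l\<in>UNIV. a (e l) * z $ l) / a k" for z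
    by (simp add: P_def matrix_vector_mult_def sum_divide_distrib sum_negf)
  have split: "(\<Sum>i\<in>UNIV. a i * x $ i) = a k * x $ k + (\<Sum>l\<in>UNIV. a (e l) * x $ e l)" for x :: "complex^4"
  proof -
    have "(\<Sum>l\<in>UNIV. a (e l) * x $ e l) = (\<Sum>i\<in>UNIV - {k}. a i * x $ i)"
      by (rule sum.reindex_bij_betw[OF e])
    then show ?thesis by (simp add: sum.remove[of UNIV k])
  qed
  have "inj ((*v) P)"
    by (rule injI) (metis Pe vec_eq_iff)
  moreover have "range ((*v) P) = hyperplane (proj_point a)"
  proof (intro subset_antisym subsetI)
    fix x assume "x \<in> range ((*v) P)"
    then show "x \<in> hyperplane (proj_point a)"
      using k by (auto simp: hyperplane_proj_point split Pe Pk)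
  next
    fix x :: "complex^4" assume x: "x \<in> hyperplane (proj_point a)"
    define z :: "complex^3" where "z = (\<chi> l. x $ e l)"
    have "P *v z = x"
    proof (unfold vec_eq_iff, rule allI)
      fix i
      show "(P *v z) $ i = x $ i"
      proof (cases "i = k")
        case True
        have "a k * x $ k = - (\<Sum>l\<in>UNIV. a (e l) * x $ e l)"
          using x by (simp add: hyperplane_proj_point split eq_neg_iff_add_eq_0)
        then show ?thesis using k by (simp add: True Pk z_def field_simps)
      next
        case False
        then obtain l where "i = e l" using e by (auto simp: bij_betw_def)
        then show ?thesis by (simp add: Pe z_def)
      qed
    qed
    then show "x \<in> range ((*v) P)" by blast
  qed
  ultimately show ?thesis using that by (auto simp: parametrizes_def bij_betw_def)
qed

lemma proj_spaceE:
  assumes "H \<in> proj_space UNIV"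
  obtains a where "H = proj_point a" "a \<noteq> (\<lambda>_. 0)"
  using assms by (auto simp: proj_space_def)

lemma section_form_parametrization:
  assumes "parametrizes P H"
  obtains B where "invertible B" "section_form f H = linear_subst B (linear_subst P f)"
proof -
  have "parametrizes (SOME A. parametrizes A H) H" using assms by (rule someI)
  then obtain B where "invertible B" "(SOME A. parametrizes A H) = P ** B"
    using parametrizes_compose assms by blast
  then show ?thesis using that by (simp add: section_form_def linear_subst_compose)
qed

lemma smooth_cubic_linear_subst_iff:
  assumes "invertible B" "homogeneous 3 g"
  shows "smooth_cubic (linear_subst B g) \<longleftrightarrow> smooth_cubic g"
  using assms by (simp add: smooth_cubic_iff homogeneous_linear_subst disc_linear_subst invertible_det_nz)

text \<open>From here on a section may be computed in any convenient parametrization of its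
  plane.\<close>

lemma section_parametrization:
  assumes f: "homogeneous 3 f" and P: "parametrizes P H" and H: "H \<in> proj_space UNIV"
  shows "H \<in> smooth_sections f \<longleftrightarrow> smooth_cubic (linear_subst P f)"
    and "smooth_cubic (linear_subst P f) \<Longrightarrow> section_map f H = moduli_class (linear_subst P f)"
proof -
  let ?g = "linear_subst P f"
  have g: "homogeneous 3 ?g" using f by (rule homogeneous_linear_subst)
  obtain B where B: "invertible B" "section_form f H = linear_subst B ?g"
    using section_form_parametrization[OF P] by blast
  have "H \<in> smooth_sections f \<longleftrightarrow> smooth_cubic (section_form f H)"
    using H by (simp add: smooth_sections_def smooth_cubic_def B homogeneous_linear_subst g)
  then show "H \<in> smooth_sections f \<longleftrightarrow> smooth_cubic ?g"
    by (simp add: B smooth_cubic_linear_subst_iff g)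
  assume s: "smooth_cubic ?g"
  have "moduli_class (linear_subst B ?g) = moduli_class ?g"
    using s B g by (subst moduli_class_eq_iff)
      (auto simp: smooth_cubic_linear_subst_iff intro!: j_inv_equiv coef_equiv_linear_subst)
  then show "section_map f H = moduli_class ?g"
    by (simp add: section_map_def moduli_class_def B)
qed

lemma smooth_sections_image:
  assumes f: "homogeneous 3 f" and H: "H \<in> smooth_sections f"
  obtains P where "parametrizes P H" "smooth_cubic (linear_subst P f)"
    "section_map f H = moduli_class (linear_subst P f)"
proof -
  have H': "H \<in> proj_space UNIV" using H by (simp add: smooth_sections_def)
  then obtain a where a: "H = proj_point a" "a \<noteq> (\<lambda>_. 0)" by (rule proj_spaceE)
  then obtain P where P: "parametrizes P H" using exists_parametrization by metis
  then show ?thesis using that section_parametrization[OF f P H'] H by blast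
qed

lemma section_map_in_moduli:
  "homogeneous 3 f \<Longrightarrow> section_map f ` smooth_sections f \<subseteq> topspace moduli_cubics"
  by (auto simp: topspace_moduli elim!: smooth_sections_image)

text \<open>The plane \<open>w = h\<^sub>1x + h\<^sub>2y + h\<^sub>3z\<close> in the coordinates \<open>(x, y, z, w)\<close> given by \<open>C\<close>.\<close>

definition graph_matrix :: "complex^3 \<Rightarrow> complex^3^4" where
  "graph_matrix h = (\<chi> i j. if i = 4 then h $ j else if i = 1 \<and> j = 1 \<or> i = 2 \<and> j = 2 \<or> i = 3 \<and> j = 3 then 1 else 0)"

lemma four_neq [simp]:
  "(1::4) \<noteq> 2" "(1::4) \<noteq> 3" "(1::4) \<noteq> 4" "(2::4) \<noteq> 3" "(2::4) \<noteq> 4" "(3::4) \<noteq> 4"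
  "(2::4) \<noteq> 1" "(3::4) \<noteq> 1" "(4::4) \<noteq> 1" "(3::4) \<noteq> 2" "(4::4) \<noteq> 2" "(4::4) \<noteq> 3"
  "(1::3) \<noteq> 2" "(1::3) \<noteq> 3" "(2::3) \<noteq> 3" "(2::3) \<noteq> 1" "(3::3) \<noteq> 1" "(3::3) \<noteq> 2"
  by simp_all

lemma graph_matrix_mult [simp]:
  "(graph_matrix h *v z) $ 1 = z $ 1" "(graph_matrix h *v z) $ 2 = z $ 2" "(graph_matrix h *v z) $ 3 = z $ 3"
  "(graph_matrix h *v z) $ 4 = h $ 1 * z $ 1 + h $ 2 * z $ 2 + h $ 3 * z $ 3"
  by (simp_all add: graph_matrix_def matrix_vector_mult_def sum_3)

text \<open>The rows of \<open>matrix_inv C\<close> are the coordinate functions x, y, z, w of the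
  frame \<open>C\<close>, so this is the linear form h1 x + h2 y + h3 z - w in the original
  coordinates.\<close>

definition plane :: "complex^4^4 \<Rightarrow> complex^3 \<Rightarrow> (4 \<Rightarrow> complex) set" where
  "plane C h = proj_point (\<lambda>j. h $ 1 * matrix_inv C $ 1 $ j + h $ 2 * matrix_inv C $ 2 $ j
     + h $ 3 * matrix_inv C $ 3 $ j - matrix_inv C $ 4 $ j)"

lemma matrix_inv_mult_vec:
  assumes "invertible C"
  shows "C *v (matrix_inv C *v x) = x" "matrix_inv C *v (C *v x) = x"
proof -
  have "C ** matrix_inv C = mat 1 \<and> matrix_inv C ** C = mat 1"
    using assms unfolding invertible_def matrix_inv_def by (rule someI_ex)
  then show "C *v (matrix_inv C *v x) = x" "matrix_inv C *v (C *v x) = x"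
    by (simp_all add: matrix_vector_mul_assoc)
qed

lemma mem_hyperplane_plane:
  assumes "invertible C"
  shows "x \<in> hyperplane (plane C h) \<longleftrightarrow> (matrix_inv C *v x) $ 4 =
    h $ 1 * (matrix_inv C *v x) $ 1 + h $ 2 * (matrix_inv C *v x) $ 2 + h $ 3 * (matrix_inv C *v x) $ 3"
proof -
  have "(\<Sum>j\<in>UNIV. (h $ 1 * matrix_inv C $ 1 $ j + h $ 2 * matrix_inv C $ 2 $ j
     + h $ 3 * matrix_inv C $ 3 $ j - matrix_inv C $ 4 $ j) * x $ j) =
     h $ 1 * (matrix_inv C *v x) $ 1 + h $ 2 * (matrix_inv C *v x) $ 2 + h $ 3 * (matrix_inv C *v x) $ 3
       - (matrix_inv C *v x) $ 4"
    by (simp add: matrix_vector_mult_def sum_4 algebra_simps)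
  then show ?thesis by (auto simp: plane_def hyperplane_proj_point)
qed

lemma parametrizes_plane:
  assumes "invertible C"
  shows "parametrizes (C ** graph_matrix h) (plane C h)"
proof -
  have inv: "matrix_inv C *v ((C ** graph_matrix h) *v z) = graph_matrix h *v z" for z
    by (simp add: matrix_inv_mult_vec assms flip: matrix_vector_mul_assoc)
  have "inj ((*v) (C ** graph_matrix h))"
  proof (rule injI)
    fix z z' assume "(C ** graph_matrix h) *v z = (C ** graph_matrix h) *v z'"
    then have "graph_matrix h *v z = graph_matrix h *v z'" using inv by metis
    then show "z = z'" unfolding vec_eq_iff forall_3 by (metis graph_matrix_mult(1-3))
  qed
  moreover have "range ((*v) (C ** graph_matrix h)) = hyperplane (plane C h)"
  proof (intro subset_antisym subsetI)
    fix x assume "x \<in> range ((*v) (C ** graph_matrix h))"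
    then show "x \<in> hyperplane (plane C h)" by (auto simp: mem_hyperplane_plane[OF assms] inv)
  next
    fix x assume x: "x \<in> hyperplane (plane C h)"
    let ?y = "matrix_inv C *v x"
    have "graph_matrix h *v vector [?y $ 1, ?y $ 2, ?y $ 3] = ?y"
      using x by (simp add: mem_hyperplane_plane[OF assms] vec_eq_iff forall_4)
    then have "(C ** graph_matrix h) *v vector [?y $ 1, ?y $ 2, ?y $ 3] = x"
      by (simp add: matrix_inv_mult_vec assms flip: matrix_vector_mul_assoc)
    then show "x \<in> range ((*v) (C ** graph_matrix h))" by (metis rangeI)
  qed
  ultimately show ?thesis by (simp add: parametrizes_def bij_betw_def)
qed

lemma plane_in_proj_space:
  assumes "invertible C"
  shows "plane C h \<in> proj_space UNIV"
proof -
  let ?a = "\<lambda>j. h $ 1 * matrix_inv C $ 1 $ j + h $ 2 * matrix_inv C $ 2 $ j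
     + h $ 3 * matrix_inv C $ 3 $ j - matrix_inv C $ 4 $ j"
  have "?a \<noteq> (\<lambda>_. 0)"
  proof
    assume "?a = (\<lambda>_. 0)"
    then have "hyperplane (plane C h) = UNIV"
      unfolding plane_def hyperplane_proj_point by (simp add: fun_eq_iff)
    then have "C *v axis 4 1 \<in> hyperplane (plane C h)" by simp
    then show False by (simp add: mem_hyperplane_plane[OF assms] matrix_inv_mult_vec[OF assms] axis_def)
  qed
  then show ?thesis unfolding plane_def proj_space_def by blast
qed

lemma inj_plane:
  assumes "invertible C"
  shows "inj (plane C)"
proof (rule injI)
  fix h k assume eq: "plane C h = plane C k"
  have mem: "C *v (graph_matrix h *v z) \<in> hyperplane (plane C k)" for z
    unfolding eq[symmetric] by (simp add: mem_hyperplane_plane assms matrix_inv_mult_vec)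
  show "h = k"
    using mem[of "axis 1 1"] mem[of "axis 2 1"] mem[of "axis 3 1"]
    by (simp add: mem_hyperplane_plane assms matrix_inv_mult_vec axis_def vec_eq_iff forall_3)
qed

section \<open>Quaternary cubic forms\<close>

datatype mon2 = XX | XY | XZ | YY | YZ | ZZ

definition quad_val :: "(mon2 \<Rightarrow> 'a::comm_ring_1) \<Rightarrow> 'a \<Rightarrow> 'a \<Rightarrow> 'a \<Rightarrow> 'a" where
  "quad_val q x y z = q XX * x^2 + q XY * x * y + q XZ * x * z + q YY * y^2 + q YZ * y * z + q ZZ * z^2"

definition lin_lin :: "(3 \<Rightarrow> 'a::comm_ring_1) \<Rightarrow> (3 \<Rightarrow> 'a) \<Rightarrow> mon2 \<Rightarrow> 'a" where
  "lin_lin h k = (\<lambda>m. case m of XX \<Rightarrow> h 1 * k 1 | XY \<Rightarrow> h 1 * k 2 + h 2 * k 1 | XZ \<Rightarrow> h 1 * k 3 + h 3 * k 1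
     | YY \<Rightarrow> h 2 * k 2 | YZ \<Rightarrow> h 2 * k 3 + h 3 * k 2 | ZZ \<Rightarrow> h 3 * k 3)"

definition lin_quad :: "(3 \<Rightarrow> 'a::comm_ring_1) \<Rightarrow> (mon2 \<Rightarrow> 'a) \<Rightarrow> mon3 \<Rightarrow> 'a" where
  "lin_quad h q = cubic_coefs (h 1 * q XX) (h 1 * q XY + h 2 * q XX) (h 1 * q XZ + h 3 * q XX)
     (h 1 * q YY + h 2 * q XY) (h 1 * q YZ + h 2 * q XZ + h 3 * q XY) (h 1 * q ZZ + h 3 * q XZ)
     (h 2 * q YY) (h 2 * q YZ + h 3 * q YY) (h 2 * q ZZ + h 3 * q YZ) (h 3 * q ZZ)"

lemma lin_lin_simps [simp]:
  "lin_lin h k XX = h 1 * k 1" "lin_lin h k XY = h 1 * k 2 + h 2 * k 1" "lin_lin h k XZ = h 1 * k 3 + h 3 * k 1"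
  "lin_lin h k YY = h 2 * k 2" "lin_lin h k YZ = h 2 * k 3 + h 3 * k 2" "lin_lin h k ZZ = h 3 * k 3"
  by (simp_all add: lin_lin_def)

lemma quad_val_lin_lin:
  "quad_val (lin_lin h k) x y z = (h 1 * x + h 2 * y + h 3 * z) * (k 1 * x + k 2 * y + k 3 * z)" for x :: complex
  by (simp add: quad_val_def algebra_simps power2_eq_square)

lemma cubic_val_lin_quad:
  "cubic_val (lin_quad h q) x y z = (h 1 * x + h 2 * y + h 3 * z) * quad_val q x y z" for x :: complex
  by (simp add: cubic_val_def quad_val_def lin_quad_def algebra_simps powers)

lemma cubic_val_add: "cubic_val (\<lambda>m. c m + d m) x y z = cubic_val c x y z + cubic_val d x y z"
  by (simp add: cubic_val_def algebra_simps)

lemma cubic_val_scale: "cubic_val (\<lambda>m. t * c m) x y z = t * cubic_val c x y z"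
  by (simp add: cubic_val_def algebra_simps)

text \<open>Expansion in powers of w = \<open>v$4\<close>: the parts \<open>c\<close>,
  \<open>q\<close>, \<open>m\<close>, \<open>\<kappa>\<close> are the g, Q, m and k of the
  overview.\<close>

definition quaternary_val ::
    "(mon3 \<Rightarrow> complex) \<Rightarrow> (mon2 \<Rightarrow> complex) \<Rightarrow> (3 \<Rightarrow> complex) \<Rightarrow> complex \<Rightarrow> complex^4 \<Rightarrow> complex" where
  "quaternary_val c q m \<kappa> v = cubic_val c (v$1) (v$2) (v$3) + v$4 * quad_val q (v$1) (v$2) (v$3)
     + (v$4)^2 * (m 1 * v$1 + m 2 * v$2 + m 3 * v$3) + \<kappa> * (v$4)^3"

lemma monom_val_Suc:
  assumes "exponent_degree m = Suc d"
  shows "\<exists>i m'. exponent_degree m' = d \<and> (\<forall>\<phi> :: _ \<Rightarrow> complex. monom_val \<phi> m = \<phi> i * monom_val \<phi> m')"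
proof -
  have "keys m \<noteq> {}" using assms unfolding exponent_degree_def by (metis Zero_neq_Suc sum.empty)
  then obtain i where "i \<in> keys m" by blast
  then have i: "lookup m i > 0" by (simp add: in_keys_iff)
  define m' where "m' = m - single i 1"
  have m: "m = single i 1 + m'"
    by (rule poly_mapping_eqI) (use i in \<open>auto simp: m'_def lookup_add lookup_minus lookup_single when_def\<close>)
  have "exponent_degree m' = d"
    using assms exponent_degree_add[of "single i 1" m', folded m] by simp
  moreover have "monom_val \<phi> m = \<phi> i * monom_val \<phi> m'" for \<phi> :: "_ \<Rightarrow> complex"
    using monom_val_add[of \<phi> "single i 1" m', folded m] by simp
  ultimately show ?thesis by blast
qed

lemma coordinate_linear:
  "\<exists>a \<alpha>. \<forall>v :: complex^4. v $ i = a 1 * v$1 + a 2 * v$2 + a (3::3) * v$3 + \<alpha> * v$4"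
proof -
  consider "i = 1" | "i = 2" | "i = 3" | "i = 4" using exhaust_4 by blast
  then show ?thesis
  proof cases
    case 1 then show ?thesis by (intro exI[of _ "\<lambda>j. if j = 1 then 1 else 0"] exI[of _ 0]) simp
  next
    case 2 then show ?thesis by (intro exI[of _ "\<lambda>j. if j = 2 then 1 else 0"] exI[of _ 0]) simp
  next
    case 3 then show ?thesis by (intro exI[of _ "\<lambda>j. if j = 3 then 1 else 0"] exI[of _ 0]) simp
  next
    case 4 then show ?thesis by (intro exI[of _ "\<lambda>j. 0"] exI[of _ 1]) simp
  qed
qed

text \<open>Functions with such an expansion are closed under sums, and a cubic monomial is a
  product of three coordinates, each a linear form in x, y, z plus a multiple of w. This avoids a
  list of twenty monomials.\<close>

lemma quaternary_expansion:
  fixes F :: "4 mpoly"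
  assumes "homogeneous 3 F"
  obtains c q m \<kappa> where "\<And>v. pval F v = quaternary_val c q m \<kappa> v"
proof -
  define R where "R \<phi> \<longleftrightarrow> (\<exists>c q m \<kappa>. \<forall>v. \<phi> v = quaternary_val c q m \<kappa> v)" for \<phi>
  have add: "R (\<lambda>v. \<phi> v + \<psi> v)" if "R \<phi>" "R \<psi>" for \<phi> \<psi>
  proof -
    obtain c q m \<kappa> c' q' m' \<kappa>' where "\<And>v. \<phi> v = quaternary_val c q m \<kappa> v" "\<And>v. \<psi> v = quaternary_val c' q' m' \<kappa>' v"
      using \<open>R \<phi>\<close> \<open>R \<psi>\<close> unfolding R_def by metis
    then have "\<phi> v + \<psi> v = quaternary_val (\<lambda>n. c n + c' n) (\<lambda>n. q n + q' n) (\<lambda>j. m j + m' j) (\<kappa> + \<kappa>') v" for v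
      by (simp add: quaternary_val_def quad_val_def cubic_val_add algebra_simps)
    then show ?thesis unfolding R_def by blast
  qed
  have zero: "R (\<lambda>v. 0)" unfolding R_def
    by (intro exI[of _ "\<lambda>_. 0"] exI[of _ 0]) (simp add: quaternary_val_def quad_val_def cubic_val_def)
  have sum: "R (\<lambda>v. \<Sum>n\<in>K. \<phi> n v)" if "\<And>n. n \<in> K \<Longrightarrow> R (\<phi> n)" for K and \<phi> :: "(4 \<Rightarrow>\<^sub>0 nat) \<Rightarrow> _"
    using that by (induction K rule: infinite_finite_induct) (auto intro: add zero)
  have mono: "R (\<lambda>v. t * monom_val (($) v) n)" if "exponent_degree n = 3" for t n
  proof -
    obtain i1 n1 where 1: "exponent_degree n1 = 2" "\<And>\<phi> :: 4 \<Rightarrow> complex. monom_val \<phi> n = \<phi> i1 * monom_val \<phi> n1"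
      using monom_val_Suc[of n 2] \<open>exponent_degree n = 3\<close> by auto
    obtain i2 n2 where 2: "exponent_degree n2 = 1" "\<And>\<phi> :: 4 \<Rightarrow> complex. monom_val \<phi> n1 = \<phi> i2 * monom_val \<phi> n2"
      using monom_val_Suc[of n1 1] 1(1) by auto
    obtain i3 n3 where 3: "exponent_degree n3 = 0" "\<And>\<phi> :: 4 \<Rightarrow> complex. monom_val \<phi> n2 = \<phi> i3 * monom_val \<phi> n3"
      using monom_val_Suc[of n2 0] 2(1) by auto
    have "n3 = 0" using 3(1) by (auto simp: exponent_degree_def in_keys_iff intro!: poly_mapping_eqI)
    obtain a \<alpha> b \<beta> d \<delta> where
      lin: "\<And>v :: complex^4. v $ i1 = a 1 * v$1 + a 2 * v$2 + a (3::3) * v$3 + \<alpha> * v$4"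
        "\<And>v :: complex^4. v $ i2 = b 1 * v$1 + b 2 * v$2 + b (3::3) * v$3 + \<beta> * v$4"
        "\<And>v :: complex^4. v $ i3 = d 1 * v$1 + d 2 * v$2 + d (3::3) * v$3 + \<delta> * v$4"
      using coordinate_linear by metis
    have "t * monom_val (($) v) n = quaternary_val (\<lambda>n. t * lin_quad a (lin_lin b d) n)
        (\<lambda>n. t * (\<alpha> * lin_lin b d n + \<beta> * lin_lin a d n + \<delta> * lin_lin a b n))
        (\<lambda>j. t * (\<alpha> * \<beta> * d j + \<alpha> * \<delta> * b j + \<beta> * \<delta> * a j)) (t * \<alpha> * \<beta> * \<delta>) v" for v
    proof -
      have quad: "quad_val (\<lambda>n. t * (\<alpha> * lin_lin b d n + \<beta> * lin_lin a d n + \<delta> * lin_lin a b n)) x y z =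
          t * (\<alpha> * quad_val (lin_lin b d) x y z + \<beta> * quad_val (lin_lin a d) x y z + \<delta> * quad_val (lin_lin a b) x y z)"
        for x y z by (simp add: quad_val_def algebra_simps)
      have "t * monom_val (($) v) n = t * (v $ i1 * v $ i2 * v $ i3)"
        by (simp add: 1 2 3 \<open>n3 = 0\<close>)
      also have "\<dots> = quaternary_val (\<lambda>n. t * lin_quad a (lin_lin b d) n)
        (\<lambda>n. t * (\<alpha> * lin_lin b d n + \<beta> * lin_lin a d n + \<delta> * lin_lin a b n))
        (\<lambda>j. t * (\<alpha> * \<beta> * d j + \<alpha> * \<delta> * b j + \<beta> * \<delta> * a j)) (t * \<alpha> * \<beta> * \<delta>) v"
        unfolding quaternary_val_def quad cubic_val_scale cubic_val_lin_quad quad_val_lin_lin lin by algebra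
      finally show ?thesis .
    qed
    then show ?thesis unfolding R_def by blast
  qed
  have "R (\<lambda>v. \<Sum>n\<in>keys F. lookup F n * monom_val (($) v) n)"
    using assms by (intro sum mono) (auto simp: homogeneous_def)
  then have "R (\<lambda>v. pval F v)" by (simp add: eval_poly_monom_val)
  then show ?thesis using that unfolding R_def by blast
qed

text \<open>The result of putting w = h(x, y, z) into \<open>quaternary_val\<close>, over a general
  ring so that \<open>h\<close> may depend polynomially on a parameter.\<close>

definition section_coefs :: "(mon3 \<Rightarrow> 'a) \<Rightarrow> (mon2 \<Rightarrow> 'a) \<Rightarrow> (3 \<Rightarrow> 'a) \<Rightarrow> 'a \<Rightarrow> (3 \<Rightarrow> 'a) \<Rightarrow> mon3 \<Rightarrow> 'a::comm_ring_1" where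
  "section_coefs c q m \<kappa> h = (\<lambda>n. c n + lin_quad h q n + lin_quad m (lin_lin h h) n + \<kappa> * lin_quad h (lin_lin h h) n)"

definition expansion :: "4 mpoly \<Rightarrow> complex^4^4 \<Rightarrow> (mon3 \<Rightarrow> complex) \<Rightarrow> (mon2 \<Rightarrow> complex) \<Rightarrow> (3 \<Rightarrow> complex)
    \<Rightarrow> complex \<Rightarrow> bool" where
  "expansion f C c q m \<kappa> \<longleftrightarrow> (\<forall>v. pval f (C *v v) = quaternary_val c q m \<kappa> v)"

lemma expansion_exists:
  assumes "homogeneous 3 f"
  obtains c q m \<kappa> where "expansion f C c q m \<kappa>"
proof -
  obtain c q m \<kappa> where "\<And>v. pval (linear_subst C f) v = quaternary_val c q m \<kappa> v"
    using quaternary_expansion[OF homogeneous_linear_subst[OF assms]] by blast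
  then have "expansion f C c q m \<kappa>" by (simp add: expansion_def eval_linear_subst)
  then show ?thesis by (rule that)
qed

lemma coef_section:
  assumes "homogeneous 3 f" "expansion f C c q m \<kappa>"
  shows "coef (linear_subst (C ** graph_matrix h) f) = section_coefs c q m \<kappa> (($) h)"
proof (rule coef_linear_subst_eqI[OF assms(1)])
  fix z
  have "pval f ((C ** graph_matrix h) *v z) = quaternary_val c q m \<kappa> (graph_matrix h *v z)"
    using assms(2) by (simp add: expansion_def flip: matrix_vector_mul_assoc)
  also have "\<dots> = cubic_val (section_coefs c q m \<kappa> (($) h)) (z $ 1) (z $ 2) (z $ 3)"
    unfolding section_coefs_def cubic_val_add cubic_val_scale cubic_val_lin_quad quad_val_lin_lin
      quaternary_val_def graph_matrix_mult by algebra
  finally show "pval f ((C ** graph_matrix h) *v z) =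
      cubic_val (section_coefs c q m \<kappa> (($) h)) (z $ 1) (z $ 2) (z $ 3)" .
qed

lemma section_coefs_0 [simp]: "section_coefs c q m \<kappa> (\<lambda>_. 0) = c"
  by (rule ext, rename_tac n, case_tac n) (simp_all add: section_coefs_def lin_quad_def)

lemma section_coefs_zero_vec [simp]: "section_coefs c q m \<kappa> (($) 0) = c"
  using section_coefs_0[of c q m \<kappa>] by (simp add: zero_vec_def vec_lambda_inverse)

section \<open>Surfaces whose plane sections have constant modulus\<close>

text \<open>The coefficient of \<open>s\<close> is the differential of c4 at the Weierstrass cubic.
  Working over polynomials allows \<open>s\<close> to become t^k later.\<close>

lemma c4_weierstrass_taylor:
  fixes s :: "complex poly"
  shows "\<exists>R. c4 (\<lambda>n. weierstrass a b n + s * r n) =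
    -48 * a + s * (48 * a * r X3 + 144 * b * r XY2 + 48 * r XZ2 - 96 * a * r Y2Z) + s^2 * R"
proof -
  have "\<exists>R. c4_form (-1 + s * x1) (s * x2) (s * x3) (s * x4) (s * x5) (- a + s * x6) (s * x7) (1 + s * x8)
      (s * x9) (- b + s * x10) = -48 * a + s * (48 * a * x1 + 144 * b * x4 + 48 * x6 - 96 * a * x8) + s^2 * R"
    for x1 x2 x3 x4 x5 x6 x7 x8 x9 x10
    unfolding c4_form_def by algebra
  then show ?thesis by (simp add: c4_def weierstrass_def)
qed

lemma c6_weierstrass_taylor:
  fixes s :: "complex poly"
  shows "\<exists>R. c6 (\<lambda>n. weierstrass a b n + s * r n) =
    -864 * b + s * (1728 * b * r X3 - 288 * a * r X2Z - 576 * a^2 * r XY2 + 864 * r Z3 - 2592 * b * r Y2Z) + s^2 * R"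
proof -
  have "\<exists>R. c6_form (-1 + s * x1) (s * x2) (s * x3) (s * x4) (s * x5) (- a + s * x6) (s * x7) (1 + s * x8)
      (s * x9) (- b + s * x10) =
      -864 * b + s * (1728 * b * x1 - 288 * a * x3 - 576 * a^2 * x4 + 864 * x10 - 2592 * b * x8) + s^2 * R"
    for x1 x2 x3 x4 x5 x6 x7 x8 x9 x10
    unfolding c6_form_def by algebra
  then show ?thesis by (simp add: c6_def weierstrass_def)
qed

text \<open>Up to a constant this is \<open>3c\<^sub>6 dc\<^sub>4 - 2c\<^sub>4 dc\<^sub>6\<close> at a Weierstrass cubic, that is, the differential
  of the modulus with its zeros at \<open>c\<^sub>4 = 0\<close> and \<open>c\<^sub>6 = 0\<close> removed.\<close>

definition modulus_form :: "complex \<Rightarrow> complex \<Rightarrow> (mon3 \<Rightarrow> complex) \<Rightarrow> complex" where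
  "modulus_form a b u = 3 * a * b * u X3 - 2 * a^2 * u X2Z - (4 * a^3 + 27 * b^2) * u XY2 - 9 * b * u XZ2 + 6 * a * u Z3"

text \<open>Here \<open>x\<close> and \<open>y\<close> are c4 and c6 of the undeformed cubic. If one
  of them is 0, the identity forces \<open>U\<close> or \<open>V\<close> to vanish as a polynomial;
  otherwise divide by \<open>s\<close>, put t = 0 and cancel x^2 y.\<close>

lemma weighted_first_order:
  fixes U V s :: "complex poly"
  assumes "(([:x:] + s * U) ^ 3) * [:y:] ^ 2 = [:x:] ^ 3 * ([:y:] + s * V) ^ 2"
    and "s \<noteq> 0" "poly s 0 = 0" "x^3 \<noteq> y^2"
  shows "3 * y * poly U 0 = 2 * x * poly V 0"
proof -
  consider "x = 0" "y \<noteq> 0" | "y = 0" "x \<noteq> 0" | "x \<noteq> 0" "y \<noteq> 0"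
    using assms(4) by (cases "x = 0"; cases "y = 0") auto
  then show ?thesis
  proof cases
    case 1
    then show ?thesis using assms(1,2) by simp
  next
    case 2
    then show ?thesis using assms(1,2) by simp
  next
    case 3
    have "s * (3 * [:x:]^2 * [:y:]^2 * U - 2 * [:x:]^3 * [:y:] * V
        + s * (3 * [:x:] * [:y:]^2 * U^2 + s * U^3 * [:y:]^2 - [:x:]^3 * V^2)) = 0"
      using assms(1) by algebra
    then have "3 * [:x:]^2 * [:y:]^2 * U - 2 * [:x:]^3 * [:y:] * V
        + s * (3 * [:x:] * [:y:]^2 * U^2 + s * U^3 * [:y:]^2 - [:x:]^3 * V^2) = 0"
      using assms(2) by simp
    from arg_cong[OF this, of "\<lambda>p. poly p 0"] assms(3)
    have "(x^2 * y) * (3 * y * poly U 0 - 2 * x * poly V 0) = 0"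
      by (simp add: algebra_simps powers)
    with 3 show ?thesis by simp
  qed
qed

text \<open>For a deformation that starts in order t^k, constancy of j constrains the leading term.
  The orders 1, 2 and 3 serve the parts of f of degree 1, 2 and 3 in w.\<close>

lemma constant_modulus_first_order:
  fixes r :: "mon3 \<Rightarrow> complex poly"
  assumes k: "k > 0" and D: "4 * a^3 + 27 * b^2 \<noteq> 0"
    and const: "\<And>t. disc (\<lambda>n. weierstrass a b n + t^k * poly (r n) t) \<noteq> 0 \<Longrightarrow>
      j_inv (\<lambda>n. weierstrass a b n + t^k * poly (r n) t) = j_inv (weierstrass a b)"
  shows "modulus_form a b (\<lambda>n. poly (r n) 0) = 0"
proof -
  define s :: "complex poly" where "s = monom 1 k"
  have s: "s \<noteq> 0" "poly s 0 = 0" using k by (simp_all add: s_def poly_monom)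
  define p where "p n = weierstrass [:a:] [:b:] n + s * r n" for n
  let ?W = "weierstrass a b"
  have poly_p: "(\<lambda>n. poly (p n) t) = (\<lambda>n. ?W n + t^k * poly (r n) t)" for t
    by (rule ext, rename_tac n, case_tac n) (simp_all add: p_def weierstrass_def s_def poly_monom)
  have DW: "disc ?W \<noteq> 0" using D by (simp only: disc_weierstrass mult_eq_0_iff) simp
  define G where "G = c4 p ^ 3 * [:disc ?W:] - [:c4 ?W ^ 3:] * disc p"
  \<comment> \<open>Constancy is known only at smooth members; the factor \<open>disc p\<close>
    extends the equation to all \<open>t\<close> and is cancelled as a nonzero polynomial.\<close>
  have "poly (disc p * G) t = 0" for t
  proof (cases "disc (\<lambda>n. poly (p n) t) = 0")
    case False
    then have "j_inv (\<lambda>n. poly (p n) t) = j_inv ?W"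
      unfolding poly_p by (rule const)
    then have "c4 (\<lambda>n. poly (p n) t) ^ 3 * disc ?W = c4 ?W ^ 3 * disc (\<lambda>n. poly (p n) t)"
      using False DW by (simp add: j_inv_def frac_eq_eq)
    then show ?thesis by (simp add: G_def poly_c4 poly_disc mult.commute)
  qed (simp add: poly_disc)
  then have "disc p * G = 0" using poly_all_0_iff_0 by blast
  moreover have "disc p \<noteq> 0"
  proof
    assume "disc p = 0"
    then have "disc (\<lambda>n. poly (p n) 0) = 0" by (simp flip: poly_disc)
    then show False using DW k by (simp add: poly_p zero_power)
  qed
  ultimately have G: "G = 0" by simp
  obtain R4 where R4: "c4 p = -48 * [:a:] + s * (48 * [:a:] * r X3 + 144 * [:b:] * r XY2 + 48 * r XZ2
      - 96 * [:a:] * r Y2Z) + s^2 * R4"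
    unfolding p_def using c4_weierstrass_taylor by blast
  obtain R6 where R6: "c6 p = -864 * [:b:] + s * (1728 * [:b:] * r X3 - 288 * [:a:] * r X2Z
      - 576 * [:a:]^2 * r XY2 + 864 * r Z3 - 2592 * [:b:] * r Y2Z) + s^2 * R6"
    unfolding p_def using c6_weierstrass_taylor by blast
  define U where "U = 48 * [:a:] * r X3 + 144 * [:b:] * r XY2 + 48 * r XZ2 - 96 * [:a:] * r Y2Z + s * R4"
  define V where "V = 1728 * [:b:] * r X3 - 288 * [:a:] * r X2Z - 576 * [:a:]^2 * r XY2 + 864 * r Z3
      - 2592 * [:b:] * r Y2Z + s * R6"
  have num: "-48 * [:a:] = [:-48 * a:]" "-864 * [:b:] = [:-864 * b:]"
    by (simp_all add: numeral_poly)
  have c4p: "c4 p = [:-48 * a:] + s * U" and c6p: "c6 p = [:-864 * b:] + s * V"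
    unfolding R4 R6 U_def V_def num[symmetric] by algebra+
  have "([:-48 * a:] + s * U) ^ 3 * [:-864 * b:] ^ 2 = [:-48 * a:] ^ 3 * ([:-864 * b:] + s * V) ^ 2"
  proof -
    have pc: "[:x ^ 3:] = [:x:] ^ 3" "[:x ^ 3 - y ^ 2:] = [:x:] ^ 3 - [:y:] ^ 2" for x y :: complex
      by (simp_all add: powers)
    have "c4 p ^ 3 * ([:c4 ?W:] ^ 3 - [:c6 ?W:] ^ 2) = [:c4 ?W:] ^ 3 * (c4 p ^ 3 - c6 p ^ 2)"
      using G unfolding G_def disc_def pc by simp
    then have "c4 p ^ 3 * [:c6 ?W:] ^ 2 = [:c4 ?W:] ^ 3 * c6 p ^ 2" by algebra
    then show ?thesis by (simp only: c4p c6p c4_weierstrass c6_weierstrass)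
  qed
  moreover have "(-48 * a)^3 \<noteq> (-864 * b)^2"
    using DW by (simp only: disc_def c4_weierstrass c6_weierstrass right_minus_eq not_False_eq_True)
  ultimately have "3 * (-864 * b) * poly U 0 = 2 * (-48 * a) * poly V 0"
    using s by (intro weighted_first_order)
  moreover have "poly U 0 = 48 * a * poly (r X3) 0 + 144 * b * poly (r XY2) 0 + 48 * poly (r XZ2) 0
      - 96 * a * poly (r Y2Z) 0"
    and "poly V 0 = 1728 * b * poly (r X3) 0 - 288 * a * poly (r X2Z) 0 - 576 * a^2 * poly (r XY2) 0
      + 864 * poly (r Z3) 0 - 2592 * b * poly (r Y2Z) 0"
    by (simp_all add: U_def V_def s)
  ultimately have "13824 * modulus_form a b (\<lambda>n. poly (r n) 0) = 0"
    unfolding modulus_form_def by algebra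
  then show ?thesis by simp
qed

text \<open>Horner form in \<open>t\<close>: once the first parts vanish, a power t^2 or t^3 splits
  off.\<close>

lemma section_coefs_line:
  "section_coefs c q m \<kappa> (\<lambda>i. t * e i) n = c n + t * (lin_quad e q n + t * (lin_quad m (lin_lin e e) n
     + t * (\<kappa> * lin_quad e (lin_lin e e) n)))" for t :: complex
  by (cases n) (simp_all add: section_coefs_def lin_quad_def algebra_simps power2_eq_square)

text \<open>The map (v, w) to (B v + w u, w): it preserves the plane w = 0, where it acts by
  \<open>B\<close>, while \<open>u\<close> is a shear.\<close>

definition affine_matrix :: "complex^3^3 \<Rightarrow> complex^3 \<Rightarrow> complex^4^4" where
  "affine_matrix B u = (\<chi> i. if i = 4 then axis 4 1 else
     (let k = (if i = 1 then 1 else if i = 2 then 2 else 3) in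
       (\<chi> j. if j = 1 then B$k$1 else if j = 2 then B$k$2 else if j = 3 then B$k$3 else u$k)))"

lemma affine_matrix_mult [simp]:
  "(affine_matrix B u *v v) $ 1 = B$1$1 * v$1 + B$1$2 * v$2 + B$1$3 * v$3 + u$1 * v$4"
  "(affine_matrix B u *v v) $ 2 = B$2$1 * v$1 + B$2$2 * v$2 + B$2$3 * v$3 + u$2 * v$4"
  "(affine_matrix B u *v v) $ 3 = B$3$1 * v$1 + B$3$2 * v$2 + B$3$3 * v$3 + u$3 * v$4"
  "(affine_matrix B u *v v) $ 4 = v$4"
  by (simp_all add: affine_matrix_def matrix_vector_mult_def sum_4 axis_def)

lemma invertible_affine_matrix:
  assumes "invertible B"
  shows "invertible (affine_matrix B u)"
proof (rule invertible_if_trivial_kernel)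
  fix v assume v: "affine_matrix B u *v v = 0"
  have 4: "v $ 4 = 0" using arg_cong[OF v, of "\<lambda>v. v $ 4"] by simp
  have "B *v vector [v$1, v$2, v$3] = 0"
    using arg_cong[OF v, of "\<lambda>v. v $ 1"] arg_cong[OF v, of "\<lambda>v. v $ 2"] arg_cong[OF v, of "\<lambda>v. v $ 3"] 4
    by (simp add: vec_eq_iff forall_3 matrix_vector_mult_def[of B] sum_3)
  then have "vector [v$1, v$2, v$3] = (0 :: complex^3)"
    using injD[OF inj_matrix_vector_mult[OF assms], of _ 0] by simp
  then show "v = 0" using 4 by (simp add: vec_eq_iff forall_3 forall_4)
qed

lemma expansion_restrict:
  assumes "expansion f C c q m \<kappa>" "expansion f (C ** affine_matrix B u) c' q' m' \<kappa>'"
  shows "c' = coef (linear_subst B (cubic_poly c))"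
proof (rule coef_linear_subst_eqI[symmetric])
  fix z :: "complex^3"
  let ?v = "(\<chi> i. if i = 1 then z$1 else if i = 2 then z$2 else if i = 3 then z$3 else 0) :: complex^4"
  have "quaternary_val c' q' m' \<kappa>' ?v = quaternary_val c q m \<kappa> (affine_matrix B u *v ?v)"
    using assms by (simp add: expansion_def flip: matrix_vector_mul_assoc)
  then show "pval (cubic_poly c) (B *v z) = cubic_val c' (z $ 1) (z $ 2) (z $ 3)"
    by (simp add: quaternary_val_def eval_cubic_poly matrix_vector_mult_def[of B] sum_3)
qed simp

lemma keys_independent_of_variable:
  assumes "\<And>a. eval_poly a p = eval_poly (a(i := 0)) p" "m \<in> keys p"
  shows "lookup m i = 0"
proof -
  let ?K = "{m \<in> keys p. lookup m i = 0}"
  define q where "q = (\<Sum>m\<in>?K. single m (lookup p m))"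
  have val: "monom_val (a(i := 0)) m = (if lookup m i = 0 then monom_val a m else 0)"
    for a :: "_ \<Rightarrow> complex" and m
  proof (cases "lookup m i = 0")
    case True
    then show ?thesis unfolding monom_val_def by (auto simp: in_keys_iff intro!: prod.cong)
  next
    case False
    then have "i \<in> keys m" by (simp add: in_keys_iff)
    then show ?thesis using False unfolding monom_val_def by (auto intro!: prod_zero)
  qed
  have "eval_poly a p = eval_poly a q" for a
  proof -
    have "eval_poly (a(i := 0)) p = (\<Sum>m\<in>?K. lookup p m * monom_val a m)"
      unfolding eval_poly_monom_val val
      by (simp add: if_distrib[of "\<lambda>x. _ * x"] sum.inter_filter cong: if_cong)
    also have "\<dots> = eval_poly a q"
      by (simp add: q_def)
    finally show ?thesis using assms(1)[of a] by simp
  qed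
  then have "p = q" by (rule eval_poly_eq_imp_eq)
  moreover have "lookup q m = 0" if "lookup m i \<noteq> 0"
    using that by (auto simp: q_def lookup_sum lookup_single when_def)
  ultimately show ?thesis using assms(2) by (auto simp: in_keys_iff)
qed

lemma is_coneI:
  assumes "invertible C" "expansion f C c (\<lambda>_. 0) (\<lambda>_. 0) 0"
  shows "is_cone f"
  unfolding is_cone_def
proof (intro exI conjI ballI)
  fix m assume m: "m \<in> keys (linear_subst C f)"
  show "lookup m 4 = 0"
  proof (rule keys_independent_of_variable[OF _ m])
    fix a :: "4 \<Rightarrow> complex"
    have val: "eval_poly b (linear_subst C f) = cubic_val c (b 1) (b 2) (b 3)" for b
    proof -
      have "pval (linear_subst C f) (\<chi> i. b i) = cubic_val c (b 1) (b 2) (b 3)"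
        using assms(2) by (simp add: eval_linear_subst expansion_def quaternary_val_def quad_val_def)
      then show ?thesis by (simp add: vec_lambda_inverse)
    qed
    show "eval_poly a (linear_subst C f) = eval_poly (a(4 := 0)) (linear_subst C f)"
      by (simp add: val)
  qed
qed (rule assms(1))

lemma modulus_nonconstant:
  assumes f: "homogeneous 3 f" "\<not> is_cone f"
    and C0: "invertible C0" "expansion f C0 c0 q0 m0 \<kappa>0" "disc c0 \<noteq> 0"
  obtains C c q m \<kappa> h where "invertible C" "expansion f C c q m \<kappa>" "disc c \<noteq> 0"
    "disc (section_coefs c q m \<kappa> h) \<noteq> 0" "j_inv (section_coefs c q m \<kappa> h) \<noteq> j_inv c"
proof -
  have "\<exists>C c q m \<kappa> h. invertible C \<and> expansion f C c q m \<kappa> \<and> disc c \<noteq> 0 \<and>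
    disc (section_coefs c q m \<kappa> h) \<noteq> 0 \<and> j_inv (section_coefs c q m \<kappa> h) \<noteq> j_inv c"
  proof (rule ccontr)
    assume "\<not> ?thesis"
    \<comment> \<open>Constancy is available in every frame whose section w = 0 is smooth; the frame
      is changed twice below.\<close>
    then have const: "j_inv (section_coefs c q m \<kappa> h) = j_inv c"
      if "invertible C" "expansion f C c q m \<kappa>" "disc c \<noteq> 0" "disc (section_coefs c q m \<kappa> h) \<noteq> 0" for C c q m \<kappa> h
      using that by blast
    obtain a b where "coef_equiv c0 (weierstrass a b)"
      using C0(3) nonsingular_iff_disc weierstrass_form by blast
    then obtain B where B: "invertible B" "weierstrass a b = coef (linear_subst B (cubic_poly c0))"
      by (auto simp: coef_equiv_def)
    let ?W = "weierstrass a b"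
    have D: "4 * a^3 + 27 * b^2 \<noteq> 0"
      using C0(3) \<open>coef_equiv c0 ?W\<close> nonsingular_equiv nonsingular_iff_disc nonsingular_weierstrass_iff by metis
    then have DW: "disc ?W \<noteq> 0" using nonsingular_iff_disc nonsingular_weierstrass_iff by blast
    define C where "C = C0 ** affine_matrix B 0"
    have C: "invertible C" unfolding C_def by (intro invertible_mult C0 invertible_affine_matrix B)
    obtain c q m \<kappa> where exp: "expansion f C c q m \<kappa>" using expansion_exists[OF f(1)] by blast
    have "c = ?W"
      using expansion_restrict[OF C0(2) exp[unfolded C_def]] B by simp
    with exp have exp: "expansion f C ?W q m \<kappa>" by simp
    have leading: "modulus_form a b (\<lambda>n. poly (r n) 0) = 0"
      if "k > 0" "invertible C" "expansion f C ?W q m \<kappa>"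
        "\<And>t. (\<lambda>n. ?W n + t^k * poly (r n) t) = section_coefs ?W q m \<kappa> (\<lambda>i. t * e i)" for k C q m \<kappa> r e
      using that D DW const by (intro constant_modulus_first_order[of k]) auto
    have no_quad: "lin_quad e (\<lambda>_. 0) n = 0" and no_lin: "lin_quad (\<lambda>_. 0) s n = 0"
      for e :: "3 \<Rightarrow> complex" and s n
      by (cases n; simp add: lin_quad_def)+
    have first: "modulus_form a b (lin_quad e q) = 0" for e
    proof -
      have "modulus_form a b
          (\<lambda>n. poly [:lin_quad e q n, lin_quad m (lin_lin e e) n, \<kappa> * lin_quad e (lin_lin e e) n:] 0) = 0"
        by (rule leading[where k=1 and e=e, OF zero_less_one C exp]) (rule ext, simp add: section_coefs_line)
      then show ?thesis by simp
    qed
    \<comment> \<open>The aim is Q = u1 W_x + u2 W_y + u3 W_z, where W_x = -3x^2 - az^2, W_y = 2yz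
      and W_z = y^2 - 2axz - 3bz^2. The coefficients of x^2, yz and y^2 determine the u's; the other
      three must be checked.\<close>
    define u1 u2 u3 where "u1 = - q XX / 3" and "u2 = q YZ / 2" and "u3 = q YY"
    have qXX: "q XX = - 3 * u1" and qYZ: "q YZ = 2 * u2" and qYY: "q YY = u3"
      by (simp_all add: u1_def u2_def u3_def)
    have qXY: "q XY = 0"
      using first[of "\<lambda>i. if i = 2 then 1 else 0"] D by (simp add: modulus_form_def lin_quad_def)
    have e1: "3 * a * b * q XX - 2 * a^2 * q XZ - (4 * a^3 + 27 * b^2) * q YY - 9 * b * q ZZ = 0"
      using first[of "\<lambda>i. if i = 1 then 1 else 0"] by (simp add: modulus_form_def lin_quad_def)
    have e2: "6 * a * q ZZ - 2 * a^2 * q XX - 9 * b * q XZ = 0"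
      using first[of "\<lambda>i. if i = 3 then 1 else 0"] by (simp add: modulus_form_def lin_quad_def algebra_simps)
    \<comment> \<open>\<open>e1\<close> and \<open>e2\<close> are linear equations for
      \<open>q XZ\<close> and \<open>q ZZ\<close> with determinant -3(4a^3 + 27b^2).\<close>
    have "(4 * a^3 + 27 * b^2) * (q XZ + 2 * a * q YY) = 0" using e1 e2 by algebra
    then have qXZ: "q XZ = - 2 * a * u3" using D by (simp add: qYY add_eq_0_iff)
    have "(4 * a^3 + 27 * b^2) * (3 * q ZZ - a * q XX + 9 * b * q YY) = 0" using e1 e2 by algebra
    then have "3 * q ZZ - a * q XX + 9 * b * q YY = 0" using D by simp
    then have qZZ: "q ZZ = - a * u1 - 3 * b * u3" unfolding qXX qYY by algebra
    \<comment> \<open>To first order in w, the shear by -u changes W by -w(u1 W_x + u2 W_y + u3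
      W_z), which cancels wQ.\<close>
    define C' where "C' = C ** affine_matrix (mat 1) (vector [- u1, - u2, - u3])"
    have "invertible (mat 1 :: complex^3^3)" unfolding invertible_def by (intro exI[of _ "mat 1"]) simp
    then have C': "invertible C'" unfolding C'_def by (intro invertible_mult C invertible_affine_matrix)
    \<comment> \<open>The w^2 part after the shear: m minus half the second derivative of W along u.
      The shear contributes that half once from W and minus twice from wQ.\<close>
    define m' where "m' i = (if i = 1 then m 1 + 3 * u1^2 + a * u3^2 
      else if i = 2 then m 2 - 2 * u2 * u3
      else m 3 - u2^2 + 2 * a * u1 * u3 + 3 * b * u3^2)" for i :: 3
    define \<kappa>' where "\<kappa>' = \<kappa> - (m 1 * u1 + m 2 * u2 + m 3 * u3) + quad_val q u1 u2 u3 - cubic_val ?W u1 u2 u3"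
    have exp': "expansion f C' ?W (\<lambda>_. 0) m' \<kappa>'"
      unfolding expansion_def
    proof
      fix v
      have "pval f (C' *v v) = quaternary_val ?W q m \<kappa> (affine_matrix (mat 1) (vector [- u1, - u2, - u3]) *v v)"
        using exp by (simp add: C'_def expansion_def flip: matrix_vector_mul_assoc)
      also have "\<dots> = quaternary_val ?W (\<lambda>_. 0) m' \<kappa>' v"
        by (simp add: quaternary_val_def mat_def m'_def \<kappa>'_def quad_val_def cubic_val_def weierstrass_def
            qXX qXY qXZ qYY qYZ qZZ) algebra
      finally show "pval f (C' *v v) = quaternary_val ?W (\<lambda>_. 0) m' \<kappa>' v" .
    qed
    have second: "modulus_form a b (lin_quad m' (lin_lin e e)) = 0" for e
    proof -
      have "modulus_form a b (\<lambda>n. poly [:lin_quad m' (lin_lin e e) n, \<kappa>' * lin_quad e (lin_lin e e) n:] 0) = 0"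
        by (rule leading[where k=2 and e=e, OF zero_less_numeral C' exp'])
           (rule ext, simp add: section_coefs_line no_quad power2_eq_square)
      then show ?thesis by simp
    qed
    \<comment> \<open>The test forms h are y, z, x + z and x + y in turn; their squares separate the
      three coefficients of m'.\<close>
    have m1: "m' 1 = 0"
      using second[of "\<lambda>i. if i = 2 then 1 else 0"] D by (simp add: modulus_form_def lin_quad_def)
    have m3a: "a * m' 3 = 0"
      using second[of "\<lambda>i. if i = 3 then 1 else 0"] m1 by (simp add: modulus_form_def lin_quad_def)
    have m3b: "b * m' 3 = 0"
      using second[of "\<lambda>i. if i = 2 then 0 else 1"] m1 m3a
      by (auto simp add: modulus_form_def lin_quad_def power2_eq_square)
    have m3: "m' 3 = 0" using m3a m3b D by auto
    have m2: "m' 2 = 0"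
      using second[of "\<lambda>i. if i = 3 then 0 else 1"] m1 m3 D by (simp add: modulus_form_def lin_quad_def)
    have "m' = (\<lambda>_. 0)"
      using m1 m2 m3 by (intro ext) (metis exhaust_3)
    with exp' have exp2: "expansion f C' ?W (\<lambda>_. 0) (\<lambda>_. 0) \<kappa>'" by simp
    have third: "\<kappa>' * modulus_form a b (lin_quad e (lin_lin e e)) = 0" for e
    proof -
      have "modulus_form a b (\<lambda>n. poly [:\<kappa>' * lin_quad e (lin_lin e e) n:] 0) = 0"
        by (rule leading[where k=3 and e=e, OF zero_less_numeral C' exp2])
           (rule ext, simp add: section_coefs_line no_quad no_lin power3_eq_cube mult_ac)
      then show ?thesis by (simp add: modulus_form_def algebra_simps)
    qed
    \<comment> \<open>On x^3 and (x + y)^3 the form \<open>modulus_form\<close> has values 3ab and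
      3ab - 3(4a^3 + 27b^2), which are not both 0.\<close>
    have "\<kappa>' = 0"
      using third[of "\<lambda>i. if i = 1 then 1 else 0"] third[of "\<lambda>i. if i = 3 then 0 else 1"] D
      by (auto simp: modulus_form_def lin_quad_def)
    with exp2 have "is_cone f" using is_coneI[OF C'] by simp
    with f(2) show False by simp
  qed
  then show ?thesis using that by blast
qed

section \<open>Existence of smooth plane sections\<close>

text \<open>The translates of a bounded piece of \<open>S\<close> by \<open>N\<close> different multiples of \<open>b\<close> lie in a common
  ball and cover each point at most \<open>d\<close> times, so that the measure of the piece is \<open>O(1/N)\<close>.\<close>

lemma negligible_bounded_line_multiplicity:
  fixes S :: "'a::euclidean_space set"
  assumes "closed S"
    and fin: "\<And>x. finite {t :: real. x + t *\<^sub>R b \<in> S}" and card: "\<And>x. card {t :: real. x + t *\<^sub>R b \<in> S} \<le> d"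
  shows "negligible S"
proof (subst negligible_on_intervals, intro allI)
  fix u v :: 'a
  define T where "T = S \<inter> cbox u v"
  have cT: "compact T" unfolding T_def using \<open>closed S\<close> by (simp add: closed_Int_compact)
  then have T: "T \<in> lmeasurable" by (rule lmeasurable_compact)
  obtain r where r: "\<And>x. x \<in> T \<Longrightarrow> norm x \<le> r"
    using compact_imp_bounded[OF cT] by (auto simp: bounded_iff)
  define K where "K = cball (0::'a) (r + norm b)"
  have K: "K \<in> lmeasurable" by (simp add: K_def)
  \<comment> \<open>Any sequence of distinct numbers in [0, 1] would do: distinctness bounds the
    overlaps, boundedness keeps the translates in \<open>K\<close>.\<close>
  define s :: "nat \<Rightarrow> real" where "s n = 1 / (real n + 1)" for n
  have s01: "0 \<le> s n" "s n \<le> 1" and inj_s: "inj s" for n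
    by (auto simp: s_def inj_def)
  define A where "A n = (+) (s n *\<^sub>R b) ` T" for n
  have A: "A n \<in> lmeasurable" "measure lebesgue (A n) = measure lebesgue T" for n
    using T by (simp_all add: A_def measurable_translation measure_translation)
  have AK: "A n \<subseteq> K" for n
  proof
    fix x assume "x \<in> A n"
    then obtain y where y: "y \<in> T" "x = s n *\<^sub>R b + y" by (auto simp: A_def)
    have "norm x \<le> s n * norm b + norm y"
      unfolding y using norm_triangle_ineq[of "s n *\<^sub>R b" y] s01[of n] by simp
    also have "\<dots> \<le> r + norm b"
      using r[OF y(1)] mult_right_mono[OF s01(2)[of n], of "norm b"] by simp
    finally show "x \<in> K" by (simp add: K_def)
  qed
  have ind: "(\<Sum>n<N. indicat_real (A n) x) \<le> d * indicat_real K x" for N x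
  proof (cases "x \<in> K")
    case False
    then show ?thesis using AK by (auto simp: indicator_def)
  next
    case True
    have "(\<Sum>n<N. indicat_real (A n) x) = card {n\<in>{..<N}. x \<in> A n}"
      by (simp add: indicator_def sum.If_cases Int_def)
    also have "card {n\<in>{..<N}. x \<in> A n} = card ((\<lambda>n. - s n) ` {n\<in>{..<N}. x \<in> A n})"
      using inj_s by (intro card_image[symmetric]) (auto simp: inj_on_def)
    also have "\<dots> \<le> card {t. x + t *\<^sub>R b \<in> S}"
      using fin by (intro card_mono) (auto simp: A_def T_def)
    also have "\<dots> \<le> d" by (rule card)
    finally show ?thesis using True by simp
  qed
  have "real N * measure lebesgue T \<le> d * measure lebesgue K" for N
  proof -
    have int: "indicat_real (A n) integrable_on UNIV" "indicat_real K integrable_on UNIV" for n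
      using A K by (auto simp: measurable_integrable)
    have "real N * measure lebesgue T = (\<Sum>n<N. integral UNIV (indicat_real (A n)))"
      using A by (simp flip: lmeasure_integral_UNIV)
    also have "\<dots> = integral UNIV (\<lambda>x. \<Sum>n<N. indicat_real (A n) x)"
      by (rule integral_sum[symmetric]) (use int in auto)
    also have "\<dots> \<le> integral UNIV (\<lambda>x. d * indicat_real K x)"
      using int ind by (intro integral_le integrable_sum integrable_on_mult_right) auto
    also have "\<dots> = d * measure lebesgue K"
      using K by (simp add: lmeasure_integral_UNIV)
    finally show ?thesis .
  qed
  then have "measure lebesgue T \<le> 0"
    by (metis ex_less_of_nat_mult not_less)
  then have "measure lebesgue T = 0" using measure_nonneg by (metis antisym)
  then show "negligible (S \<inter> cbox u v)"
    using T by (simp add: negligible_iff_measure T_def)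
qed

lemma poly_along_line:
  fixes p :: "'n::finite mpoly"
  assumes "homogeneous d p"
  obtains q where "degree q \<le> d" "\<And>t. poly q t = pval p (x + t *s b)"
proof -
  define q where "q = insertion (\<lambda>c. [:c:]) (\<lambda>i. [:x $ i, b $ i:]) p"
  have "poly q t = pval p (x + t *s b)" for t
  proof -
    have "(\<lambda>i. poly [:x $ i, b $ i:] t) = ($) (x + t *s b)" by (auto simp: mult.commute)
    then show ?thesis unfolding q_def poly_insertion by simp
  qed
  moreover have "degree q \<le> d"
    unfolding q_def insertion_def
  proof (rule degree_sum_le)
    fix m assume m: "m \<in> keys p"
    have "degree (\<Prod>i\<in>keys m. [:x $ i, b $ i:] ^ lookup m i)
        \<le> (\<Sum>i\<in>keys m. degree ([:x $ i, b $ i:] ^ lookup m i))"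
      using degree_prod_sum_le[OF finite_keys[of m]] by (simp add: comp_def)
    also have "\<dots> \<le> (\<Sum>i\<in>keys m. lookup m i)"
    proof (rule sum_mono)
      fix i
      have "degree ([:x $ i, b $ i:] ^ lookup m i) \<le> degree [:x $ i, b $ i:] * lookup m i"
        by (rule degree_power_le)
      also have "\<dots> \<le> 1 * lookup m i" by (intro mult_right_mono) auto
      finally show "degree ([:x $ i, b $ i:] ^ lookup m i) \<le> lookup m i" by simp
    qed
    also have "\<dots> = d" using assms m by (simp add: homogeneous_def exponent_degree_def)
    finally show "degree ([:lookup p m:] *
        (\<Prod>i\<in>keys m. [:x $ i, b $ i:] ^ lookup m i)) \<le> d"
      by (metis (no_types, lifting) degree_mult_le degree_pCons_0 add_0 order_trans)
  qed simp
  ultimately show ?thesis using that by blast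
qed

text \<open>In a direction \<open>b\<close> with p(b) nonzero, the restriction of \<open>p\<close>
  to any parallel line has leading coefficient p(b) in degree \<open>d\<close>, so the number of
  zeros on it is at most \<open>d\<close>.\<close>

lemma negligible_zeros:
  fixes p :: "'n::finite mpoly"
  assumes p: "homogeneous d p" "p \<noteq> 0"
  shows "negligible {x. pval p x = 0}"
proof -
  obtain b where b: "pval p b \<noteq> 0"
    using eval_poly_vec_eq_imp_eq[of p 0] p(2) by auto
  have fin_card: "finite {t :: real. pval p (x + t *\<^sub>R b) = 0} \<and>
      card {t :: real. pval p (x + t *\<^sub>R b) = 0} \<le> d" for x
  proof -
    obtain q where q: "degree q \<le> d" "\<And>t. poly q t = pval p (x + t *s b)"
      using poly_along_line[OF p(1)] by blast
    \<comment> \<open>\<open>q'\<close> is the reversal t^d q(1/t) of \<open>q\<close>; its constant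
      term p(b) shows that \<open>q\<close> is not 0.\<close>
    obtain q' where q': "degree q' \<le> d" "\<And>t. poly q' t = pval p (b + t *s x)"
      using poly_along_line[OF p(1)] by blast
    have "q \<noteq> 0"
    proof
      assume "q = 0"
      have "poly q' t = 0" if "t \<noteq> 0" for t
      proof -
        have "($) (b + t *s x) = (\<lambda>i. t * (x + (1 / t) *s b) $ i)" using that by (auto simp: algebra_simps)
        then have "poly q' t = t ^ d * poly q (1 / t)"
          unfolding q q' using eval_poly_scale[OF p(1), of t "($) (x + (1 / t) *s b)"] by simp
        then show ?thesis using \<open>q = 0\<close> by simp
      qed
      then have "{t. t \<noteq> 0} \<subseteq> {t. poly q' t = 0}" by auto
      moreover have "infinite {t :: complex. t \<noteq> 0}"
        using infinite_remove[OF infinite_UNIV_char_0, of "0 :: complex"] by (simp add: set_diff_eq)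
      ultimately have "q' = 0" using poly_roots_finite finite_subset by blast
      then show False using q'(2)[of 0] b by simp
    qed
    have scale: "x + t *\<^sub>R b = x + complex_of_real t *s b" for t
      by (simp add: vec_eq_iff scaleR_conv_of_real[where 'a=complex])
    have sub: "complex_of_real ` {t. pval p (x + t *\<^sub>R b) = 0} \<subseteq> {t. poly q t = 0}"
      by (auto simp: q scale)
    have inj: "inj_on complex_of_real A" for A by (auto simp: inj_on_def)
    have "finite {t. poly q t = 0}" using poly_roots_finite[OF \<open>q \<noteq> 0\<close>] .
    moreover from this have "card (complex_of_real ` {t. pval p (x + t *\<^sub>R b) = 0}) \<le> d"
      using card_mono[OF _ sub] card_poly_roots_bound[OF \<open>q \<noteq> 0\<close>] q(1) by linarith
    ultimately show ?thesis
      using finite_imageD[OF finite_subset[OF sub] inj] card_image[OF inj, of "{t. pval p (x + t *\<^sub>R b) = 0}"]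
      by simp
  qed
  show ?thesis
  proof (rule negligible_bounded_line_multiplicity)
    show "closed {x. pval p x = 0}"
      by (intro closed_Collect_eq continuous_on_eval_poly continuous_on_const)
  qed (use fin_card in auto)
qed

lemma homogeneous_partial_deriv:
  assumes "homogeneous (Suc d) p"
  shows "homogeneous d (partial_deriv i p)"
  unfolding partial_deriv_def
proof (rule homogeneous_sum)
  fix m assume m: "m \<in> keys p"
  show "homogeneous d (single (m - single i 1)
     (of_nat (lookup m i) * lookup p m))"
  proof (cases "lookup m i = 0")
    case False
    have "m = single i 1 + (m - single i 1)"
      by (rule poly_mapping_eqI) (use False in \<open>auto simp: lookup_add lookup_minus lookup_single when_def\<close>)
    then have "exponent_degree m = 1 + exponent_degree (m - single i 1)"
      by (metis exponent_degree_add exponent_degree_single)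
    moreover have "exponent_degree m = Suc d" using assms m by (simp add: homogeneous_def)
    ultimately show ?thesis by (metis homogeneous_single add_Suc_shift add_0 plus_1_eq_Suc nat.inject)
  qed simp
qed

text \<open>This transfers isolatedness of singular points to the Euclidean topology of the affine
  cone, where Lindelof's theorem is available.\<close>

lemma zariski_open_euclidean:
  assumes "openin (zariski (UNIV :: 'n::finite set)) V"
  shows "open {x :: complex^'n. x \<noteq> 0 \<and> proj_point (($) x) \<in> V}"
proof -
  have vec0: "($) x = (\<lambda>_. 0) \<longleftrightarrow> x = 0" for x :: "complex^'n" by (auto simp: vec_eq_iff fun_eq_iff)
  from assms have "generate_topology_on {{p \<in> proj_space UNIV. \<forall>a\<in>p. eval_poly a F \<noteq> 0} | (F :: 'n mpoly) d. homogeneous d F} V"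
    unfolding zariski_def by (rule openin_topology_generated_by)
  then show ?thesis
  proof induction
    case (Int a b)
    have "{x :: complex^'n. x \<noteq> 0 \<and> proj_point (($) x) \<in> a \<inter> b} =
       {x. x \<noteq> 0 \<and> proj_point (($) x) \<in> a} \<inter> {x. x \<noteq> 0 \<and> proj_point (($) x) \<in> b}" by auto
    then show ?case using Int by (simp only: open_Int)
  next
    case (UN K)
    have "{x :: complex^'n. x \<noteq> 0 \<and> proj_point (($) x) \<in> \<Union>K} = (\<Union>k\<in>K. {x. x \<noteq> 0 \<and> proj_point (($) x) \<in> k})"
      by auto
    then show ?case using UN.IH by (simp only:) (rule open_UN, blast)
  next
    case (Basis s)
    then obtain F d where s: "s = {p \<in> proj_space UNIV. \<forall>a\<in>p. eval_poly a F \<noteq> 0}" and F: "homogeneous d F"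
      by blast
    have "{x :: complex^'n. x \<noteq> 0 \<and> proj_point (($) x) \<in> s} = {x. x \<noteq> 0} \<inter> {x. pval F x \<noteq> 0}"
      unfolding s using vec0 by (auto simp: ball_proj_point[OF F] proj_space_def)
    moreover have "open {x :: complex^'n. x \<noteq> 0}" by (simp add: open_Collect_neq)
    moreover have "open {x :: complex^'n. pval F x \<noteq> 0}"
      by (intro open_Collect_neq continuous_on_eval_poly continuous_on_const)
    ultimately show ?case by (simp only: open_Int)
  qed simp
qed

text \<open>The punctured lines over isolated singular points are open in the cone \<open>Z\<close>
  of singular vectors, so there are countably many. The planes through one such point form a null
  hyperplane.\<close>

lemma negligible_singular_planes:
  fixes f :: "'n::finite mpoly"
  assumes "isolated_singularities f"
  shows "negligible {a. \<exists>x. x \<noteq> 0 \<and> pval f x = 0 \<and> critical f x \<and> (\<Sum>i\<in>UNIV. a $ i * x $ i) = 0}"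
proof -
  define Z where "Z = {x :: complex^'n. x \<noteq> 0 \<and> pval f x = 0 \<and> critical f x}"
  define L where "L x = {y \<in> Z. proj_point (($) y) = proj_point (($) x)}" for x
  have vec0: "($) x = (\<lambda>_. 0) \<longleftrightarrow> x = 0" for x :: "complex^'n" by (auto simp: vec_eq_iff fun_eq_iff)
  have sing: "proj_point (($) x) \<in> singular_locus f" if "x \<in> Z" for x
    using that vec0[of x] unfolding singular_locus_def Z_def critical_def by blast
  have "openin (top_of_set Z) (L x)" if x: "x \<in> Z" for x
  proof -
    have "openin (subtopology (zariski UNIV) (singular_locus f)) {proj_point (($) x)}"
      using assms sing[OF x] by (simp add: isolated_singularities_def)
    from this[unfolded openin_subtopology] obtain V where
      "openin (zariski UNIV) V \<and> {proj_point (($) x)} = V \<inter> singular_locus f" ..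
    then have V: "openin (zariski UNIV) V" "{proj_point (($) x)} = V \<inter> singular_locus f" by simp_all
    have "L x = Z \<inter> {y. y \<noteq> 0 \<and> proj_point (($) y) \<in> V}"
    proof -
      have "proj_point (($) y) = proj_point (($) x) \<longleftrightarrow> proj_point (($) y) \<in> V" if "y \<in> Z" for y
        using V(2) sing[OF that] by blast
      then show ?thesis by (auto simp: L_def Z_def)
    qed
    then show ?thesis using zariski_open_euclidean[OF V(1)] by (auto simp: openin_open)
  qed
  then have "\<And>S. S \<in> L ` Z \<Longrightarrow> openin (top_of_set Z) S" by blast
  then obtain F where F: "F \<subseteq> L ` Z" "countable F" "\<Union>F = \<Union>(L ` Z)"
    using Lindelof_openin by metis
  then obtain X where X: "X \<subseteq> Z" "countable X" "F = L ` X"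
    using countable_image_eq_inj by (metis subset_image_inj countable_image_inj_on)
  define P where "P x = {a :: complex^'n. (\<Sum>i\<in>UNIV. a $ i * x $ i) = 0}" for x
  have "negligible (P x)" if x: "x \<in> X" for x
  proof -
    let ?F = "\<Sum>i\<in>UNIV. single (single i 1) (x $ i) :: 'n mpoly"
    have ev: "pval ?F a = (\<Sum>i\<in>UNIV. a $ i * x $ i)" for a
      by (simp add: mult.commute)
    have "homogeneous 1 ?F"
      by (rule homogeneous_sum) (metis homogeneous_single exponent_degree_single)
    moreover have "?F \<noteq> 0"
    proof
      assume "?F = 0"
      have "x $ k = 0" for k
        using ev[of "axis k 1"] unfolding \<open>?F = 0\<close>
        by (simp add: axis_def if_distrib[of "\<lambda>x. x * _"] cong: if_cong)
      then have "x = 0" by (simp add: vec_eq_iff)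
      then show False using x X(1) by (auto simp: Z_def)
    qed
    ultimately have "negligible {a. pval ?F a = 0}" by (rule negligible_zeros)
    then show ?thesis by (simp only: ev P_def)
  qed
  then have "negligible (\<Union>(P ` X))" using X(2) by (intro negligible_countable_Union) auto
  moreover have "{a. \<exists>x. x \<noteq> 0 \<and> pval f x = 0 \<and> critical f x \<and> (\<Sum>i\<in>UNIV. a $ i * x $ i) = 0} \<subseteq> \<Union>(P ` X)"
  proof clarify
    fix a x assume x: "x \<noteq> 0" "pval f x = 0" "critical f x" "(\<Sum>i\<in>UNIV. a $ i * x $ i) = 0"
    then have "x \<in> L x" "x \<in> Z" by (auto simp: L_def Z_def)
    then have "x \<in> \<Union>(L ` X)" using F(3) X(3) by blast
    then obtain y where y: "y \<in> X" "proj_point (($) x) = proj_point (($) y)" by (auto simp: L_def)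
    then obtain c where c: "c \<noteq> 0" "($) y = (\<lambda>i. c * x $ i)" by (auto simp: proj_point_eq_iff)
    have "(\<Sum>i\<in>UNIV. a $ i * y $ i) = c * (\<Sum>i\<in>UNIV. a $ i * x $ i)"
      by (simp add: c(2) sum_distrib_left mult_ac)
    then show "a \<in> \<Union>(P ` X)" using y(1) x(4) by (auto simp: P_def)
  qed
  ultimately show ?thesis by (rule negligible_subset)
qed

text \<open>
  A plane that is tangent to the surface at a smooth point is a value of the gradient map on
  the zero set of \<open>f\<close>, which has measure zero.
\<close>

lemma exists_smooth_section:
  fixes f :: "4 mpoly"
  assumes f: "f \<noteq> 0" "homogeneous 3 f" and iso: "isolated_singularities f"
  obtains a where "a \<noteq> 0" "\<And>P. parametrizes P (proj_point (($) a)) \<Longrightarrow> smooth_form (linear_subst P f)"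
proof -
  define G where "G x = (\<chi> i. pval (partial_deriv i f) x)" for x
  let ?S = "{x. pval f x = 0}"
  let ?N = "G ` ?S \<union> {a. \<exists>x. x \<noteq> 0 \<and> pval f x = 0 \<and> critical f x \<and> (\<Sum>i\<in>UNIV. a $ i * x $ i) = 0} \<union> {0}"
  have "G differentiable_on ?S"
    unfolding differentiable_on_def
  proof
    fix x
    have "(\<lambda>x. inner (G x) b) differentiable (at x within ?S)" if "b \<in> Basis" for b
    proof -
      obtain i c where "b = axis i c" using \<open>b \<in> Basis\<close> by (auto simp: Basis_vec_def)
      then have "(\<lambda>x. inner (G x) b) = (\<lambda>x. inner (pval (partial_deriv i f) x) c)"
        by (simp add: G_def inner_axis)
      then show ?thesis
        unfolding differentiable_def
        by (simp only:) (rule exI, rule has_derivative_inner_left[OF has_derivative_at_withinI[OF has_derivative_eval_poly]])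
    qed
    then show "G differentiable (at x within ?S)"
      by (subst differentiable_componentwise_within) blast
  qed
  then have "negligible (G ` ?S)"
    using negligible_zeros[OF f(2,1)] by (intro negligible_differentiable_image_negligible) auto
  then have "negligible ?N"
    using negligible_singular_planes[OF iso] by (intro negligible_Un) auto
  then have "?N \<noteq> UNIV" using non_negligible_UNIV by metis
  then obtain a where a: "a \<notin> ?N" by blast
  then have "a \<noteq> 0" by simp
  moreover have "smooth_form (linear_subst P f)" if P: "parametrizes P (proj_point (($) a))" for P
    unfolding smooth_form_iff
  proof (intro allI impI, elim conjE)
    fix z assume z: "pval (linear_subst P f) z = 0" "critical (linear_subst P f) z"
    define x where "x = P *v z"
    have range: "range ((*v) P) = {x. (\<Sum>i\<in>UNIV. a $ i * x $ i) = 0}"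
      using P by (simp add: parametrizes_def bij_betw_def hyperplane_proj_point)
    have x: "pval f x = 0" using z(1) by (simp add: x_def eval_linear_subst)
    have tangent: "(\<Sum>i\<in>UNIV. y $ i * G x $ i) = 0" if "(\<Sum>i\<in>UNIV. a $ i * y $ i) = 0" for y
    proof -
      have "y \<in> range ((*v) P)" unfolding range using that by simp
      then obtain u where u: "y = P *v u" by auto
      have "((\<lambda>t. pval f (x + t *s y)) has_field_derivative 0) (at 0)"
        using z(2) by (simp add: critical_linear_subst u x_def)
      from DERIV_unique[OF has_field_derivative_eval_poly_line this] show ?thesis by (simp add: G_def)
    qed
    obtain k where k: "a $ k \<noteq> 0" using \<open>a \<noteq> 0\<close> by (auto simp: vec_eq_iff)
    define c where "c = G x $ k / a $ k"
    have G: "G x = c *s a"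
    proof (unfold vec_eq_iff, rule allI)
      fix i
      show "G x $ i = (c *s a) $ i"
      proof (cases "i = k")
        case False
        have axis: "(\<Sum>j\<in>UNIV. axis l 1 $ j * g j) = g l" for l and g :: "4 \<Rightarrow> complex"
          by (simp add: axis_def if_distrib[of "\<lambda>x. x * _"] cong: if_cong)
        have sum: "(\<Sum>j\<in>UNIV. (a $ k *s axis i 1 - a $ i *s axis k 1) $ j * g j) = a $ k * g i - a $ i * g k" for g
          unfolding vector_minus_component vector_smult_component left_diff_distrib sum_subtractf mult.assoc
          by (simp only: axis flip: sum_distrib_left)
        \<comment> \<open>The vectors a_k e_i - a_i e_k lie in the plane, and a gradient that kills
          them is proportional to \<open>a\<close>.\<close>
        have "(\<Sum>j\<in>UNIV. (a $ k *s axis i 1 - a $ i *s axis k 1) $ j * G x $ j) = 0"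
        proof (rule tangent)
          show "(\<Sum>j\<in>UNIV. a $ j * (a $ k *s axis i 1 - a $ i *s axis k 1) $ j) = 0"
            using sum[of "($) a"] by (subst mult.commute) simp
        qed
        then have "a $ k * G x $ i = a $ i * G x $ k" unfolding sum by simp
        then show ?thesis using k by (simp add: c_def field_simps)
      qed (use k in \<open>simp add: c_def\<close>)
    qed
    have "c = 0"
    proof (rule ccontr)
      assume c: "c \<noteq> 0"
      \<comment> \<open>\<open>G\<close> is homogeneous of degree 2, so rescaling x by
        \<open>\<mu>\<close> turns its value c a into \<open>a\<close>, which was chosen outside the
        image of the zero set.\<close>
      obtain \<mu> where \<mu>: "\<mu> ^ 2 = 1 / c" using complex_root_exists[of 2] by auto
      have coords: "($) (\<mu> *s x) = (\<lambda>i. \<mu> * x $ i)" by auto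
      have "homogeneous 2 (partial_deriv i f)" for i
        using homogeneous_partial_deriv[of 2 f i] f(2) by simp
      then have "G (\<mu> *s x) = \<mu> ^ 2 *s G x"
        by (simp add: G_def vec_eq_iff coords eval_poly_scale)
      then have "G (\<mu> *s x) = a" using c by (simp add: G \<mu> vec_eq_iff)
      moreover have "\<mu> *s x \<in> ?S" using x by (simp add: coords eval_poly_scale[OF f(2)])
      ultimately show False using a by blast
    qed
    then have "critical f x" using G by (simp add: critical_def G_def vec_eq_iff)
    moreover have "(\<Sum>i\<in>UNIV. a $ i * x $ i) = 0"
    proof -
      have "x \<in> range ((*v) P)" by (simp add: x_def)
      then show ?thesis unfolding range by simp
    qed
    ultimately have "x = 0" using a x by blast
    then show "z = 0" using P unfolding parametrizes_def bij_betw_def x_def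
      by (metis injD matrix_vector_mult_0_right)
  qed
  ultimately show ?thesis using that by blast
qed

section \<open>Surfaces that are not cones\<close>

lemma cancel_common_roots:
  fixes A B :: "'a::field poly"
  assumes "B \<noteq> 0"
  shows "\<exists>d A' B'. d \<noteq> 0 \<and> A = d * A' \<and> B = d * B' \<and> (\<forall>t. \<not> (poly A' t = 0 \<and> poly B' t = 0))"
  using assms
proof (induction "degree B" arbitrary: A B rule: less_induct)
  case less
  show ?case
  proof (cases "\<exists>t. poly A t = 0 \<and> poly B t = 0")
    case True
    then obtain t A1 B1 where AB: "A = [:-t, 1:] * A1" "B = [:-t, 1:] * B1"
      by (metis dvdE poly_eq_0_iff_dvd)
    then have "B1 \<noteq> 0" using less.prems by auto
    then have "degree B = Suc (degree B1)" unfolding AB by (subst degree_mult_eq) auto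
    then obtain d A' B' where "d \<noteq> 0" "A1 = d * A'" "B1 = d * B'" "\<forall>t. \<not> (poly A' t = 0 \<and> poly B' t = 0)"
      using less.hyps[of B1 A1] \<open>B1 \<noteq> 0\<close> by auto
    then show ?thesis
      by (intro exI[of _ "[:-t, 1:] * d"] exI[of _ A'] exI[of _ B']) (simp add: AB mult.assoc del: mult_pCons_left)
  next
    case False
    then show ?thesis by (intro exI[of _ 1] exI[of _ A] exI[of _ B]) auto
  qed
qed

text \<open>After cancelling common roots, c is omitted only if A' - c B' is constant, and two such
  c would make A and B proportional. Other exceptions are values attained only at roots of the
  cancelled factor \<open>d\<close>.\<close>

lemma rational_function_values:
  fixes A B :: "complex poly"
  assumes B: "B \<noteq> 0" and nc: "\<And>c. A \<noteq> smult c B"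
  shows "finite {c. \<nexists>t. poly B t \<noteq> 0 \<and> poly A t = c * poly B t}"
proof -
  obtain d A' B' where d: "d \<noteq> 0" and A': "A = d * A'" and B': "B = d * B'"
    and no_common: "\<And>t. \<not> (poly A' t = 0 \<and> poly B' t = 0)"
    using cancel_common_roots[OF B] by metis
  define R where "R = {c. \<nexists>t. poly (A' - smult c B') t = 0}"
  have "c1 = c2" if c12: "c1 \<in> R" "c2 \<in> R" for c1 c2
  proof (rule ccontr)
    assume "c1 \<noteq> c2"
    have "\<exists>k. A' - smult c B' = [:k:]" if "c \<in> R" for c
    proof -
      have "degree (A' - smult c B') = 0"
        using that fundamental_theorem_of_algebra[of "A' - smult c B'"] by (auto simp: R_def constant_degree)
      then show ?thesis by (elim degree_eq_zeroE) blast
    qed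
    then obtain k1 k2 where k: "A' - smult c1 B' = [:k1:]" "A' - smult c2 B' = [:k2:]"
      using c12 by blast
    have "smult (c2 - c1) B' = [:k1 - k2:]"
    proof -
      have "smult (c2 - c1) B' = (A' - smult c1 B') - (A' - smult c2 B')" by (simp add: smult_diff_left)
      then show ?thesis unfolding k by simp
    qed
    then have "smult (1 / (c2 - c1)) (smult (c2 - c1) B') = smult (1 / (c2 - c1)) [:k1 - k2:]" by simp
    then have "B' = [:(k1 - k2) / (c2 - c1):]" using \<open>c1 \<noteq> c2\<close> by simp
    then obtain l where l: "B' = [:l:]" by blast
    then have "A' = [:k1 + c1 * l:]" using k(1) by (simp add: diff_eq_eq)
    then have "A' = smult ((k1 + c1 * l) / l) B'" using B B' l by auto
    then have "A = smult ((k1 + c1 * l) / l) B" by (simp add: A' B')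
    then show False using nc by blast
  qed
  then have "R = {} \<or> (\<exists>c. R = {c})" by blast
  then have "finite R" by auto
  moreover have "{c. \<nexists>t. poly B t \<noteq> 0 \<and> poly A t = c * poly B t} \<subseteq>
      R \<union> (\<lambda>t. poly A' t / poly B' t) ` {t. poly d t = 0}"
  proof
    fix c assume c: "c \<in> {c. \<nexists>t. poly B t \<noteq> 0 \<and> poly A t = c * poly B t}"
    show "c \<in> R \<union> (\<lambda>t. poly A' t / poly B' t) ` {t. poly d t = 0}"
    proof (cases "c \<in> R")
      case False
      then obtain t where t: "poly A' t = c * poly B' t" by (auto simp: R_def)
      then have B't: "poly B' t \<noteq> 0" using no_common by auto
      have "poly A t = c * poly B t" by (simp add: A' B' t)
      then have "poly B t = 0" using c by blast
      then have "poly d t = 0" using B't by (simp add: B')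
      moreover have "c = poly A' t / poly B' t" using t B't by simp
      ultimately show ?thesis by blast
    qed simp
  qed
  ultimately show ?thesis
    using finite_subset poly_roots_finite[OF d] by blast
qed

lemma poly_section_coefs:
  "poly (section_coefs (\<lambda>n. [:c n:]) (\<lambda>n. [:q n:]) (\<lambda>i. [:m i:]) [:\<kappa>:] h n) t =
     section_coefs c q m \<kappa> (\<lambda>i. poly (h i) t) n" for t :: complex
  by (cases n) (simp_all add: section_coefs_def lin_quad_def)

text \<open>The rational function is c4^3/disc along the line; its values at t = 0 and t = 1 differ,
  so it is not constant.\<close>

lemma modulus_along_line:
  assumes "disc c \<noteq> 0" "disc (section_coefs c q m \<kappa> e) \<noteq> 0" "j_inv (section_coefs c q m \<kappa> e) \<noteq> j_inv c"
  shows "finite {k. \<nexists>t. disc (section_coefs c q m \<kappa> (\<lambda>i. t * e i)) \<noteq> 0 \<and>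
    j_inv (section_coefs c q m \<kappa> (\<lambda>i. t * e i)) = k}" (is "finite ?K")
proof -
  define p where "p = section_coefs (\<lambda>n. [:c n:]) (\<lambda>n. [:q n:]) (\<lambda>i. [:m i:]) [:\<kappa>:] (\<lambda>i. [:0, e i:])"
  have p: "(\<lambda>n. poly (p n) t) = section_coefs c q m \<kappa> (\<lambda>i. t * e i)" for t
    by (rule ext) (simp add: p_def poly_section_coefs)
  have p0: "(\<lambda>n. poly (p n) 0) = c" and p1: "(\<lambda>n. poly (p n) 1) = section_coefs c q m \<kappa> e"
    using p[of 0] p[of 1] by simp_all
  have "finite {k. \<nexists>t. poly (disc p) t \<noteq> 0 \<and> poly (c4 p ^ 3) t = k * poly (disc p) t}"
  proof (rule rational_function_values)
    have "poly (disc p) 0 \<noteq> 0" using assms(1) by (simp add: poly_disc p0)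
    then show "disc p \<noteq> 0" by auto
    fix k
    show "c4 p ^ 3 \<noteq> smult k (disc p)"
    proof
      assume eq: "c4 p ^ 3 = smult k (disc p)"
      have "c4 (\<lambda>n. poly (p n) t) ^ 3 = k * disc (\<lambda>n. poly (p n) t)" for t
        using arg_cong[OF eq, of "\<lambda>p. poly p t"] by (simp add: poly_c4 poly_disc)
      from this[of 0] this[of 1] show False
        using assms by (simp add: p0 p1 j_inv_def)
    qed
  qed
  moreover have "poly (disc p) t \<noteq> 0 \<and> poly (c4 p ^ 3) t = k * poly (disc p) t \<longleftrightarrow>
      poly (disc p) t \<noteq> 0 \<and> j_inv (\<lambda>n. poly (p n) t) = k" for t k
    by (auto simp: j_inv_def poly_c4 poly_disc field_simps)
  ultimately have "finite {k. \<nexists>t. poly (disc p) t \<noteq> 0 \<and> j_inv (\<lambda>n. poly (p n) t) = k}"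
    by (simp only:)
  then show ?thesis by (simp add: poly_disc p)
qed

definition moduli_j :: "((3 \<Rightarrow>\<^sub>0 nat) \<Rightarrow> complex) set set \<Rightarrow> complex" where
  "moduli_j q = j_inv (coef (SOME g. smooth_cubic g \<and> moduli_class g = q))"

lemma moduli_j_class:
  assumes "smooth_cubic g"
  shows "moduli_j (moduli_class g) = j_inv (coef g)"
proof -
  let ?h = "SOME h. smooth_cubic h \<and> moduli_class h = moduli_class g"
  have "smooth_cubic ?h \<and> moduli_class ?h = moduli_class g"
    by (rule someI[of _ g]) (simp add: assms)
  then show ?thesis unfolding moduli_j_def using moduli_class_eq_iff assms by blast
qed

text \<open>A unit vector outside the plane is added as fourth column, which turns the given plane
  into w = 0.\<close>

lemma matrix_extending_parametrization:
  assumes "a \<noteq> 0" "parametrizes P (proj_point (($) a))"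
  obtains C where "invertible C" "C ** graph_matrix 0 = P"
proof -
  have injP: "inj ((*v) P)" and range: "range ((*v) P) = {x. (\<Sum>i\<in>UNIV. a $ i * x $ i) = 0}"
    using assms(2) by (auto simp: parametrizes_def bij_betw_def hyperplane_proj_point)
  obtain k where k: "a $ k \<noteq> 0" using assms(1) by (auto simp: vec_eq_iff)
  define C :: "complex^4^4" where "C = (\<chi> i j. if j = 1 then P$i$1 else if j = 2 then P$i$2
     else if j = 3 then P$i$3 else axis k 1 $ i)"
  have Cv: "C *v v = P *v vector [v$1, v$2, v$3] + v$4 *s axis k 1" for v
    by (simp add: C_def vec_eq_iff matrix_vector_mult_def sum_4 sum_3 mult.commute)
  have "v = 0" if v: "C *v v = 0" for v
  proof -
    let ?z = "vector [v$1, v$2, v$3] :: complex^3"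
    have "P *v ?z \<in> range ((*v) P)" by simp
    then have "(\<Sum>i\<in>UNIV. a $ i * (P *v ?z) $ i) = 0" unfolding range by simp
    moreover have Pz: "P *v ?z = - (v$4 *s axis k 1)" using v by (simp add: Cv eq_neg_iff_add_eq_0)
    ultimately have "a $ k * v $ 4 = 0"
      by (simp add: axis_def sum_negf if_distrib[of "\<lambda>x. _ * x"] cong: if_cong)
    then have v4: "v $ 4 = 0" using k by simp
    then have "?z = 0" using injD[OF injP, of ?z 0] Pz by simp
    then show "v = 0" using v4 by (simp add: vec_eq_iff forall_3 forall_4)
  qed
  then have "invertible C" by (rule invertible_if_trivial_kernel)
  moreover have "C ** graph_matrix 0 = P"
  proof -
    have "vector [z $ 1, z $ 2, z $ 3] = z" for z :: "complex^3" by (simp add: vec_eq_iff forall_3)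
    then show ?thesis by (simp add: matrix_eq Cv flip: matrix_vector_mul_assoc)
  qed
  ultimately show ?thesis using that by blast
qed

text \<open>The output of \<open>modulus_nonconstant\<close>: the planes w = 0 and w = h have smooth
  sections with different moduli.\<close>

locale varying_sections =
  fixes f C c q m \<kappa> h
  assumes f: "homogeneous 3 f" and C: "invertible C" and exp: "expansion f C c q m \<kappa>"
    and c: "disc c \<noteq> 0" and h: "disc (section_coefs c q m \<kappa> h) \<noteq> 0"
    and j: "j_inv (section_coefs c q m \<kappa> h) \<noteq> j_inv c"
begin

abbreviation coefs :: "(3 \<Rightarrow> complex) \<Rightarrow> mon3 \<Rightarrow> complex" where
  "coefs e \<equiv> section_coefs c q m \<kappa> e"

definition H :: "(3 \<Rightarrow> complex) \<Rightarrow> (4 \<Rightarrow> complex) set" where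
  "H e = plane C (\<chi> i. e i)"

lemma section_at:
  assumes "disc (coefs e) \<noteq> 0"
  obtains g where "H e \<in> smooth_sections f" "section_map f (H e) = moduli_class g" "smooth_cubic g"
    "coef g = coefs e"
proof -
  let ?g = "linear_subst (C ** graph_matrix (\<chi> i. e i)) f"
  have coef: "coef ?g = coefs e"
    using coef_section[OF f exp, of "\<chi> i. e i"] by (simp add: vec_lambda_inverse)
  then have "smooth_cubic ?g"
    using assms f by (simp add: smooth_cubic_iff homogeneous_linear_subst)
  then show ?thesis
    using that[of ?g] section_parametrization[OF f parametrizes_plane[OF C] plane_in_proj_space[OF C]] coef
    by (auto simp: H_def)
qed

lemma inj_H: "inj H"
  unfolding H_def by (rule injI) (metis injD[OF inj_plane[OF C]] vec_lambda_inject UNIV_I)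

lemma infinite_image: "infinite (section_map f ` smooth_sections f)"
proof
  assume fin: "finite (section_map f ` smooth_sections f)"
  let ?K = "{k. \<nexists>t. disc (coefs (\<lambda>i. t * h i)) \<noteq> 0 \<and> j_inv (coefs (\<lambda>i. t * h i)) = k}"
  have "- ?K \<subseteq> moduli_j ` section_map f ` smooth_sections f"
  proof
    fix k assume "k \<in> - ?K"
    then obtain t where t: "disc (coefs (\<lambda>i. t * h i)) \<noteq> 0" "j_inv (coefs (\<lambda>i. t * h i)) = k" by blast
    obtain g where "H (\<lambda>i. t * h i) \<in> smooth_sections f" "section_map f (H (\<lambda>i. t * h i)) = moduli_class g"
      "smooth_cubic g" "coef g = coefs (\<lambda>i. t * h i)" using section_at[OF t(1)] by blast
    then show "k \<in> moduli_j ` section_map f ` smooth_sections f"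
      using t(2) moduli_j_class by (metis imageI)
  qed
  then have "finite (- ?K)" using fin finite_subset by blast
  moreover have "finite ?K" using modulus_along_line[OF c h j] .
  ultimately have "finite (- ?K \<union> ?K)" by (rule finite_UnI)
  then have "finite (UNIV :: complex set)" by (simp only: Compl_partition2)
  then show False using infinite_UNIV_char_0 by blast
qed

text \<open>
  On almost every line through the plane \<open>H 0\<close> the modulus takes all but finitely many values.
  A value outside the countably many exceptions for infinitely many lines is taken on each of them.
\<close>

lemma infinite_fibre:
  assumes "countable N"
  obtains k where "k \<notin> N" "infinite {e. disc (coefs e) \<noteq> 0 \<and> j_inv (coefs e) = k}"
proof -
  have "h \<noteq> (\<lambda>_. 0)" using j by auto
  then obtain i where i: "h i \<noteq> 0" by auto
  obtain i' :: 3 where i': "i' \<noteq> i" by (metis four_neq(13))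
  \<comment> \<open>Directions h + s e_i', pairwise not proportional because coordinate
    \<open>i\<close> is fixed and nonzero while coordinate \<open>i'\<close> varies.\<close>
  define e where "e s l = h l + (if l = i' then s else 0)" for s :: complex and l
  define p where "p = section_coefs (\<lambda>n. [:c n:]) (\<lambda>n. [:q n:]) (\<lambda>i. [:m i:]) [:\<kappa>:]
     (\<lambda>l. [:h l, if l = i' then 1 else 0:])"
  have p: "(\<lambda>n. poly (p n) s) = coefs (e s)" for s
  proof
    fix n
    have "(\<lambda>l. poly [:h l, if l = i' then 1 else 0:] s) = e s" by (auto simp: e_def)
    then show "poly (p n) s = coefs (e s) n" by (simp only: p_def poly_section_coefs)
  qed
  define E where "E = disc p * (c4 p ^ 3 * [:disc c:] - [:c4 c ^ 3:] * disc p)"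
  have E: "poly E s \<noteq> 0 \<longleftrightarrow> disc (coefs (e s)) \<noteq> 0 \<and> j_inv (coefs (e s)) \<noteq> j_inv c" for s
    using c by (auto simp: E_def poly_disc poly_c4 p j_inv_def field_simps)
  have "e 0 = h" by (auto simp: e_def)
  then have "poly E 0 \<noteq> 0" using E[of 0] h j by simp
  then have "finite {s. poly E s = 0}" by (intro poly_roots_finite) auto
  then have "infinite {s. poly E s \<noteq> 0}"
    using infinite_UNIV_char_0[where 'a=complex] by (metis Collect_neg_eq finite_compl)
  \<comment> \<open>A countable set of lines keeps the union of their exceptional values
    countable.\<close>
  then obtain X where X: "countable X" "infinite X" "X \<subseteq> {s. poly E s \<noteq> 0}"
    using infinite_countable_subset' by blast
  define bad where "bad s = {k. \<nexists>t. disc (coefs (\<lambda>l. t * e s l)) \<noteq> 0 \<and> j_inv (coefs (\<lambda>l. t * e s l)) = k}" for s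
  have "finite (bad s)" if "s \<in> X" for s
    unfolding bad_def using that X(3) E by (intro modulus_along_line[OF c]) auto
  then have "countable ((\<Union>s\<in>X. bad s) \<union> N \<union> {j_inv c})"
    using X(1) assms by (auto intro: countable_finite)
  then have "(\<Union>s\<in>X. bad s) \<union> N \<union> {j_inv c} \<noteq> UNIV"
    using uncountable_UNIV_complex by metis
  then obtain k where "k \<notin> (\<Union>s\<in>X. bad s) \<union> N \<union> {j_inv c}" by blast
  then have k: "k \<notin> (\<Union>s\<in>X. bad s)" "k \<notin> N" "k \<noteq> j_inv c" by simp_all
  have "\<exists>t. disc (coefs (\<lambda>l. t * e s l)) \<noteq> 0 \<and> j_inv (coefs (\<lambda>l. t * e s l)) = k" if "s \<in> X" for s
    using k(1) that by (auto simp: bad_def)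
  then obtain t where t: "\<And>s. s \<in> X \<Longrightarrow> disc (coefs (\<lambda>l. t s * e s l)) \<noteq> 0"
    "\<And>s. s \<in> X \<Longrightarrow> j_inv (coefs (\<lambda>l. t s * e s l)) = k" by metis
  have t0: "t s \<noteq> 0" if "s \<in> X" for s
    using t(2)[OF that] k(3) by auto
  have "inj_on (\<lambda>s l. t s * e s l) X"
  proof (rule inj_onI)
    fix s s' assume s: "s \<in> X" "s' \<in> X" and eq: "(\<lambda>l. t s * e s l) = (\<lambda>l. t s' * e s' l)"
    have "t s = t s'" using fun_cong[OF eq, of i] i i' by (auto simp: e_def)
    then show "s = s'" using fun_cong[OF eq, of i'] t0[OF s(2)] by (simp add: e_def)
  qed
  then have "infinite ((\<lambda>s l. t s * e s l) ` X)" using X(2) finite_imageD by blast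
  moreover have "(\<lambda>s l. t s * e s l) ` X \<subseteq> {e. disc (coefs e) \<noteq> 0 \<and> j_inv (coefs e) = k}"
    using t by auto
  ultimately have "infinite {e. disc (coefs e) \<noteq> 0 \<and> j_inv (coefs e) = k}"
    by (rule infinite_super[rotated])
  with k(2) show ?thesis by (rule that)
qed

lemma maximal_rank: "maximal_rank f"
proof -
  let ?Y = "section_map f ` smooth_sections f"
  have Y: "?Y \<subseteq> topspace moduli_cubics" using section_map_in_moduli[OF f] .
  have "krull_dim (section_image f) = 1"
    unfolding section_image_def by (rule krull_dim_moduli_subspace[OF Y infinite_image])
  moreover have "krull_dim moduli_cubics = 1"
    using krull_dim_moduli finite_subset[OF Y] infinite_image by blast
  ultimately show ?thesis by (simp add: maximal_rank_def min_def)
qed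

text \<open>A nonempty open \<open>W\<close> misses only finitely many classes of the image, so
  \<open>infinite_fibre\<close> finds a modulus in \<open>W\<close> attained on infinitely many
  planes; these are distinct by \<open>inj_H\<close>.\<close>

lemma not_generically_finite: "\<not> generically_finite f"
proof
  let ?Y = "section_map f ` smooth_sections f"
  assume "generically_finite f"
  then obtain W where W: "openin (section_image f) W" "W \<noteq> {}"
    and fin: "\<And>q. q \<in> W \<Longrightarrow> finite {H \<in> smooth_sections f. section_map f H = q}"
    unfolding generically_finite_def by blast
  have Y: "?Y \<subseteq> topspace moduli_cubics" using section_map_in_moduli[OF f] .
  then have top: "topspace (section_image f) = ?Y" by (auto simp: section_image_def)
  have "W \<subseteq> ?Y" using openin_subset[OF W(1)] top by simp
  have "closedin (section_image f) (?Y - W)"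
    using closedin_diff[OF closedin_topspace W(1)] by (simp only: top)
  then have "finite (?Y - W) \<or> ?Y - W = ?Y"
    by (simp only: section_image_def closedin_moduli_subspace_iff[OF Y])
  moreover have "?Y - W \<noteq> ?Y" using W(2) \<open>W \<subseteq> ?Y\<close> by blast
  ultimately have "finite (?Y - W)" by simp
  then have "countable (moduli_j ` (?Y - W))" by (intro countable_finite) simp
  then obtain k where k: "k \<notin> moduli_j ` (?Y - W)"
    and inf: "infinite {e. disc (coefs e) \<noteq> 0 \<and> j_inv (coefs e) = k}" (is "infinite ?E")
    by (rule infinite_fibre)
  have "?E \<noteq> {}" using inf by (rule infinite_imp_nonempty)
  then obtain e0 where e0: "e0 \<in> ?E" by blast
  define q where "q = section_map f (H e0)"
  have sec: "H e \<in> smooth_sections f \<and> section_map f (H e) = q" if e: "e \<in> ?E" for e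
  proof -
    obtain g where g: "H e \<in> smooth_sections f" "section_map f (H e) = moduli_class g"
      "smooth_cubic g" "coef g = coefs e" using section_at[of e] e by blast
    obtain g0 where g0: "section_map f (H e0) = moduli_class g0"
      "smooth_cubic g0" "coef g0 = coefs e0" using section_at[of e0] e0 by blast
    have "moduli_class g = moduli_class g0"
      using moduli_class_eq_iff[OF g(3) g0(2)] g g0 e e0 by simp
    then show ?thesis using g g0 by (simp add: q_def)
  qed
  have "moduli_j q = k"
  proof -
    obtain g0 where g0: "section_map f (H e0) = moduli_class g0"
      "smooth_cubic g0" "coef g0 = coefs e0" using section_at[of e0] e0 by blast
    then show ?thesis using e0 moduli_j_class[OF g0(2)] by (simp add: q_def)
  qed
  moreover have "q \<in> ?Y" using sec[OF e0] by auto
  ultimately have "q \<in> W" using k by blast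
  then have "finite {H \<in> smooth_sections f. section_map f H = q}" by (rule fin)
  moreover have "H ` ?E \<subseteq> {H \<in> smooth_sections f. section_map f H = q}" using sec by auto
  ultimately have "finite (H ` ?E)" by (rule rev_finite_subset)
  then have "finite ?E" by (rule finite_imageD) (rule inj_on_subset[OF inj_H subset_UNIV])
  then show False using inf by blast
qed

end

section \<open>Cones\<close>

text \<open>The vertex is the column of \<open>A\<close> belonging to the missing variable.\<close>

lemma cone_vertex:
  assumes "is_cone f"
  obtains e :: "complex^4" where "e \<noteq> 0" "\<And>x \<mu>. pval f (x + \<mu> *s e) = pval f x"
proof -
  obtain A :: "complex^4^4" and i where A: "invertible A"
    and keys: "\<And>m. m \<in> keys (linear_subst A f) \<Longrightarrow> lookup m i = 0"
    using assms unfolding is_cone_def by blast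
  define e where "e = A *v axis i 1"
  have "e \<noteq> 0"
  proof
    assume "e = 0"
    then have "axis i (1::complex) = 0"
      using injD[OF inj_matrix_vector_mult[OF A], of "axis i 1" 0] by (simp add: e_def)
    then show False by (metis axis_nth zero_index one_neq_zero)
  qed
  moreover have "pval f (x + \<mu> *s e) = pval f x" for x \<mu>
  proof -
    define y where "y = matrix_inv A *v x"
    have x: "x = A *v y" by (simp add: y_def matrix_inv_mult_vec A)
    have x': "x + \<mu> *s e = A *v (y + \<mu> *s axis i 1)"
      by (simp add: x e_def matrix_vector_right_distrib vector_scalar_commute)
    have "monom_val (($) (y + \<mu> *s axis i 1)) m = monom_val (($) y) m"
      if "m \<in> keys (linear_subst A f)" for m
      unfolding monom_val_def
    proof (rule prod.cong)
      fix l assume "l \<in> keys m"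
      then have "l \<noteq> i" using keys[OF that] by (auto simp: in_keys_iff)
      then show "(y + \<mu> *s axis i 1) $ l ^ lookup m l = y $ l ^ lookup m l"
        by (simp add: axis_def)
    qed simp
    then have "pval (linear_subst A f) (y + \<mu> *s axis i 1) = pval (linear_subst A f) y"
      unfolding eval_poly_monom_val by (intro sum.cong) auto
    then show ?thesis unfolding x' by (simp only: x eval_linear_subst)
  qed
  ultimately show ?thesis using that by blast
qed

text \<open>At the vertex, f(e + t y) = f(t y) = t^3 f(y) has derivative 0 in every direction, so a
  section through \<open>e\<close> is singular there.\<close>

lemma vertex_notin_smooth_section:
  fixes f :: "4 mpoly"
  assumes f: "homogeneous 3 f" and e: "e \<noteq> 0" "\<And>x \<mu>. pval f (x + \<mu> *s e) = pval f x"
    and P: "smooth_form (linear_subst P f)"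
  shows "e \<notin> range ((*v) P)"
proof
  assume "e \<in> range ((*v) P)"
  then obtain z where z: "e = P *v z" by auto
  have zero: "pval f 0 = 0"
  proof -
    have "($) (0 :: complex^4) = (\<lambda>i. 0)" by auto
    then show ?thesis using eval_poly_zero[OF f] by simp
  qed
  have "pval (linear_subst P f) z = 0"
    using e(2)[of 0 1] zero by (simp add: eval_linear_subst flip: z)
  moreover have "critical (linear_subst P f) z"
    unfolding critical_linear_subst
  proof
    fix u
    have "pval f (P *v z + t *s (P *v u)) = t ^ 3 * pval f (P *v u)" for t
    proof -
      have "($) (t *s (P *v u)) = (\<lambda>i. t * (P *v u) $ i)" by auto
      then show ?thesis
        using e(2)[of "t *s (P *v u)" 1] eval_poly_scale[OF f, of t "($) (P *v u)"]
        by (simp add: add.commute flip: z)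
    qed
    then show "((\<lambda>t. pval f (P *v z + t *s (P *v u))) has_field_derivative 0) (at 0)"
      by (auto intro!: derivative_eq_intros)
  qed
  ultimately have "z = 0" using P by (auto simp: smooth_form_iff)
  then show False using e(1) z by simp
qed

text \<open>Projection from the vertex identifies any two plane sections that avoid it.\<close>

lemma cone_sections_equivalent:
  fixes f :: "4 mpoly"
  assumes e: "\<And>x \<mu>. pval f (x + \<mu> *s e) = pval f x"
    and P: "parametrizes P (proj_point a)" "e \<notin> range ((*v) P)"
    and P': "parametrizes P' (proj_point a')" "e \<notin> range ((*v) P')"
  obtains B where "invertible B" "linear_subst P' f = linear_subst B (linear_subst P f)"
proof -
  have inj: "inj ((*v) P)" "inj ((*v) P')"
    and range: "range ((*v) P) = {x. (\<Sum>i\<in>UNIV. a i * x $ i) = 0}"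
      "range ((*v) P') = {x. (\<Sum>i\<in>UNIV. a' i * x $ i) = 0}"
    using P P' by (auto simp: parametrizes_def bij_betw_def hyperplane_proj_point)
  define s where "s = (\<Sum>i\<in>UNIV. a i * e $ i)"
  have s: "s \<noteq> 0" using P(2) unfolding range s_def by simp
  obtain L where L: "L ** P = mat 1" using inj(1) matrix_left_invertible_injective by blast
  \<comment> \<open>The multiple of \<open>e\<close> that moves \<open>P' *v z\<close> into the
    plane \<open>a\<close>; dividing by \<open>s\<close> is possible because \<open>e\<close> is not
    in that plane.\<close>
  define \<mu> where "\<mu> z = - (\<Sum>i\<in>UNIV. a i * (P' *v z) $ i) / s" for z
  define w where "w j = (\<Sum>l\<in>UNIV. a l * P' $ l $ j)" for j
  define M where "M = (\<chi> i j. P' $ i $ j - w j / s * e $ i)"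
  have Mz: "M *v z = P' *v z + \<mu> z *s e" for z
  proof (unfold vec_eq_iff, rule allI)
    fix i
    have "(\<Sum>l\<in>UNIV. a l * (P' *v z) $ l) = (\<Sum>j\<in>UNIV. w j * z $ j)"
      unfolding matrix_vector_mult_def w_def
      by (simp add: sum_distrib_left sum_distrib_right mult.assoc) (rule sum.swap)
    then have "\<mu> z * e $ i = - (\<Sum>j\<in>UNIV. w j / s * e $ i * z $ j)"
      by (simp add: \<mu>_def sum_divide_distrib sum_distrib_left mult_ac)
    then show "(M *v z) $ i = (P' *v z + \<mu> z *s e) $ i"
      by (simp add: M_def matrix_vector_mult_def left_diff_distrib sum_subtractf)
  qed
  have M_range: "M *v z \<in> range ((*v) P)" for z
  proof -
    have "(\<Sum>i\<in>UNIV. a i * (M *v z) $ i) = (\<Sum>i\<in>UNIV. a i * (P' *v z) $ i) + \<mu> z * s"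
      by (simp add: Mz distrib_left sum.distrib s_def sum_distrib_left mult_ac)
    also have "\<dots> = 0" using s by (simp add: \<mu>_def)
    finally show ?thesis unfolding range by simp
  qed
  define B where "B = L ** M"
  have PB: "P *v (B *v z) = M *v z" for z
  proof -
    obtain y where y: "M *v z = P *v y" using M_range by blast
    have "B *v z = y" by (simp add: B_def y matrix_vector_mul_assoc[symmetric]) (simp add: matrix_vector_mul_assoc L)
    then show ?thesis by (simp add: y)
  qed
  \<comment> \<open>If the projection kills \<open>z\<close>, then \<open>P' *v z\<close> is a
    multiple of \<open>e\<close>, hence 0 because \<open>e\<close> is not in the second
    plane.\<close>
  have "z = 0" if "B *v z = 0" for z
  proof -
    have "P' *v z + \<mu> z *s e = 0" using PB[of z] that by (simp add: Mz)
    then have Pz: "P' *v z = (- \<mu> z) *s e" by (simp add: eq_neg_iff_add_eq_0 vec_eq_iff)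
    have "\<mu> z = 0"
    proof (rule ccontr)
      assume "\<mu> z \<noteq> 0"
      have "P' *v ((- 1 / \<mu> z) *s z) = (- 1 / \<mu> z) *s (P' *v z)" by (rule vector_scalar_commute)
      also have "\<dots> = e" unfolding Pz using \<open>\<mu> z \<noteq> 0\<close> by (simp add: vec_eq_iff)
      finally show False using P'(2) by (metis rangeI)
    qed
    then show "z = 0" using injD[OF inj(2), of z 0] Pz by simp
  qed
  then have "invertible B" by (rule invertible_if_trivial_kernel)
  moreover have "linear_subst P' f = linear_subst B (linear_subst P f)"
    by (rule eval_poly_vec_eq_imp_eq) (simp add: eval_linear_subst PB Mz e)
  ultimately show ?thesis using that by blast
qed

theorem proposition5p1:
  fixes f :: "4 mpoly"
  assumes "f \<noteq> 0" and "homogeneous 3 f"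
    and "isolated_singularities f"
  shows "(\<not> is_cone f \<longrightarrow> maximal_rank f \<and> \<not> generically_finite f) \<and>
         (is_cone f \<longrightarrow> constant_section_map f)"
proof -
  note f = \<open>homogeneous 3 f\<close>
  obtain a where a: "a \<noteq> 0" and smooth: "\<And>P. parametrizes P (proj_point (($) a)) \<Longrightarrow> smooth_form (linear_subst P f)"
    using exists_smooth_section[OF assms] by metis
  have a': "($) a \<noteq> (\<lambda>_. 0)" using a by (auto simp: vec_eq_iff fun_eq_iff)
  then obtain P where P: "parametrizes P (proj_point (($) a))" using exists_parametrization by blast
  let ?H = "proj_point (($) a)" and ?g = "linear_subst P f"
  have H: "?H \<in> proj_space UNIV" using a' by (auto simp: proj_space_def)
  have g: "smooth_cubic ?g" using smooth[OF P] f by (simp add: smooth_cubic_def homogeneous_linear_subst)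
  show ?thesis
  proof (intro conjI[of "_ \<longrightarrow> _"] impI)
    assume nc: "\<not> is_cone f"
    obtain C where C: "invertible C" "C ** graph_matrix 0 = P"
      using matrix_extending_parametrization[OF a P] by blast
    obtain c q m \<kappa> where exp: "expansion f C c q m \<kappa>" using expansion_exists[OF f] by blast
    have "coef ?g = c" using coef_section[OF f exp, of 0] by (simp add: C(2))
    then have "disc c \<noteq> 0" using smooth_cubicD(3)[OF g] by simp
    then obtain C c q m \<kappa> h where "invertible C" "expansion f C c q m \<kappa>" "disc c \<noteq> 0"
      "disc (section_coefs c q m \<kappa> h) \<noteq> 0" "j_inv (section_coefs c q m \<kappa> h) \<noteq> j_inv c"
      using modulus_nonconstant[OF f nc C(1) exp] by metis
    then interpret varying_sections f C c q m \<kappa> h by unfold_locales (use f in auto)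
    show "maximal_rank f \<and> \<not> generically_finite f"
      using maximal_rank not_generically_finite by blast
  next
    assume "is_cone f"
    then obtain e where e: "e \<noteq> 0" "\<And>x \<mu>. pval f (x + \<mu> *s e) = pval f x"
      using cone_vertex by blast
    have "section_map f H' = moduli_class ?g" if H': "H' \<in> smooth_sections f" for H'
    proof -
      obtain P' where P': "parametrizes P' H'" "smooth_cubic (linear_subst P' f)"
        "section_map f H' = moduli_class (linear_subst P' f)"
        using smooth_sections_image[OF f H'] by blast
      have "H' \<in> proj_space UNIV" using H' by (simp add: smooth_sections_def)
      then obtain b where b: "H' = proj_point b" by (rule proj_spaceE)
      have "e \<notin> range ((*v) P)" "e \<notin> range ((*v) P')"
        using vertex_notin_smooth_section[OF f e] smooth[OF P] smooth_cubicD(2)[OF P'(2)] by blast+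
      then obtain B where "invertible B" "linear_subst P' f = linear_subst B ?g"
        using cone_sections_equivalent[OF e(2) P _ P'(1)[unfolded b]] by blast
      then have "j_inv (coef (linear_subst P' f)) = j_inv (coef ?g)"
        using smooth_cubicD(1)[OF g] by (simp add: j_inv_equiv coef_equiv_linear_subst)
      then show ?thesis using P' g moduli_class_eq_iff by simp
    qed
    moreover have "?H \<in> smooth_sections f" using section_parametrization(1)[OF f P H] g by simp
    moreover have "moduli_class ?g \<in> topspace moduli_cubics" using g by (auto simp: topspace_moduli)
    ultimately show "constant_section_map f"
      unfolding constant_section_map_def by (intro bexI[of _ "moduli_class ?g"]) auto
  qed
qed

end
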